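(* Let $\Omega\subset\mathbb{R}^2$ be an open bounded domain with $0\in\Omega$. Let $\epsilon_n\to 0^+$, let $\alpha_n\to\alpha_\infty$ with $\alpha_\infty\in(-1,1)$, and let $V_n$ satisfy $$0<a\le V_n\le b<+\infty \ \text{ in } \Omega,\qquad V_n\in C^0(\Omega),\qquad V_n\to V \ \text{ locally uniformly in } \Omega,$$ where $a,b$ are constants independent of $n$. Assume that $v_n$ is a sequence of solutions of $$-\Delta v_n=\left(\epsilon_n^2+|x|^2\right)^{\alpha_n}V_n(x)\,e^{v_n}\qquad\text{in }\Omega .$$ Then, for any $$C_1>\max\left\{1,\tfrac{1+\alpha_\infty}{1-\alpha_\infty}\right\}$$ and for any compact set $K\subset\Omega$, there exists a constant $C_2>0$, which depends only on $a$, $b$, $\mathrm{dist}(K,\partial\Omega)$, $\alpha_\infty$ and on the uniform modulus of continuity of $V$ on $K$, such that $$\sup_{K} v_n + C_1\inf_{\Omega} v_n\le C_2 .$$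
   Context: All sequences are indexed by $n\in\mathbb{N}$, and $\epsilon_n\to0^+$ means $\epsilon_n>0$ and $\epsilon_n\to0$ as $n\to+\infty$. $|x|$ denotes the Euclidean norm in $\mathbb{R}^2$ and $\Delta$ is the Laplacian in $\mathbb{R}^2$.
   Formalization: C_2 with the stated dependence serves all large n (for every n, C_2 may depend on Ω and the sequences, not on v_n); it may also depend on C_1 and, if α_∞<0, on a bound for |x| on Ω; the modulus of continuity of V compares points of K with points of Ω. *)

theory Defs
  imports "HOL-Analysis.Analysis"
begin

definition partial :: "'a::euclidean_space \<Rightarrow> ('a \<Rightarrow> real) \<Rightarrow> 'a \<Rightarrow> real" where
  "partial e f x = frechet_derivative f (at x) e"

definition laplacian :: "('a::euclidean_space \<Rightarrow> real) \<Rightarrow> 'a \<Rightarrow> real" where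
  "laplacian f x = (\<Sum>e\<in>Basis. partial e (partial e f) x)"

primrec Ck :: "nat \<Rightarrow> ('a::euclidean_space \<Rightarrow> real) \<Rightarrow> bool" where
  "Ck 0 f \<longleftrightarrow> continuous_on UNIV f"
| "Ck (Suc k) f \<longleftrightarrow> f differentiable_on UNIV \<and> (\<forall>e\<in>Basis. Ck k (partial e f))"

definition test_function :: "'a::euclidean_space set \<Rightarrow> ('a \<Rightarrow> real) \<Rightarrow> bool" where
  "test_function \<Omega> \<phi> \<longleftrightarrow>
     (\<forall>k. Ck k \<phi>) \<and> compact (closure {x. \<phi> x \<noteq> 0}) \<and> closure {x. \<phi> x \<noteq> 0} \<subseteq> \<Omega>"

(* - Delta v = f in Omega in the sense of distributions.  For merely continuous V the solutions of
   - Delta v = W e^v need not be C^2; they do have a continuous representative, and v denotes it, so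
   that pointwise suprema and infima of v make sense. *)
definition solves_poisson ::
  "'a::euclidean_space set \<Rightarrow> ('a \<Rightarrow> real) \<Rightarrow> ('a \<Rightarrow> real) \<Rightarrow> bool" where
  "solves_poisson \<Omega> v f \<longleftrightarrow> continuous_on \<Omega> v \<and>
     (\<forall>\<phi>. test_function \<Omega> \<phi> \<longrightarrow>
        (LINT x:\<Omega>|lborel. v x * (- laplacian \<phi> x)) = (LINT x:\<Omega>|lborel. f x * \<phi> x))"

definition liouville_solution ::
  "(real^2) set \<Rightarrow> real \<Rightarrow> real \<Rightarrow> (real^2 \<Rightarrow> real) \<Rightarrow> (real^2 \<Rightarrow> real) \<Rightarrow> bool" where
  "liouville_solution \<Omega> \<epsilon> \<alpha> V v \<longleftrightarrow>
     solves_poisson \<Omega> v (\<lambda>x. (\<epsilon>\<^sup>2 + (norm x)\<^sup>2) powr \<alpha> * V x * exp (v x))"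

definition admissible_domain :: "(real^2) set \<Rightarrow> bool" where
  "admissible_domain \<Omega> \<longleftrightarrow> open \<Omega> \<and> connected \<Omega> \<and> bounded \<Omega> \<and> 0 \<in> \<Omega>"

definition admissible_coefficients ::
  "(real^2) set \<Rightarrow> real \<Rightarrow> real \<Rightarrow> real \<Rightarrow> (nat \<Rightarrow> real) \<Rightarrow> (nat \<Rightarrow> real) \<Rightarrow>
   (nat \<Rightarrow> real^2 \<Rightarrow> real) \<Rightarrow> (real^2 \<Rightarrow> real) \<Rightarrow> bool" where
  "admissible_coefficients \<Omega> a b \<alpha>lim \<epsilon> \<alpha> Vn V \<longleftrightarrow>
     (\<forall>n. \<epsilon> n > 0) \<and> \<epsilon> \<longlonglongrightarrow> 0 \<and> \<alpha> \<longlonglongrightarrow> \<alpha>lim \<and>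
     (\<forall>n. \<forall>x\<in>\<Omega>. a \<le> Vn n x \<and> Vn n x \<le> b) \<and>
     (\<forall>n. continuous_on \<Omega> (Vn n)) \<and>
     (\<forall>S. compact S \<and> S \<subseteq> \<Omega> \<longrightarrow> uniform_limit S Vn V sequentially)"

(* Uniform modulus of continuity, at the points of K, of V as a function on Omega: only one of the
   two points is confined to K.  Comparing points of K only would give no information for K = {p}. *)
definition modulus_of_continuity_on ::
  "(real \<Rightarrow> real) \<Rightarrow> (real^2) set \<Rightarrow> (real^2) set \<Rightarrow> (real^2 \<Rightarrow> real) \<Rightarrow> bool" where
  "modulus_of_continuity_on \<omega> K \<Omega> V \<longleftrightarrow>
     (\<omega> \<longlongrightarrow> 0) (at_right 0) \<and> (\<forall>x\<in>K. \<forall>y\<in>\<Omega>. \<bar>V x - V y\<bar> \<le> \<omega> (dist x y))"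

(* Extended real, since the infimum over the open set Omega may be -\<infinity>. *)
definition sup_plus_inf ::
  "real \<Rightarrow> (real^2) set \<Rightarrow> (real^2) set \<Rightarrow> (real^2 \<Rightarrow> real) \<Rightarrow> ereal" where
  "sup_plus_inf C K \<Omega> v = (SUP x\<in>K. ereal (v x)) + ereal C * (INF x\<in>\<Omega>. ereal (v x))"

end

theory Submission
  imports Defs "HOL-Real_Asymp.Real_Asymp"
begin

text \<open>
  Testing the equation against radial functions gives an exact formula: \<open>v x\<close> is the mean of \<open>v\<close> over
  a disc of radius \<open>r\<close> plus the integral of \<open>f = (\<epsilon>\<^sup>2 + |x|\<^sup>2)\<^sup>\<alpha> V e\<^sup>v\<close> against a truncated logarithmic
  kernel. So if \<open>f\<close> has mass \<open>m\<close> within distance \<open>\<delta>\<close> of a point \<open>x\<^sub>0\<close>, then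
  \<open>inf v \<le> v x\<^sub>0 - m/(2\<pi>) ln (1/\<delta>) + O(1)\<close>, and what is needed is a lower bound for the mass at the
  scale of a peak of \<open>v\<close>: almost \<open>8\<pi>\<close> if the origin is far away in units of this scale, and almost
  \<open>8\<pi> (1 + min 0 \<alpha>)\<close> otherwise. The hypothesis on \<open>C\<^sub>1\<close> is exactly what makes the resulting powers of
  \<open>e\<^sup>v\<close> add up to something bounded in both cases.

  No limiting equation is used for the mass bound. Since \<open>e\<^sup>t \<ge> 1 + t\<close>, for \<open>s > 1\<close> the integral of
  \<open>f x (v (s x) - v x)\<close> over a disc is at most the difference between the dilated and the original
  mass. Inserting the mean value formula and symmetrizing in \<open>x\<close> and \<open>y\<close>, the same integral is at
  least \<open>- m\<^sup>2 ln s / (4\<pi>) - o(s - 1)\<close>, because \<open>|s x - y| |s y - x|\<close> is at most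
  \<open>s |x - y|\<^sup>2 + (s - 1)\<^sup>2 (|x|\<^sup>2 + |y|\<^sup>2) / 2\<close>. For \<open>s\<close> near \<open>1\<close> this is a Pohozaev inequality which needs
  neither derivatives of \<open>v\<close> or \<open>V\<close> nor control at infinity.
\<close>

section \<open>Radial test functions\<close>

text \<open>If passing from the radius R to s R added no mass, the Pohozaev inequality divided by ln
  s times the mass m within R would read M \<ge> 8 pi (1 - \<beta>) as s tends to 1, where M is the
  total mass and s^(2 \<beta>) bounds the loss of the weight under dilation. Such a radius is found
  by pigeonhole among many geometric steps, one of which adds only a small share of the mass. Small
  has to mean small against m, so m needs a positive lower bound that is fixed before the range of
  radii and the size of the disc; it comes from the unit disc about the peak, where no large radius
  occurs. A second obstacle is uniformity in \<epsilon>: near the origin the ratio of \<epsilon> to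
  the blow-up scale may be arbitrarily small, so the rescaled density is controlled only by |y|^(-p)
  with p < 2 from above and by a multiple of |y|^2 e^u from below. The estimate is local: a
  tolerance for the oscillation of V is fixed by a, b, C1 and the limit exponent alone, and the
  radius on which V stays within it is chosen afterwards. Finitely many n are handled by absorbing
  the weight into the coefficient.\<close>

lemma partial_eq: "(f has_derivative f') (at x) \<Longrightarrow> partial e f x = f' e"
  unfolding partial_def using frechet_derivative_at by metis

text \<open>\<open>Ck\<close> speaks of \<open>frechet_derivative\<close>, a choice operator.
  Supplying an explicit derivative here keeps that operator out of the inductions that
  follow.\<close>

lemma Ck_SucI:
  assumes "\<And>x. (f has_derivative f' x) (at x)" "\<And>e. e \<in> Basis \<Longrightarrow> Ck k (\<lambda>x. f' x e)"
  shows "Ck (Suc k) f"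
proof -
  have "partial e f = (\<lambda>x. f' x e)" for e
    using assms(1) partial_eq by blast
  then show ?thesis
    using assms by (auto simp: differentiable_on_def differentiable_def intro!: exI assms(1))
qed

lemma Ck_SucD:
  assumes "Ck (Suc k) f"
  shows "(f has_derivative frechet_derivative f (at x)) (at x)" "e \<in> Basis \<Longrightarrow> Ck k (partial e f)"
  using assms by (auto simp: differentiable_on_def frechet_derivative_works)

lemma Ck_mono: "Ck (Suc k) f \<Longrightarrow> Ck k f"
proof (induction k arbitrary: f)
  case 0
  then show ?case using differentiable_imp_continuous_on by auto
next
  case (Suc k)
  then show ?case by (metis Ck.simps(2))
qed

lemma Ck_imp_continuous: "Ck k f \<Longrightarrow> continuous_on UNIV f"
  by (cases k) (auto intro: differentiable_imp_continuous_on)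

lemma Ck_const: "Ck k (\<lambda>x. c)"
proof (induction k arbitrary: c)
  case (Suc k)
  show ?case by (rule Ck_SucI[where f'="\<lambda>_ _. 0"]) (auto simp: Suc)
qed simp

lemma Ck_add: "Ck k f \<Longrightarrow> Ck k g \<Longrightarrow> Ck k (\<lambda>x. f x + g x)"
proof (induction k arbitrary: f g)
  case 0
  then show ?case by (auto intro: continuous_on_add)
next
  case (Suc k)
  show ?case
    by (rule Ck_SucI[OF has_derivative_add[OF Ck_SucD(1)[OF Suc.prems(1)] Ck_SucD(1)[OF Suc.prems(2)]]])
       (use Suc in \<open>auto simp: partial_def[abs_def]\<close>)
qed

lemma Ck_mult: "Ck k f \<Longrightarrow> Ck k g \<Longrightarrow> Ck k (\<lambda>x. f x * g x)"
proof (induction k arbitrary: f g)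
  case 0
  then show ?case by (auto intro: continuous_on_mult)
next
  case (Suc k)
  have "Ck k f" "Ck k g" using Suc.prems Ck_mono by auto
  then show ?case
    by (intro Ck_SucI[OF has_derivative_mult[OF Ck_SucD(1)[OF Suc.prems(1)] Ck_SucD(1)[OF Suc.prems(2)]]]
        Ck_add Suc.IH)
       (use Suc.prems in \<open>auto simp: partial_def[abs_def]\<close>)
qed

lemma Ck_uminus: "Ck k f \<Longrightarrow> Ck k (\<lambda>x. - f x)"
  using Ck_mult[OF Ck_const[of k "-1"], of f] by simp

lemma Ck_diff: "Ck k f \<Longrightarrow> Ck k g \<Longrightarrow> Ck k (\<lambda>x. f x - g x)"
  using Ck_add[of k f "\<lambda>x. - g x"] Ck_uminus by auto

lemma Ck_cmult: "Ck k f \<Longrightarrow> Ck k (\<lambda>x. c * f x)"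
  by (rule Ck_mult[OF Ck_const])

lemma Ck_inner: "Ck k (\<lambda>x. (x - a) \<bullet> e)"
proof (induction k)
  case (Suc k)
  show ?case
    by (rule Ck_SucI[where f'="\<lambda>x h. h \<bullet> e"]) (auto intro!: derivative_eq_intros Ck_const)
qed (auto intro!: continuous_intros)

lemma Ck_real_SucI:
  fixes g :: "real \<Rightarrow> real"
  assumes "\<And>t. (g has_real_derivative g' t) (at t)" "Ck k g'"
  shows "Ck (Suc k) g"
  using assms by (intro Ck_SucI[where f'="\<lambda>t h. g' t * h"]) (auto simp: has_field_derivative_def)

lemma Ck_real_SucD:
  fixes g :: "real \<Rightarrow> real"
  assumes "Ck (Suc k) g"
  shows "(g has_real_derivative partial 1 g t) (at t)" "Ck k (partial 1 g)"
proof -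
  have "g differentiable at t" using assms by (auto simp: differentiable_on_def)
  then have "(g has_real_derivative deriv g t) (at t)"
    by (simp add: DERIV_deriv_iff_real_differentiable)
  moreover from partial_eq[OF this[unfolded has_field_derivative_def], of 1]
  have "partial 1 g t = deriv g t" by simp
  ultimately show "(g has_real_derivative partial 1 g t) (at t)" by simp
  show "Ck k (partial 1 g)" using assms by simp
qed

lemma has_derivative_norm_sq:
  "((\<lambda>x. (norm (x - a))\<^sup>2) has_derivative (\<lambda>h. 2 * ((x - a) \<bullet> h))) (at x)"
  unfolding power2_norm_eq_inner
  by (auto intro!: derivative_eq_intros simp: inner_commute)

lemma has_derivative_radial:
  fixes g :: "real \<Rightarrow> real"
  assumes "\<And>t. (g has_real_derivative g' t) (at t)"
  shows "((\<lambda>x. g ((norm (x - a))\<^sup>2)) has_derivative (\<lambda>h. g' ((norm (x - a))\<^sup>2) * (2 * ((x - a) \<bullet> h)))) (at x)"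
  using has_derivative_compose[OF has_derivative_norm_sq assms[unfolded has_field_derivative_def], of a x] .

text \<open>Radial functions are written as profiles of the squared distance, because the distance
  itself is not differentiable at the centre.\<close>

lemma Ck_radial:
  fixes g :: "real \<Rightarrow> real" and a :: "'a::euclidean_space"
  assumes "Ck k g"
  shows "Ck k (\<lambda>x. g ((norm (x - a))\<^sup>2))"
  using assms
proof (induction k arbitrary: g)
  case 0
  then show ?case by (auto intro!: continuous_on_compose2[of UNIV g] continuous_intros)
next
  case (Suc k)
  show ?case
    by (rule Ck_SucI[OF has_derivative_radial[OF Ck_real_SucD(1)[OF Suc.prems]]])
       (intro Ck_mult Suc.IH Ck_real_SucD(2)[OF Suc.prems] Ck_cmult Ck_inner Ck_const)
qed

lemma laplacian_radial:
  fixes g g' g'' :: "real \<Rightarrow> real" and a :: "'a::euclidean_space"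
  assumes g: "\<And>t. (g has_real_derivative g' t) (at t)" "\<And>t. (g' has_real_derivative g'' t) (at t)"
  shows "laplacian (\<lambda>x. g ((norm (x - a))\<^sup>2)) x =
    2 * real DIM('a) * g' ((norm (x - a))\<^sup>2) + 4 * (norm (x - a))\<^sup>2 * g'' ((norm (x - a))\<^sup>2)"
proof -
  define q where "q = (norm (x - a))\<^sup>2"
  have 1: "partial e (\<lambda>x. g ((norm (x - a))\<^sup>2)) = (\<lambda>x. g' ((norm (x - a))\<^sup>2) * (2 * ((x - a) \<bullet> e)))" for e
    using partial_eq[OF has_derivative_radial[OF g(1)]] by blast
  have 2: "partial e (\<lambda>x. g' ((norm (x - a))\<^sup>2) * (2 * ((x - a) \<bullet> e))) x
     = 2 * g' q + 4 * ((x - a) \<bullet> e)\<^sup>2 * g'' q" if "e \<in> Basis" for e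
  proof -
    have "((\<lambda>x. 2 * ((x - a) \<bullet> e)) has_derivative (\<lambda>h. 2 * (h \<bullet> e))) (at x)"
      by (auto intro!: derivative_eq_intros)
    from partial_eq[OF has_derivative_mult[OF has_derivative_radial[OF g(2)] this]]
    show ?thesis using that by (simp add: q_def power2_eq_square)
  qed
  have "laplacian (\<lambda>x. g ((norm (x - a))\<^sup>2)) x = (\<Sum>e\<in>Basis. 2 * g' q + 4 * ((x - a) \<bullet> e)\<^sup>2 * g'' q)"
    unfolding laplacian_def 1 by (simp add: 2)
  also have "\<dots> = 2 * DIM('a) * g' q + 4 * (\<Sum>e\<in>Basis. ((x - a) \<bullet> e)\<^sup>2) * g'' q"
    by (simp add: sum.distrib sum_distrib_left sum_distrib_right)
  also have "(\<Sum>e\<in>Basis. ((x - a) \<bullet> e)\<^sup>2) = q"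
    unfolding q_def power2_norm_eq_inner by (subst (2) euclidean_inner) (simp add: power2_eq_square)
  finally show ?thesis by (simp add: q_def)
qed

text \<open>The quotient vanishes on t \<le> \<open>t0\<close> and is smooth for t > 0. The
  induction closes because the derivative h'/t - (h/t)/t again consists of quotients whose
  numerators vanish up to \<open>t0\<close>.\<close>

lemma Ck_divide_id:
  fixes h :: "real \<Rightarrow> real"
  assumes "t0 > 0" "\<And>t. t \<le> t0 \<Longrightarrow> h t = 0" "Ck k h"
  shows "Ck k (\<lambda>t. h t / t)"
  using assms(2,3)
proof (induction k arbitrary: h)
  case 0
  have "continuous_on ({..t0} \<union> {t0..}) (\<lambda>t. h t / t)"
  proof (rule continuous_on_closed_Un)
    show "continuous_on {..t0} (\<lambda>t. h t / t)"
      by (rule continuous_on_eq[OF continuous_on_const[of _ 0]]) (use 0 in auto)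
    show "continuous_on {t0..} (\<lambda>t. h t / t)"
      using 0 assms(1) by (intro continuous_on_divide continuous_on_id) (auto intro: continuous_on_subset)
  qed auto
  moreover have "{..t0} \<union> {t0..} = (UNIV::real set)" by auto
  ultimately show ?case by simp
next
  case (Suc k)
  let ?h' = "partial 1 h"
  note d = Ck_real_SucD(1)[OF Suc.prems(2)]
  have loc: "((\<lambda>t. f t) has_real_derivative 0) (at t)" if "\<And>t. t \<le> t0 \<Longrightarrow> f t = (0::real)" "t < t0" for f t
  proof (rule has_field_derivative_transform_within[where d="t0-t" and f="\<lambda>_. 0"])
  qed (use that in \<open>auto simp: dist_real_def\<close>)
  have z0: "?h' t = 0" if "t < t0" for t
    using loc[of h t] d[of t] Suc.prems(1) that DERIV_unique by blast
  \<comment> \<open>At \<open>t0\<close> itself h is known to vanish on one side only, so h'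
    \<open>t0\<close> = 0 is read off from the left limit of the continuous function h'.\<close>
  have "isCont ?h' t0"
    using Ck_imp_continuous[OF Ck_real_SucD(2)[OF Suc.prems(2)]]
    by (simp add: continuous_on_eq_continuous_at)
  then have cont: "(?h' \<longlongrightarrow> ?h' t0) (at_left t0)"
    unfolding isCont_def by (simp add: filterlim_at_split)
  have "(?h' \<longlongrightarrow> 0) (at_left t0)"
    by (rule tendsto_eventually, rule eventually_at_leftI[of "t0-1"]) (auto simp: z0)
  then have "?h' t0 = 0"
    using tendsto_unique[OF trivial_limit_at_left_real cont] by simp
  then have z: "?h' t = 0" if "t \<le> t0" for t using z0 that by (cases "t = t0") auto
  have "((\<lambda>t. h t / t) has_real_derivative (?h' t / t - (h t / t) / t)) (at t)" for t
  proof (cases "t < t0")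
    case True
    then show ?thesis using loc[of "\<lambda>t. h t / t" t] Suc.prems(1) z by simp
  next
    case False
    then show ?thesis using assms(1) by (auto intro!: derivative_eq_intros d simp: field_simps power2_eq_square)
  qed
  then show ?case
  proof (rule Ck_real_SucI)
    have 1: "Ck k (\<lambda>t. h t / t)" by (rule Suc.IH[OF Suc.prems(1) Ck_mono[OF Suc.prems(2)]])
    have 2: "Ck k (\<lambda>t. h t / t / t)" using Suc.IH[of "\<lambda>t. h t / t"] Suc.prems 1 by auto
    have 3: "Ck k (\<lambda>t. ?h' t / t)" using Suc.IH[of ?h'] z Ck_real_SucD(2)[OF Suc.prems(2)] by auto
    show "Ck k (\<lambda>t. ?h' t / t - (h t / t) / t)" by (rule Ck_diff[OF 3 2])
  qed
qed

text \<open>The index n makes the family closed under differentiation up to linear combinations, so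
  smoothness of exp (-1/t) follows by a single induction over all n at once.\<close>

definition flat_exp :: "nat \<Rightarrow> real \<Rightarrow> real" where
  "flat_exp n t = (if t > 0 then exp (- 1 / t) / t ^ n else 0)"

lemma flat_exp_tendsto_0: "(flat_exp n \<longlongrightarrow> 0) (at 0)"
proof (subst filterlim_at_split, rule conjI)
  show "(flat_exp n \<longlongrightarrow> 0) (at_left 0)"
    by (rule tendsto_eventually) (auto simp: flat_exp_def eventually_at_left_field intro!: exI[of _ "-1"])
  have "((\<lambda>t. inverse t ^ n / exp (inverse t)) \<longlongrightarrow> (0::real)) (at_right 0)"
    by (rule filterlim_compose[OF tendsto_power_div_exp_0 filterlim_inverse_at_top_right])
  moreover have "\<forall>\<^sub>F t in at_right 0. inverse t ^ n / exp (inverse t) = flat_exp n t"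
    by (rule eventually_at_rightI[of 0 1]) (auto simp: flat_exp_def exp_minus field_simps)
  ultimately show "(flat_exp n \<longlongrightarrow> 0) (at_right 0)" using Lim_transform_eventually by blast
qed

lemma flat_exp_deriv:
  "(flat_exp n has_real_derivative flat_exp (n + 2) t - n * flat_exp (n + 1) t) (at t)"
proof -
  consider "t > 0" | "t < 0" | "t = 0" by linarith
  then show ?thesis
  proof cases
    case 1
    have "((\<lambda>t. exp (- 1 / t) / t ^ n) has_real_derivative
        exp (- 1 / t) / t ^ (n+2) - n * (exp (- 1 / t) / t ^ (n+1))) (at t)"
      using 1
      by (auto intro!: derivative_eq_intros simp: field_simps power2_eq_square)
        (cases n; auto simp: field_simps)
    then have "(flat_exp n has_real_derivative
        exp (- 1 / t) / t ^ (n+2) - n * (exp (- 1 / t) / t ^ (n+1))) (at t)"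
      by (rule has_field_derivative_transform_within[where d=t]) (use 1 in \<open>auto simp: flat_exp_def dist_real_def\<close>)
    then show ?thesis using 1 by (simp add: flat_exp_def)
  next
    case 2
    have "(flat_exp n has_real_derivative 0) (at t)"
      by (rule has_field_derivative_transform_within[where d="-t" and f="\<lambda>_. 0"]) (use 2 in \<open>auto simp: flat_exp_def dist_real_def\<close>)
    then show ?thesis using 2 by (simp add: flat_exp_def)
  next
    case 3
    have "(\<lambda>h. (flat_exp n (0 + h) - flat_exp n 0) / h) = flat_exp (n+1)"
      by (auto simp: flat_exp_def fun_eq_iff)
    then have "(flat_exp n has_real_derivative 0) (at 0)"
      unfolding DERIV_def using flat_exp_tendsto_0[of "n+1"] by (simp only: )
    then show ?thesis using 3 by (simp add: flat_exp_def)
  qed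
qed

lemma Ck_flat_exp: "Ck k (flat_exp n)"
proof (induction k arbitrary: n)
  case 0
  show ?case using DERIV_isCont[OF flat_exp_deriv] by (auto simp: continuous_at_imp_continuous_on)
next
  case (Suc k)
  show ?case
    by (rule Ck_real_SucI[OF flat_exp_deriv]) (intro Ck_diff Ck_cmult Suc)
qed

lemma Ck_affine: "Ck k g \<Longrightarrow> Ck k (\<lambda>t::real. g (c * t + d))"
proof (induction k arbitrary: g)
  case 0
  then show ?case by (auto intro!: continuous_on_compose2[of UNIV g] continuous_intros)
next
  case (Suc k)
  have "((\<lambda>t. g (c * t + d)) has_real_derivative c * partial 1 g (c * t + d)) (at t)" for t
  proof -
    have "((\<lambda>t. c * t + d) has_real_derivative c) (at t)"
      by (auto intro!: derivative_eq_intros)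
    from DERIV_chain2[OF Ck_real_SucD(1)[OF Suc.prems] this] show ?thesis by (simp add: mult.commute)
  qed
  then show ?case
    by (rule Ck_real_SucI) (intro Ck_cmult Suc.IH Ck_real_SucD(2)[OF Suc.prems])
qed

text \<open>A smooth approximation of the indicator of (0,1) from below. It has no plateau: both
  factors stay below 1 and tend to 1 only because their arguments grow with j. That it vanishes for
  t \<le> 1/j is what later permits a division by t.\<close>

definition bump :: "nat \<Rightarrow> real \<Rightarrow> real" where
  "bump j t = flat_exp 0 (real j * t - 1) * flat_exp 0 (real j - real j * t)"

lemma Ck_bump: "Ck k (bump j)"
  unfolding bump_def[abs_def]
  using Ck_affine[OF Ck_flat_exp, of k 0 "real j" "-1"] Ck_affine[OF Ck_flat_exp, of k 0 "- real j" "real j"]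
  by (intro Ck_mult) (auto simp: algebra_simps)

lemma flat_exp_0_bounds: "0 \<le> flat_exp 0 t" "flat_exp 0 t \<le> 1"
  by (auto simp: flat_exp_def)

lemma bump_bounds: "0 \<le> bump j t" "bump j t \<le> 1"
  unfolding bump_def using flat_exp_0_bounds by (auto intro: mult_le_one)

lemma bump_eq_0: "j > 0 \<Longrightarrow> t \<le> 1 / j \<Longrightarrow> bump j t = 0" "t \<ge> 1 \<Longrightarrow> bump j t = 0"
proof -
  show "bump j t = 0" if "j > 0" "t \<le> 1 / j"
    using that by (auto simp: bump_def flat_exp_def field_simps)
  show "bump j t = 0" if "t \<ge> 1"
  proof -
    have "real j * 1 \<le> real j * t" using that by (intro mult_left_mono) auto
    then show ?thesis by (simp add: bump_def flat_exp_def)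
  qed
qed

lemma bump_tendsto: "(\<lambda>j. bump j t) \<longlonglongrightarrow> indicator {0<..<1} t"
proof (cases "t \<in> {0<..<1}")
  case True
  then have t: "0 < t" "t < 1" by auto
  have lim: "(\<lambda>j. flat_exp 0 (real j * c - d)) \<longlonglongrightarrow> 1" if "c > 0" for c d :: real
  proof -
    have "filterlim (\<lambda>j. real j * c - d) at_top sequentially"
      using that by real_asymp
    then have f: "filterlim (\<lambda>j. real j * c - d) at_top sequentially" .
    have "((\<lambda>s. exp (- 1 / s)) \<longlongrightarrow> 1) (at_top :: real filter)"
      by real_asymp
    from filterlim_compose[OF this f]
    have "(\<lambda>j. exp (- 1 / (real j * c - d))) \<longlonglongrightarrow> 1" by simp
    moreover have "\<forall>\<^sub>F j in sequentially. exp (- 1 / (real j * c - d)) = flat_exp 0 (real j * c - d)"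
      using f[unfolded filterlim_at_top_dense, rule_format, of 0] by (rule eventually_mono) (simp add: flat_exp_def)
    ultimately show ?thesis by (rule Lim_transform_eventually)
  qed
  have "(\<lambda>j. flat_exp 0 (real j * t - 1) * flat_exp 0 (real j * (1 - t) - 0)) \<longlonglongrightarrow> 1 * 1"
    using t by (intro tendsto_mult lim) auto
  then show ?thesis using True by (simp add: bump_def[abs_def] algebra_simps)
next
  case False
  have "bump j t = 0" if "j > 0" for j
  proof (cases "t \<le> 0")
    case True
    then have "t \<le> 1 / real j" by (rule order_trans) simp
    then show ?thesis using bump_eq_0(1) that by blast
  next
    case t: False
    then show ?thesis using False bump_eq_0(2) by auto
  qed
  then have "\<forall>\<^sub>F j in sequentially. bump j t = 0"
    by (intro eventually_mono[OF eventually_gt_at_top[of 0]])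
  then show ?thesis using False by (simp add: tendsto_eventually)
qed

section \<open>The mean value formula of a distributional solution\<close>

lemma deriv_zero_above:
  fixes g :: "real \<Rightarrow> real"
  assumes "(g has_real_derivative d) (at t)" "\<And>s. s \<ge> c \<Longrightarrow> g s = 0" "t > c"
  shows "d = 0"
proof -
  have "(g has_real_derivative 0) (at t)"
    by (rule has_field_derivative_transform_within[where d="t-c" and f="\<lambda>_. 0"])
      (use assms in \<open>auto simp: dist_real_def\<close>)
  then show ?thesis using assms(1) DERIV_unique by blast
qed

text \<open>In dimension two the Laplacian of g (|x - a|^2) is 4 (g' + t g'') = 4 (t g')' at t = |x
  - a|^2. Since g vanishes from \<rho>^2 on, its first two derivatives vanish strictly beyond, and
  both integrals live on the closed disc.\<close>

lemma poisson_radial: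
  fixes g g' g'' :: "real \<Rightarrow> real" and a :: "real^2"
  assumes sol: "solves_poisson \<Omega> v F" and sub: "cball a \<rho> \<subseteq> \<Omega>" and "0 < \<rho>"
    and Ck: "\<And>k. Ck k g"
    and g: "\<And>t. (g has_real_derivative g' t) (at t)" "\<And>t. (g' has_real_derivative g'' t) (at t)"
    and z: "\<And>t. t \<ge> \<rho>\<^sup>2 \<Longrightarrow> g t = 0"
  defines "q \<equiv> \<lambda>x. (norm (x - a))\<^sup>2"
  shows "(LINT x|lborel. indicator (cball a \<rho>) x * v x * (- 4 * (g' (q x) + q x * g'' (q x)))) =
         (LINT x|lborel. indicator (cball a \<rho>) x * F x * g (q x))"
proof -
  define \<phi> where "\<phi> x = g (q x)" for x
  have lap: "laplacian \<phi> x = 4 * (g' (q x) + q x * g'' (q x))" for x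
    using laplacian_radial[OF g, of a x] by (simp add: \<phi>_def[abs_def] q_def algebra_simps)
  have q_ge: "q x > \<rho>\<^sup>2" if "x \<notin> cball a \<rho>" for x
    using that \<open>0 < \<rho>\<close> by (auto simp: q_def dist_norm norm_minus_commute intro!: power_strict_mono)
  have z': "g' t = 0" if "t > \<rho>\<^sup>2" for t using deriv_zero_above[OF g(1) z that] .
  \<comment> \<open>The vanishing of g' is known only strictly above \<rho>^2; the midpoint provides
    a closed half line of zeros that starts below t.\<close>
  have z'': "g'' t = 0" if "t > \<rho>\<^sup>2" for t
  proof (rule deriv_zero_above[OF g(2), where c="(t + \<rho>\<^sup>2)/2"])
    show "g' s = 0" if "s \<ge> (t + \<rho>\<^sup>2)/2" for s using z' that \<open>t > \<rho>\<^sup>2\<close> by auto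
  qed (use that in auto)
  have supp: "{x. \<phi> x \<noteq> 0} \<subseteq> cball a \<rho>"
    using z q_ge unfolding \<phi>_def by (metis (mono_tags, lifting) mem_Collect_eq order_less_imp_le subsetI)
  then have clo: "closure {x. \<phi> x \<noteq> 0} \<subseteq> cball a \<rho>" by (simp add: closure_minimal)
  have "test_function \<Omega> \<phi>"
    unfolding test_function_def
  proof (intro conjI allI)
    show "Ck k \<phi>" for k unfolding \<phi>_def[abs_def] q_def by (rule Ck_radial[OF Ck])
    show "compact (closure {x. \<phi> x \<noteq> 0})"
      using supp bounded_subset[OF bounded_cball] by (simp add: compact_closure)
    show "closure {x. \<phi> x \<noteq> 0} \<subseteq> \<Omega>" using clo sub by auto
  qed
  then have eq: "(LINT x:\<Omega>|lborel. v x * (- laplacian \<phi> x)) = (LINT x:\<Omega>|lborel. F x * \<phi> x)"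
    using sol by (auto simp: solves_poisson_def)
  have 1: "indicator \<Omega> x *\<^sub>R (v x * (- laplacian \<phi> x)) =
      indicator (cball a \<rho>) x * v x * (- 4 * (g' (q x) + q x * g'' (q x)))" for x
    using sub z'[OF q_ge[of x]] z''[OF q_ge[of x]] by (auto simp: lap indicator_def)
  have 2: "indicator \<Omega> x *\<^sub>R (F x * \<phi> x) = indicator (cball a \<rho>) x * F x * g (q x)" for x
    using sub supp by (auto simp: \<phi>_def indicator_def)
  show ?thesis using eq unfolding set_lebesgue_integral_def 1 2 .
qed

section \<open>Truncated logarithms as limits of smooth radial profiles\<close>

lemma continuous_antiderivative:
  fixes h :: "real \<Rightarrow> real"
  assumes "continuous_on UNIV h"
  obtains H where "\<And>t. (H has_real_derivative h t) (at t)" "H c = 0"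
proof -
  have "\<exists>F. \<forall>x :: real. -\<infinity> < ereal x \<longrightarrow> ereal x < \<infinity> \<longrightarrow> (F has_vector_derivative h x) (at x)"
    by (rule einterval_antiderivative) (use assms in \<open>auto simp: continuous_on_eq_continuous_at\<close>)
  then obtain F where F: "\<And>x. (F has_real_derivative h x) (at x)"
    by (auto simp: has_real_derivative_iff_has_vector_derivative)
  have "((\<lambda>t. F t - F c) has_real_derivative h t) (at t)" for t
    by (auto intro!: derivative_eq_intros F)
  then show thesis using that[of "\<lambda>t. F t - F c"] by auto
qed

lemma integral_by_antiderivative:
  fixes H :: "real \<Rightarrow> real"
  assumes "\<And>t. (H has_real_derivative h t) (at t)" "a \<le> b"
  shows "(h has_integral (H b - H a)) {a..b}"
  using assms
  by (intro fundamental_theorem_of_calculus)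
     (auto simp: has_real_derivative_iff_has_vector_derivative intro: has_vector_derivative_at_within)

definition ramp :: "real \<Rightarrow> real" where "ramp t = min t 1"

text \<open>Integrating (t g')' once gives t g'. \<open>P j\<close> is this first integral when (t
  g')' is the cutoff \<open>bump j\<close>, and \<open>ramp\<close> is its limit when (t g')' is the
  indicator of (0,1).\<close>

lemma bump_antiderivative:
  obtains P :: "nat \<Rightarrow> real \<Rightarrow> real" where
    "\<And>j t. (P j has_real_derivative bump j t) (at t)"
    "\<And>j t. t \<ge> 1 \<Longrightarrow> P j t = P j 1"
    "\<And>j t. j > 0 \<Longrightarrow> t \<le> 1 / real j \<Longrightarrow> P j t = 0"
    "\<And>j t. t \<ge> 0 \<Longrightarrow> 0 \<le> P j t \<and> P j t \<le> t"
    "\<And>t. t \<ge> 0 \<Longrightarrow> (\<lambda>j. P j t) \<longlonglongrightarrow> ramp t"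
proof -
  have "\<exists>H. (\<forall>t. (H has_real_derivative bump j t) (at t)) \<and> H 0 = 0" for j
    using continuous_antiderivative[OF Ck_imp_continuous[OF Ck_bump[of 0 j]], of 0] by metis
  then obtain P where P: "\<And>j t. (P j has_real_derivative bump j t) (at t)" "\<And>j. P j 0 = 0"
    by metis
  have hi: "(bump j has_integral (P j t - P j s)) {s..t}" if "s \<le> t" for j s t
    using integral_by_antiderivative[OF P(1) that] .
  have eq0: "P j t = P j s" if "s \<le> t" "\<And>u. u \<in> {s..t} \<Longrightarrow> bump j u = 0" for j s t
    using has_integral_unique[OF hi[OF that(1), of j] has_integral_is_0[of "{s..t}"]] that by simp
  have bd: "0 \<le> P j t \<and> P j t \<le> t" if "t \<ge> 0" for j t
  proof
    show "0 \<le> P j t" using has_integral_nonneg[OF hi[OF that, of j]] bump_bounds P(2) by auto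
    show "P j t \<le> t"
      using has_integral_le[OF hi[OF that, of j] has_integral_const_real[of 1 0 t]] bump_bounds P(2) that by auto
  qed
  have "(\<lambda>j. P j t) \<longlonglongrightarrow> ramp t" if "t \<ge> 0" for t
  proof -
    have ii: "(indicator {0<..<1} has_integral ramp t) {0..t}"
    proof -
      have "((\<lambda>x. 1::real) has_integral ramp t) {0..ramp t}"
        using has_integral_const_real[of "1::real" 0 "ramp t"] that by (simp add: ramp_def)
      then have "((\<lambda>x. if x \<in> {0..ramp t} then 1 else 0 :: real) has_integral ramp t) {0..t}"
        using has_integral_restrict_closed_subinterval[where b=1] 
        by (subst has_integral_restrict) (auto simp: ramp_def)
      then show ?thesis
        by (rule has_integral_spike_finite[of "{0,1,t}", rotated 2]) (auto simp: ramp_def indicator_def split: if_splits)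
    qed
    have "(\<lambda>j. integral {0..t} (bump j)) \<longlonglongrightarrow> integral {0..t} (indicator {0<..<1})"
      by (rule dominated_convergence(2)[where h="\<lambda>_. 1"])
        (use hi[OF that] bump_bounds bump_tendsto in \<open>auto simp: has_integral_iff\<close>)
    moreover have "integral {0..t} (bump j) = P j t" for j
      using hi[OF that, of j] P(2) by (simp add: has_integral_iff)
    ultimately show ?thesis using ii by (simp add: has_integral_iff)
  qed
  then show thesis
  proof (intro that[OF P(1) _ _ bd])
    show "P j t = P j 1" if "t \<ge> 1" for j t
      by (rule eq0) (use that bump_eq_0(2) in auto)
    show "P j t = 0" if "j > 0" "t \<le> 1 / real j" for j t
    proof (cases "t \<ge> 0")
      case True
      have "P j t = P j 0" by (rule eq0) (use that True bump_eq_0(1) in auto)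
      then show ?thesis using P by simp
    next
      case False
      have "P j 0 = P j t"
      proof (rule eq0)
        show "bump j u = 0" if "u \<in> {t..0}" for u
          by (rule bump_eq_0(1)[OF \<open>j > 0\<close>]) (use that in \<open>auto intro: order_trans[of _ 0]\<close>)
      qed (use False in auto)
      then show ?thesis using P by simp
    qed
  qed auto
qed

lemma Ck_antiderivative:
  fixes H :: "real \<Rightarrow> real"
  assumes "\<And>t. (H has_real_derivative h t) (at t)" "\<And>k. Ck k h"
  shows "Ck k H"
  using Ck_real_SucI[OF assms(1,2)] Ck_mono by blast

text \<open>The logarithm ln (1/t), corrected so that both value and slope vanish at t = 1. On (0,1)
  it satisfies t g' = t - 1, hence (t g')' = 1: with t = |z|^2/r^2 its Laplacian is constant on the
  disc apart from a point mass at the centre. Testing with it therefore produces a disc mean and no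
  boundary term.\<close>

definition log_defect :: "real \<Rightarrow> real" where
  "log_defect t = (if 0 < t \<and> t < 1 then ln (1 / t) - 1 + t else 0)"

text \<open>Identifies the limit of the smooth profiles with the difference of two
  \<open>log_defect\<close> terms. For t < r0 the interval is split at r0, where the first ramp
  saturates and the integrand turns from a constant into 1/u - 1/r1.\<close>

lemma ramp_integral:
  assumes "0 < r0" "r0 < r1" "0 < t" "t \<le> r1"
  shows "((\<lambda>u. (ramp (u / r0) - ramp (u / r1)) / u) has_integral (log_defect (t / r1) - log_defect (t / r0))) {t..r1}"
proof -
  have A: "((\<lambda>u. (ramp (u / r0) - ramp (u / r1)) / u) has_integral (ln (r1 / s) - 1 + s / r1)) {s..r1}"
    if "r0 \<le> s" "s \<le> r1" for s
  proof -
    have "((\<lambda>u. 1 / u - 1 / r1) has_integral ((ln r1 - r1 / r1) - (ln s - s / r1))) {s..r1}"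
      by (rule fundamental_theorem_of_calculus)
        (use assms that in \<open>auto intro!: derivative_eq_intros
          simp: has_real_derivative_iff_has_vector_derivative[symmetric] divide_simps\<close>)
    then have "((\<lambda>u. 1 / u - 1 / r1) has_integral (ln (r1 / s) - 1 + s / r1)) {s..r1}"
      using assms that by (simp add: ln_div algebra_simps)
    then show ?thesis
      by (rule has_integral_eq[rotated]) (use assms that in \<open>auto simp: ramp_def min_def field_simps\<close>)
  qed
  show ?thesis
  proof (cases "r0 \<le> t")
    case True
    then show ?thesis using A[OF True assms(4)] assms by (auto simp: log_defect_def divide_simps)
  next
    case False
    have "((\<lambda>u. (1 / r0 - 1 / r1)) has_integral (r0 - t) * (1 / r0 - 1 / r1)) {t..r0}"
      using has_integral_const_real[of "1 / r0 - 1 / r1" t r0] False by simp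
    then have B: "((\<lambda>u. (ramp (u / r0) - ramp (u / r1)) / u) has_integral ((r0 - t) * (1 / r0 - 1 / r1))) {t..r0}"
      by (rule has_integral_eq[rotated]) (use assms False in \<open>auto simp: ramp_def min_def field_simps\<close>)
    have "((\<lambda>u. (ramp (u / r0) - ramp (u / r1)) / u) has_integral
        ((r0 - t) * (1 / r0 - 1 / r1) + (ln (r1 / r0) - 1 + r0 / r1))) {t..r1}"
      by (rule has_integral_combine[OF _ _ B A]) (use False assms in auto)
    moreover have "(r0 - t) * (1 / r0 - 1 / r1) + (ln (r1 / r0) - 1 + r0 / r1) = log_defect (t / r1) - log_defect (t / r0)"
      using False assms by (auto simp: log_defect_def ln_div field_simps)
    ultimately show ?thesis by simp
  qed
qed

text \<open>The normalisation makes minus the Laplacian equal to a unit point mass minus the uniform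
  probability density of the disc of radius r. At z = 0 the value is 0 instead of infinity, which
  concerns a null set only.\<close>

definition green_ker :: "real \<Rightarrow> real^2 \<Rightarrow> real" where
  "green_ker r z = log_defect ((norm z)\<^sup>2 / r\<^sup>2) / (4 * pi)"

definition disc_mean :: "real \<Rightarrow> (real^2 \<Rightarrow> real) \<Rightarrow> real^2 \<Rightarrow> real" where
  "disc_mean r v a = (LINT x:ball a r|lborel. v x) / (pi * r\<^sup>2)"

lemma log_defect_borel [measurable]: "log_defect \<in> borel_measurable borel"
  unfolding log_defect_def[abs_def] by measurable

lemma green_ker_borel [measurable]: "green_ker r \<in> borel_measurable borel"
  unfolding green_ker_def[abs_def] by measurable

text \<open>One \<open>log_defect\<close> is singular at 0 and cannot be tested with; in the
  difference of two, at r0 < r1, the logarithms cancel near 0. The approximants are built from the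
  equation: up to sign, t g' is the difference of two antiderivatives of bumps, which vanishes near
  0, so g' stays smooth after division by t, and g is the antiderivative that vanishes at r1. The
  index \<open>Suc j\<close> avoids \<open>bump 0\<close>, which has no zero interval to the right
  of 0.\<close>

lemma log_defect_approximation:
  assumes "0 < r0" "r0 < r1"
  obtains g g' g'' :: "nat \<Rightarrow> real \<Rightarrow> real" where
    "\<And>j k. Ck k (g j)"
    "\<And>j t. (g j has_real_derivative g' j t) (at t)"
    "\<And>j t. (g' j has_real_derivative g'' j t) (at t)"
    "\<And>j t. t \<ge> r1 \<Longrightarrow> g j t = 0"
    "\<And>j t. g' j t + t * g'' j t = bump (Suc j) (t / r1) / r1 - bump (Suc j) (t / r0) / r0"
    "\<And>j t. 0 \<le> t \<Longrightarrow> \<bar>g j t\<bar> \<le> (1 / r0 + 1 / r1) * r1"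
    "\<And>t. 0 < t \<Longrightarrow> (\<lambda>j. g j t) \<longlonglongrightarrow> log_defect (t / r1) - log_defect (t / r0)"
proof -
  obtain P where P: "\<And>j t. (P j has_real_derivative bump j t) (at t)"
    "\<And>j t. t \<ge> 1 \<Longrightarrow> P j t = P j 1"
    "\<And>j t. j > 0 \<Longrightarrow> t \<le> 1 / real j \<Longrightarrow> P j t = 0"
    "\<And>j t. t \<ge> 0 \<Longrightarrow> 0 \<le> P j t \<and> P j t \<le> t"
    "\<And>t. t \<ge> 0 \<Longrightarrow> (\<lambda>j. P j t) \<longlonglongrightarrow> ramp t"
    by (rule bump_antiderivative) (rule that; assumption)
  define Q where "Q j t = P (Suc j) (t / r0) - P (Suc j) (t / r1)" for j t
  define h where "h j t = Q j t / t" for j t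
  have CkP: "Ck k (P j)" for j k by (rule Ck_antiderivative[OF P(1) Ck_bump])
  have CkQ: "Ck k (Q j)" for j k
    unfolding Q_def[abs_def]
    using Ck_affine[OF CkP, of k "Suc j" "1/r0" 0] Ck_affine[OF CkP, of k "Suc j" "1/r1" 0]
    by (intro Ck_diff) auto
  have Q0: "Q j t = 0" if "t \<le> r0 / real (Suc j)" for j t
  proof -
    have "t / r0 \<le> 1 / real (Suc j)" using that assms by (simp add: field_simps)
    moreover have "t / r1 \<le> 1 / real (Suc j)"
    proof -
      have "t \<le> r1 / real (Suc j)" using that assms
        by (meson divide_right_mono less_eq_real_def of_nat_0_le_iff order_trans)
      then show ?thesis using assms by (simp add: field_simps)
    qed
    ultimately show ?thesis using P(3)[of "Suc j"] by (simp add: Q_def)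
  qed
  have Ckh: "Ck k (h j)" for j k
    unfolding h_def[abs_def]
    by (rule Ck_divide_id[OF _ Q0 CkQ]) (use assms in auto)
  have "\<exists>G. (\<forall>t. (G has_real_derivative h j t) (at t)) \<and> G r1 = 0" for j
    using continuous_antiderivative[OF Ck_imp_continuous[OF Ckh[of 0 j]], of r1] by metis
  then obtain G where G: "\<And>j t. (G j has_real_derivative h j t) (at t)" "\<And>j. G j r1 = 0" by metis
  have Qz: "Q j t = 0" if "t \<ge> r1" for j t
    using P(2)[of "t / r0" "Suc j"] P(2)[of "t / r1" "Suc j"] that assms by (simp add: Q_def)
  have dQ: "(Q j has_real_derivative bump (Suc j) (t / r0) / r0 - bump (Suc j) (t / r1) / r1) (at t)" for j t
  proof -
    have "((\<lambda>t. P (Suc j) (t / r)) has_real_derivative bump (Suc j) (t / r) * (1 / r)) (at t)" if "r > 0" for r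
      by (rule DERIV_chain2[OF P(1)]) (use that in \<open>auto intro!: derivative_eq_intros\<close>)
    from DERIV_diff[OF this[of r0] this[of r1]] show ?thesis using assms by (simp add: Q_def[abs_def])
  qed
  have dh: "(h j has_real_derivative partial 1 (h j) t) (at t)" for j t
    by (rule Ck_real_SucD(1)[OF Ckh])
  have rel: "h j t + t * partial 1 (h j) t = bump (Suc j) (t / r0) / r0 - bump (Suc j) (t / r1) / r1" for j t
  proof -
    have "(\<lambda>t. t * h j t) = Q j" using Q0[of 0 j] assms by (auto simp: h_def fun_eq_iff)
    moreover have "((\<lambda>t. t * h j t) has_real_derivative h j t + t * partial 1 (h j) t) (at t)"
      by (auto intro!: derivative_eq_intros dh)
    ultimately show ?thesis using dQ[of j t] DERIV_unique by metis
  qed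
  have hb: "\<bar>h j u\<bar> \<le> 1 / r0 + 1 / r1" if "u \<ge> 0" for j u
  proof (cases "u = 0")
    case True
    then show ?thesis using assms by (simp add: h_def)
  next
    case False
    have "0 \<le> P (Suc j) (u / r0)" "P (Suc j) (u / r0) \<le> u / r0" "0 \<le> P (Suc j) (u / r1)" "P (Suc j) (u / r1) \<le> u / r1"
      using P(4)[of "u / r0" "Suc j"] P(4)[of "u / r1" "Suc j"] that assms by auto
    then have "\<bar>Q j u\<bar> \<le> u / r0 + u / r1" unfolding Q_def by linarith
    then show ?thesis using False that by (simp add: h_def abs_mult field_simps abs_divide)
  qed
  have hi: "(h j has_integral (- G j t)) {t..r1}" if "t \<le> r1" for j t
    using integral_by_antiderivative[OF G(1) that, of j] G(2) by simp
  have Gz: "G j t = 0" if "t \<ge> r1" for j t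
  proof -
    have "(h j has_integral (G j t - G j r1)) {r1..t}"
      by (rule integral_by_antiderivative[OF G(1) that])
    moreover have "(h j has_integral 0) {r1..t}"
      by (rule has_integral_is_0) (use Qz in \<open>auto simp: h_def\<close>)
    ultimately have "G j t - G j r1 = 0" by (rule has_integral_unique)
    then show ?thesis using G(2) by simp
  qed
  have Gb: "\<bar>G j t\<bar> \<le> (1 / r0 + 1 / r1) * r1" if "0 \<le> t" for j t
  proof (cases "t \<le> r1")
    case True
    have "norm (- G j t) \<le> (1 / r0 + 1 / r1) * measure lborel {t..r1}"
      by (rule has_integral_bound_real[OF _ _ hi[OF True], of _ "{}"]) (use hb that assms in auto)
    also have "\<dots> \<le> (1 / r0 + 1 / r1) * r1" using that True assms by (intro mult_left_mono) auto
    finally show ?thesis by simp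
  next
    case False
    then have "G j t = 0" by (intro Gz) auto
    then show ?thesis using assms by auto
  qed
  have lim: "(\<lambda>j. - G j t) \<longlonglongrightarrow> log_defect (t / r1) - log_defect (t / r0)" if "0 < t" for t
  proof (cases "t \<le> r1")
    case True
    have "(\<lambda>j. integral {t..r1} (h j)) \<longlonglongrightarrow> integral {t..r1} (\<lambda>u. (ramp (u / r0) - ramp (u / r1)) / u)"
    proof (rule dominated_convergence(2)[where h="\<lambda>_. 1 / r0 + 1 / r1"])
      show "h j integrable_on {t..r1}" for j using hi[OF True] by (auto simp: has_integral_iff)
      show "(\<lambda>j. h j u) \<longlonglongrightarrow> (ramp (u / r0) - ramp (u / r1)) / u" if "u \<in> {t..r1}" for u
        unfolding h_def Q_def using that \<open>0 < t\<close> assms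
        by (intro tendsto_divide tendsto_diff tendsto_const LIMSEQ_Suc[OF P(5)]) auto
    qed (use hb that in auto)
    moreover have "integral {t..r1} (h j) = - G j t" for j using hi[OF True] by (simp add: has_integral_iff)
    moreover have "integral {t..r1} (\<lambda>u. (ramp (u / r0) - ramp (u / r1)) / u) = log_defect (t / r1) - log_defect (t / r0)"
      using ramp_integral[OF assms that True] by (simp add: has_integral_iff)
    ultimately show ?thesis by simp
  next
    case False
    then show ?thesis using Gz[of t] assms by (auto simp: log_defect_def)
  qed
  show thesis
  proof (rule that[of "\<lambda>j t. - G j t" "\<lambda>j t. - h j t" "\<lambda>j t. - partial 1 (h j) t"])
    show "Ck k (\<lambda>t. - G j t)" for j k by (intro Ck_uminus Ck_antiderivative[OF G(1) Ckh])
    show "((\<lambda>t. - G j t) has_real_derivative - h j t) (at t)" for j t by (intro DERIV_minus G)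
    show "((\<lambda>t. - h j t) has_real_derivative - partial 1 (h j) t) (at t)" for j t by (intro DERIV_minus dh)
    show "- h j t + t * - partial 1 (h j) t = bump (Suc j) (t / r1) / r1 - bump (Suc j) (t / r0) / r0" for j t
      using rel[of j t] by simp
  qed (use Gz Gb lim in auto)
qed

lemma integrable_on_cball:
  fixes v :: "real^2 \<Rightarrow> real"
  assumes "continuous_on (cball a r) v"
  shows "integrable lborel (\<lambda>x. indicator (cball a r) x * v x)"
  using borel_integrable_compact[OF compact_cball assms] by simp

text \<open>The equation is tested with the smooth approximants and j tends to infinity. By
  dominated convergence the side with v turns into the two disc means and the side with F into the
  two kernels; pointwise convergence at the centre a is unknown, but {a} is a null set.\<close>

lemma disc_mean_diff:
  fixes a :: "real^2"
  assumes sol: "solves_poisson \<Omega> v F" and F: "continuous_on \<Omega> F"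
    and sub: "cball a \<rho> \<subseteq> \<Omega>" and r: "0 < \<sigma>" "\<sigma> < \<rho>"
  shows "disc_mean \<sigma> v a = disc_mean \<rho> v a +
    (LINT x|lborel. indicator (cball a \<rho>) x * F x * (green_ker \<rho> (x - a) - green_ker \<sigma> (x - a)))"
proof -
  define q where "q x = (norm (x - a))\<^sup>2" for x
  have qm [measurable]: "q \<in> borel_measurable borel" unfolding q_def[abs_def] by measurable
  define vB where "vB x = indicator (cball a \<rho>) x * v x" for x
  define FB where "FB x = indicator (cball a \<rho>) x * F x" for x
  have vi: "integrable lborel vB" unfolding vB_def[abs_def]
    by (rule integrable_on_cball) (use sol sub in \<open>auto simp: solves_poisson_def intro: continuous_on_subset\<close>)
  have Fi: "integrable lborel FB" unfolding FB_def[abs_def]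
    by (rule integrable_on_cball) (use F sub in \<open>auto intro: continuous_on_subset\<close>)
  have [measurable]: "vB \<in> borel_measurable borel" "FB \<in> borel_measurable borel" using vi Fi by auto
  have rr: "0 < \<sigma>\<^sup>2" "\<sigma>\<^sup>2 < \<rho>\<^sup>2" using r by (auto intro: power_strict_mono)
  obtain g g' g'' where g:
    "\<And>j k. Ck k (g j)"
    "\<And>j t. (g j has_real_derivative g' j t) (at t)"
    "\<And>j t. (g' j has_real_derivative g'' j t) (at t)"
    "\<And>j t. t \<ge> \<rho>\<^sup>2 \<Longrightarrow> g j t = 0"
    "\<And>j t. g' j t + t * g'' j t = bump (Suc j) (t / \<rho>\<^sup>2) / \<rho>\<^sup>2 - bump (Suc j) (t / \<sigma>\<^sup>2) / \<sigma>\<^sup>2"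
    "\<And>j t. 0 \<le> t \<Longrightarrow> \<bar>g j t\<bar> \<le> (1 / \<sigma>\<^sup>2 + 1 / \<rho>\<^sup>2) * \<rho>\<^sup>2"
    "\<And>t. 0 < t \<Longrightarrow> (\<lambda>j. g j t) \<longlonglongrightarrow> log_defect (t / \<rho>\<^sup>2) - log_defect (t / \<sigma>\<^sup>2)"
    by (rule log_defect_approximation[OF rr]) (rule that; assumption)
  have [measurable]: "bump j \<in> borel_measurable borel" for j
    by (rule borel_measurable_continuous_onI[OF Ck_imp_continuous[OF Ck_bump[of 0]]])
  have [measurable]: "g j \<in> borel_measurable borel" for j
    by (rule borel_measurable_continuous_onI[OF Ck_imp_continuous[OF g(1)[of 0]]])
  define L where "L j = (\<lambda>x. vB x * (4 * (bump (Suc j) (q x / \<sigma>\<^sup>2) / \<sigma>\<^sup>2 - bump (Suc j) (q x / \<rho>\<^sup>2) / \<rho>\<^sup>2)))" for j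
  define L' where "L' = (\<lambda>x. vB x * (4 * (indicator {0<..<1} (q x / \<sigma>\<^sup>2) / \<sigma>\<^sup>2 - indicator {0<..<1} (q x / \<rho>\<^sup>2) / \<rho>\<^sup>2)))"
  define R where "R j = (\<lambda>x. FB x * g j (q x))" for j
  define R' where "R' = (\<lambda>x. FB x * (log_defect (q x / \<rho>\<^sup>2) - log_defect (q x / \<sigma>\<^sup>2)))"
  have eq: "(\<integral>x. L j x \<partial>lborel) = (\<integral>x. R j x \<partial>lborel)" for j
  proof -
    have "0 < \<rho>" using r by simp
    have "- 4 * (g' j (q x) + q x * g'' j (q x)) = 4 * (bump (Suc j) (q x / \<sigma>\<^sup>2) / \<sigma>\<^sup>2 - bump (Suc j) (q x / \<rho>\<^sup>2) / \<rho>\<^sup>2)" for x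
      unfolding g(5) by simp
    then show ?thesis
      using poisson_radial[OF sol sub \<open>0 < \<rho>\<close> g(1)[of _ j] g(2-4)] unfolding L_def R_def vB_def FB_def q_def by simp
  qed
  have LL: "(\<lambda>j. \<integral>x. L j x \<partial>lborel) \<longlonglongrightarrow> (\<integral>x. L' x \<partial>lborel)"
  proof (rule integral_dominated_convergence[where w="\<lambda>x. \<bar>vB x\<bar> * (4 * (1 / \<sigma>\<^sup>2 + 1 / \<rho>\<^sup>2))"])
    show "AE x in lborel. (\<lambda>j. L j x) \<longlonglongrightarrow> L' x"
      unfolding L_def L'_def by (intro AE_I2 tendsto_intros LIMSEQ_Suc[OF bump_tendsto]) (use r in auto)
    show "AE x in lborel. norm (L j x) \<le> \<bar>vB x\<bar> * (4 * (1 / \<sigma>\<^sup>2 + 1 / \<rho>\<^sup>2))" for j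
    proof (rule AE_I2)
      fix x
      have b: "0 \<le> bump (Suc j) (q x / s\<^sup>2) / s\<^sup>2 \<and> bump (Suc j) (q x / s\<^sup>2) / s\<^sup>2 \<le> 1 / s\<^sup>2" if "s > 0" for s
        using bump_bounds[of "Suc j" "q x / s\<^sup>2"] that by (auto intro: divide_right_mono)
      have "\<bar>4 * (bump (Suc j) (q x / \<sigma>\<^sup>2) / \<sigma>\<^sup>2 - bump (Suc j) (q x / \<rho>\<^sup>2) / \<rho>\<^sup>2)\<bar> \<le> 4 * (1 / \<sigma>\<^sup>2 + 1 / \<rho>\<^sup>2)"
        using b[of \<sigma>] b[of \<rho>] r by (simp add: abs_le_iff)
      then show "norm (L j x) \<le> \<bar>vB x\<bar> * (4 * (1 / \<sigma>\<^sup>2 + 1 / \<rho>\<^sup>2))"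
        unfolding L_def by (simp only: real_norm_def abs_mult) (intro mult_left_mono, auto simp: abs_mult)
    qed
    show "integrable lborel (\<lambda>x. \<bar>vB x\<bar> * (4 * (1 / \<sigma>\<^sup>2 + 1 / \<rho>\<^sup>2)))" using vi by simp
  qed (auto simp: L_def L'_def)
  have RR: "(\<lambda>j. \<integral>x. R j x \<partial>lborel) \<longlonglongrightarrow> (\<integral>x. R' x \<partial>lborel)"
  proof (rule integral_dominated_convergence[where w="\<lambda>x. \<bar>FB x\<bar> * ((1 / \<sigma>\<^sup>2 + 1 / \<rho>\<^sup>2) * \<rho>\<^sup>2)"])
    show "AE x in lborel. (\<lambda>j. R j x) \<longlonglongrightarrow> R' x"
      using AE_lborel_singleton[of a]
    proof eventually_elim
      case (elim x)
      then have "0 < q x" by (simp add: q_def)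
      then show ?case unfolding R_def R'_def by (intro tendsto_intros g(7))
    qed
    show "AE x in lborel. norm (R j x) \<le> \<bar>FB x\<bar> * ((1 / \<sigma>\<^sup>2 + 1 / \<rho>\<^sup>2) * \<rho>\<^sup>2)" for j
      unfolding R_def by (intro AE_I2) (simp only: real_norm_def abs_mult, intro mult_left_mono g(6), auto simp: q_def)
    show "integrable lborel (\<lambda>x. \<bar>FB x\<bar> * ((1 / \<sigma>\<^sup>2 + 1 / \<rho>\<^sup>2) * \<rho>\<^sup>2))" using Fi by simp
  qed (auto simp: R_def R'_def)
  have main: "(\<integral>x. L' x \<partial>lborel) = (\<integral>x. R' x \<partial>lborel)"
    using LIMSEQ_unique[OF LL] RR unfolding eq by simp
  have si: "set_integrable lborel (ball a s) v" if "s \<le> \<rho>" for s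
  proof -
    have "set_integrable lborel (cball a \<rho>) v" using vi by (simp add: vB_def[abs_def] set_integrable_def)
    then show ?thesis by (rule set_integrable_subset) (use that in auto)
  qed
  have L'eq: "(\<integral>x. L' x \<partial>lborel) = 4 * pi * (disc_mean \<sigma> v a - disc_mean \<rho> v a)"
  proof -
    have "AE x in lborel. L' x = 4 / \<sigma>\<^sup>2 * (indicator (ball a \<sigma>) x *\<^sub>R v x) - 4 / \<rho>\<^sup>2 * (indicator (ball a \<rho>) x *\<^sub>R v x)"
      using AE_lborel_singleton[of a]
    proof eventually_elim
      case (elim x)
      have "(q x / s\<^sup>2 \<in> {0<..<1}) = (x \<in> ball a s)" if "s > 0" for s
      proof -
        have "(q x < s\<^sup>2) = (norm (x - a) < s)"
          unfolding q_def using that power_strict_mono[of "norm (x-a)" s 2] power_mono[of s "norm (x-a)" 2]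
          by (auto simp: not_less[symmetric])
        moreover have "0 < q x" using elim by (simp add: q_def)
        ultimately show ?thesis using that by (auto simp: dist_norm norm_minus_commute)
      qed
      then have "(indicator {0<..<1} (q x / s\<^sup>2) :: real) = indicator (ball a s) x" if "s > 0" for s
        using that by (auto simp: indicator_def)
      then show ?case using r unfolding L'_def vB_def by (auto simp: indicator_def algebra_simps)
    qed
    then have "(\<integral>x. L' x \<partial>lborel) = (\<integral>x. 4 / \<sigma>\<^sup>2 * (indicator (ball a \<sigma>) x *\<^sub>R v x) - 4 / \<rho>\<^sup>2 * (indicator (ball a \<rho>) x *\<^sub>R v x) \<partial>lborel)"
      using si[of \<sigma>] si[of \<rho>] r
      by (intro integral_cong_AE) (auto simp: L'_def set_integrable_def)
    also have "\<dots> = 4 / \<sigma>\<^sup>2 * (LINT x:ball a \<sigma>|lborel. v x) - 4 / \<rho>\<^sup>2 * (LINT x:ball a \<rho>|lborel. v x)"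
      using si[of \<sigma>] si[of \<rho>] r
      by (subst Bochner_Integration.integral_diff) (auto simp: set_lebesgue_integral_def set_integrable_def)
    finally show ?thesis by (simp add: disc_mean_def right_diff_distrib)
  qed
  have "R' x = (4 * pi) * (indicator (cball a \<rho>) x * F x * (green_ker \<rho> (x - a) - green_ker \<sigma> (x - a)))" for x
    by (simp add: R'_def FB_def green_ker_def q_def right_diff_distrib)
  then have "(\<integral>x. R' x \<partial>lborel) = 4 * pi *
    (LINT x|lborel. indicator (cball a \<rho>) x * F x * (green_ker \<rho> (x - a) - green_ker \<sigma> (x - a)))"
    by (simp only: integral_mult_right_zero)
  with main L'eq have "disc_mean \<sigma> v a - disc_mean \<rho> v a = (LINT x|lborel. indicator (cball a \<rho>) x * F x * (green_ker \<rho> (x - a) - green_ker \<sigma> (x - a)))"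
    by simp
  then show ?thesis by simp
qed

section \<open>Affine substitution and integrable power singularities\<close>

lemma lborel_integral_affine:
  fixes f :: "'a::euclidean_space \<Rightarrow> real"
  assumes [measurable]: "f \<in> borel_measurable borel" and "c > 0"
  shows "(\<integral>x. f x \<partial>lborel) = c ^ DIM('a) * (\<integral>x. f (t + c *\<^sub>R x) \<partial>lborel)"
proof -
  have "(\<integral>x. f x \<partial>lborel) = (\<integral>x. f x \<partial>(density (distr lborel borel (\<lambda>x. t + c *\<^sub>R x)) (\<lambda>_. \<bar>c\<bar> ^ DIM('a))))"
    using lborel_affine[of c t] assms(2) by simp
  also have "\<dots> = (\<integral>x. c ^ DIM('a) *\<^sub>R f x \<partial>distr lborel borel (\<lambda>x. t + c *\<^sub>R x))"
    using assms(2) by (subst integral_density) auto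
  also have "\<dots> = (\<integral>x. c ^ DIM('a) *\<^sub>R f (t + c *\<^sub>R x) \<partial>lborel)"
    by (subst integral_distr) auto
  finally show ?thesis by simp
qed

lemma lborel_integrable_affine:
  fixes f :: "'a::euclidean_space \<Rightarrow> real"
  assumes "integrable lborel f" and "c > 0"
  shows "integrable lborel (\<lambda>x. f (t + c *\<^sub>R x))"
proof -
  have [measurable]: "f \<in> borel_measurable borel" using assms by auto
  have "integrable (density (distr lborel borel (\<lambda>x. t + c *\<^sub>R x)) (\<lambda>_. \<bar>c\<bar> ^ DIM('a))) f"
    using lborel_affine[of c t] assms by simp
  then have "integrable (distr lborel borel (\<lambda>x. t + c *\<^sub>R x)) (\<lambda>x. c ^ DIM('a) *\<^sub>R f x)"
    using assms(2) by (subst (asm) integrable_density) auto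
  then have "integrable (distr lborel borel (\<lambda>x. t + c *\<^sub>R x)) f" using assms(2) by simp
  then show ?thesis by (subst (asm) integrable_distr_eq) auto
qed

lemma lborel_integral_shift:
  fixes f :: "'a::euclidean_space \<Rightarrow> real"
  assumes "f \<in> borel_measurable borel"
  shows "(\<integral>x. f (x - a) \<partial>lborel) = (\<integral>x. f x \<partial>lborel)"
  using lborel_integral_affine[OF assms, of 1 "-a"] by simp

lemma lborel_integrable_shift:
  fixes f :: "'a::euclidean_space \<Rightarrow> real"
  shows "integrable lborel f \<Longrightarrow> integrable lborel (\<lambda>x. f (x - a))"
  using lborel_integrable_affine[of f 1 "-a"] by simp

text \<open>A dyadic decomposition takes the place of polar coordinates: on the shell r/2^(k+1)
  \<le> |z| < r/2^k the integrand is at most \<open>c k\<close>, and the discs containing these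
  shells contribute a geometric series of ratio 2^(p-2) < 1.\<close>

lemma integrable_norm_powr_disc:
  assumes p: "0 \<le> p" "p < 2"
  shows "integrable lborel (\<lambda>z::real^2. indicator (ball 0 r) z * norm z powr (-p))"
proof (cases "r > 0")
  case r: True
  define f where "f z = indicator (ball 0 r) z * norm z powr (-p)" for z :: "real^2"
  define c where "c k = (r / 2 ^ Suc k) powr (-p)" for k :: nat
  have [measurable]: "f \<in> borel_measurable borel" unfolding f_def[abs_def]
    by (intro borel_measurable_times borel_measurable_indicator powr_real_measurable) auto
  have le: "ennreal (f z) \<le> (\<Sum>k. ennreal (c k) * indicator (ball 0 (r / 2 ^ k)) z)" for z
  proof (cases "0 < norm z \<and> norm z < r")
    case True
    obtain n where "(1/2) ^ n < norm z / r"
      using real_arch_pow_inv[of "norm z / r" "1/2"] True r by auto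
    then have "r < norm z * 2 ^ n" using r True by (simp add: field_simps power_divide)
    also have "\<dots> \<le> norm z * 2 ^ Suc n" by (intro mult_left_mono) auto
    finally have n: "r / 2 ^ Suc n \<le> norm z" by (simp add: field_simps)
    \<comment> \<open>Minimality of the index gives \<open>norm z < r / 2 ^ k\<close> as well, so z
      lies in the k-th shell.\<close>
    define k where "k = (LEAST n. r / 2 ^ Suc n \<le> norm z)"
    have k1: "r / 2 ^ Suc k \<le> norm z" unfolding k_def by (rule LeastI[of _ n]) (rule n)
    have k2: "norm z < r / 2 ^ k"
    proof (cases k)
      case (Suc m)
      then have "\<not> r / 2 ^ Suc m \<le> norm z" using not_less_Least[of m "\<lambda>n. r / 2 ^ Suc n \<le> norm z"]
        by (simp add: k_def)
      then show ?thesis using Suc by simp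
    qed (use True in auto)
    have "f z \<le> c k" unfolding f_def c_def using k1 p True \<open>r > 0\<close> less_trans[of 0 "norm z" r]
      by (auto simp: indicator_def intro!: powr_mono2' divide_pos_pos)
    then have "ennreal (f z) \<le> ennreal (c k) * indicator (ball 0 (r / 2 ^ k)) z"
      using k2 by (simp add: ennreal_leI)
    also have "\<dots> \<le> (\<Sum>k. ennreal (c k) * indicator (ball 0 (r / 2 ^ k)) z)"
    proof -
      have "G k \<le> suminf G" for G :: "nat \<Rightarrow> ennreal"
        using sum_le_suminf[OF summableI, of "{k}" G] by simp
      then show ?thesis .
    qed
    finally show ?thesis .
  next
    case False
    then have "f z = 0" by (auto simp: f_def)
    then show ?thesis by simp
  qed
  have "(\<integral>\<^sup>+z. ennreal (f z) \<partial>lborel) \<le> (\<integral>\<^sup>+(z::real^2). (\<Sum>k. ennreal (c k) * indicator (ball 0 (r / 2 ^ k)) z) \<partial>lborel)"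
    by (intro nn_integral_mono le)
  also have "\<dots> = (\<Sum>k. ennreal (c k) * emeasure lborel (ball (0::real^2) (r / 2 ^ k)))"
  proof (subst nn_integral_suminf)
    show "(\<lambda>z. ennreal (c k) * indicator (ball 0 (r / 2 ^ k)) z) \<in> borel_measurable (lborel :: (real^2) measure)" for k
      by (intro borel_measurable_times_ennreal borel_measurable_const borel_measurable_indicator) auto
  qed (simp add: nn_integral_cmult_indicator)
  also have "\<dots> = (\<Sum>k. ennreal (c k * (pi * (r / 2 ^ k)\<^sup>2)))"
    using r by (simp add: emeasure_ball unit_ball_vol_2 ennreal_mult c_def)
  also have "\<dots> = (\<Sum>k. ennreal ((pi * r powr (2 - p) * 2 powr p) * (2 powr (p - 2)) ^ k))"
  proof -
    have "c k * (pi * (r / 2 ^ k)\<^sup>2) = (pi * r powr (2 - p) * 2 powr p) * (2 powr (p - 2)) ^ k" for k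
    proof -
      have pw: "(2 ^ n) powr p = (2 powr p) ^ n" for n :: nat
        by (induction n) (auto simp: powr_mult)
      have c1: "c k = r powr (-p) * (2 powr p * (2 powr p) ^ k)"
      proof -
        have "c k = r powr (-p) / (2 ^ Suc k) powr (-p)"
          unfolding c_def by (rule powr_divide)
        also have "\<dots> = r powr (-p) * (2 ^ Suc k) powr p"
          by (simp only: powr_minus divide_inverse inverse_inverse_eq)
        also have "\<dots> = r powr (-p) * (2 powr p * (2 powr p) ^ k)"
          unfolding pw unfolding power_Suc ..
        finally show ?thesis .
      qed
      have c2: "(r / 2 ^ k)\<^sup>2 = r powr 2 * (2 powr (-2)) ^ k"
      proof -
        have "(2 powr (-2 :: real)) ^ k = inverse ((2 ^ k)\<^sup>2)" for k :: nat
          by (induction k) (auto simp: powr_minus power2_eq_square)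
        then show ?thesis using r by (simp add: power_mult_distrib power_inverse divide_inverse)
      qed
      have c3: "r powr (-p) * r powr 2 = r powr (2 - p)" by (simp add: powr_add[symmetric])
      have c4: "(2 powr p) ^ k * (2 powr (-2)) ^ k = (2 powr (p - 2)) ^ k"
        by (simp add: power_mult_distrib[symmetric] powr_add[symmetric])
      have "c k * (pi * (r / 2 ^ k)\<^sup>2) = pi * (r powr (-p) * r powr 2) * 2 powr p * ((2 powr p) ^ k * (2 powr (-2)) ^ k)"
        unfolding c1 c2 by (simp only: mult_ac)
      then show ?thesis by (simp only: c3 c4)
    qed
    then show ?thesis by (simp only:)
  qed
  also have "\<dots> < \<infinity>"
  proof -
    have fin: "(\<Sum>k. ennreal (C * t ^ k)) < \<infinity>" if "0 \<le> C" "0 \<le> t" "t < 1" for C t :: real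
    proof -
      have "summable (\<lambda>k. C * t ^ k)" using that by (intro summable_mult summable_geometric) auto
      then have "(\<Sum>k. ennreal (C * t ^ k)) = ennreal (\<Sum>k. C * t ^ k)"
        using that by (intro suminf_ennreal2) auto
      then show ?thesis by simp
    qed
    have "(2::real) powr (p - 2) < 2 powr 0" using p by (intro powr_less_mono) auto
    then have "(2::real) powr (p - 2) < 1" by (simp only: powr_zero_eq_one if_False zero_neq_numeral[symmetric] split: if_splits)
    then show ?thesis by (intro fin) (use r in auto)
  qed
  finally have fin: "(\<integral>\<^sup>+z. ennreal (f z) \<partial>lborel) < \<infinity>" .
  have "0 \<le> f z" for z by (simp add: f_def)
  then have "integrable lborel f" by (intro integrableI_nonneg) (use fin in auto)
  then show ?thesis by (simp add: f_def[abs_def])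
next
  case False
  then show ?thesis by (simp add: ball_empty)
qed

lemma log_defect_nonneg: "0 \<le> log_defect t"
proof (cases "0 < t \<and> t < 1")
  case True
  then have "ln t \<le> t - 1" by (intro ln_le_minus_one) auto
  then show ?thesis using True by (simp add: log_defect_def ln_div)
qed (auto simp: log_defect_def)

lemma green_ker_nonneg: "0 \<le> green_ker r z"
  by (simp add: green_ker_def log_defect_nonneg)

lemma green_ker_eq_0: "0 < r \<Longrightarrow> r \<le> norm z \<Longrightarrow> green_ker r z = 0"
proof -
  assume "0 < r" "r \<le> norm z"
  then have "1 \<le> (norm z)\<^sup>2 / r\<^sup>2" using power_mono[of r "norm z" 2] by (simp add: field_simps)
  then show ?thesis by (simp add: green_ker_def log_defect_def)
qed

lemma green_ker_eq:
  assumes "0 < norm z" "norm z < r"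
  shows "green_ker r z = (ln (r / norm z) - 1 / 2 + (norm z)\<^sup>2 / (2 * r\<^sup>2)) / (2 * pi)"
proof -
  have "(norm z)\<^sup>2 < r\<^sup>2" using assms by (intro power_strict_mono) auto
  moreover have "ln (r\<^sup>2 / (norm z)\<^sup>2) = 2 * ln (r / norm z)"
    using assms by (simp add: ln_realpow flip: power_divide)
  moreover have r0: "r > 0" using assms by linarith
  ultimately have "0 < (norm z)\<^sup>2 / r\<^sup>2" "(norm z)\<^sup>2 / r\<^sup>2 < 1" "ln (r\<^sup>2 / (norm z)\<^sup>2) = 2 * ln (r / norm z)"
    using assms r0 by (auto intro!: divide_pos_pos)
  then show ?thesis by (simp add: green_ker_def log_defect_def field_simps)
qed

lemma green_ker_le_ln:
  assumes "0 < norm z" "norm z < r"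
  shows "green_ker r z \<le> ln (r / norm z) / (2 * pi)"
proof -
  have "(norm z)\<^sup>2 < r\<^sup>2" using assms by (intro power_strict_mono) auto
  moreover have "r > 0" using assms by linarith
  ultimately have "(norm z)\<^sup>2 / (2 * r\<^sup>2) \<le> 1 / 2" using assms by (simp add: divide_simps)
  then show ?thesis unfolding green_ker_eq[OF assms] by (intro divide_right_mono) auto
qed

text \<open>Crude, but enough for integrability. The right-hand side is also increasing in r, so the
  bound at one radius dominates the kernels of all smaller radii.\<close>

lemma green_ker_le:
  assumes "0 < r"
  shows "green_ker r z \<le> r * (indicator (ball 0 r) z * norm z powr (-1))"
proof (cases "0 < norm z \<and> norm z < r")
  case True
  have "green_ker r z \<le> ln (r / norm z) / (2 * pi)" using green_ker_le_ln True by blast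
  also have "\<dots> \<le> (r / norm z) / 1"
  proof (rule frac_le)
    show "ln (r / norm z) \<le> r / norm z" using ln_le_minus_one[of "r / norm z"] divide_pos_pos[OF assms, of "norm z"] True by linarith
    show "1 \<le> 2 * pi" using pi_gt3 by linarith
  qed (use True assms in auto)
  finally show ?thesis using True by (simp add: powr_minus divide_inverse)
next
  case False
  then have "green_ker r z = 0" using green_ker_eq_0[OF assms, of z] by (auto simp: green_ker_def log_defect_def)
  then show ?thesis using assms by simp
qed

lemma integrable_green_ker:
  assumes "0 < r"
  shows "integrable lborel (\<lambda>y. green_ker r (y - a))"
proof (rule Bochner_Integration.integrable_bound)
  show "integrable lborel (\<lambda>y. r * (indicator (ball 0 r) (y - a) * norm (y - a) powr (-1)))"
    by (intro integrable_mult_right lborel_integrable_shift[OF integrable_norm_powr_disc[of 1 r], of a]) auto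
qed (use green_ker_le[OF assms] green_ker_nonneg assms in \<open>auto simp: abs_mult\<close>)

lemma disc_mean_bounds:
  assumes i: "set_integrable lborel (ball a r) v" and r: "0 < r"
  shows "(\<And>x. x \<in> ball a r \<Longrightarrow> m \<le> v x) \<Longrightarrow> m \<le> disc_mean r v a"
    and "(\<And>x. x \<in> ball a r \<Longrightarrow> v x \<le> M) \<Longrightarrow> disc_mean r v a \<le> M"
proof -
  have c: "set_integrable lborel (ball a r) (\<lambda>_. k)" "(LINT x:ball a r|lborel. k) = pi * r\<^sup>2 * k" for k :: real
  proof -
    have "integrable lborel (indicat_real (ball a r))"
      by (rule integrable_real_indicator) (use emeasure_lborel_ball_finite[of a r] in \<open>auto simp: less_top\<close>)
    then show "set_integrable lborel (ball a r) (\<lambda>_. k)" "(LINT x:ball a r|lborel. k) = pi * r\<^sup>2 * k"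
      using circle_area[of r a] r by (auto simp: set_integrable_def set_lebesgue_integral_def mult.commute)
  qed
  { assume "\<And>x. x \<in> ball a r \<Longrightarrow> m \<le> v x"
    from set_integral_mono[OF c(1) i this] have "pi * r\<^sup>2 * m \<le> (LINT x:ball a r|lborel. v x)" by (simp add: c)
    then show "m \<le> disc_mean r v a" using r by (simp add: disc_mean_def field_simps) }
  { assume "\<And>x. x \<in> ball a r \<Longrightarrow> v x \<le> M"
    from set_integral_mono[OF i c(1) this] have "(LINT x:ball a r|lborel. v x) \<le> pi * r\<^sup>2 * M" by (simp add: c)
    then show "disc_mean r v a \<le> M" using r by (simp add: disc_mean_def field_simps) }
qed

text \<open>Together with continuity of v and f, this formula is all that is used of the equation
  from here on. It makes sense without derivatives and is inherited by subsets and by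
  rescalings.\<close>

definition green_on :: "(real^2) set \<Rightarrow> (real^2 \<Rightarrow> real) \<Rightarrow> (real^2 \<Rightarrow> real) \<Rightarrow> bool" where
  "green_on S v F \<longleftrightarrow> (\<forall>a r. 0 < r \<and> cball a r \<subseteq> S \<longrightarrow>
     v a = disc_mean r v a + (LINT y|lborel. indicator (cball a r) y * F y * green_ker r (y - a)))"

text \<open>The inner radius in \<open>disc_mean_diff\<close> is sent to 0: the inner disc mean
  tends to v a by continuity, and the inner kernel, whose support shrinks to a point, contributes
  nothing in the limit.\<close>

lemma solves_poisson_green_on:
  assumes sol: "solves_poisson \<Omega> v F" and F: "continuous_on \<Omega> F"
  shows "green_on \<Omega> v F"
  unfolding green_on_def
proof (intro allI impI)
  fix a :: "real^2" and \<rho> :: real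
  assume "0 < \<rho> \<and> cball a \<rho> \<subseteq> \<Omega>"
  then have r: "0 < \<rho>" and sub: "cball a \<rho> \<subseteq> \<Omega>" by auto
  have cv: "continuous_on (cball a \<rho>) v" using sol sub by (auto simp: solves_poisson_def intro: continuous_on_subset)
  have cF: "continuous_on (cball a \<rho>) F" using F sub by (auto intro: continuous_on_subset)
  obtain C where C: "\<forall>x\<in>cball a \<rho>. \<bar>F x\<bar> \<le> C"
    using compact_imp_bounded[OF compact_continuous_image[OF cF compact_cball]] by (auto simp: bounded_iff)
  have C0: "0 \<le> C" using C r by (meson abs_ge_zero centre_in_cball order_trans less_imp_le)
  define FB where "FB x = indicator (cball a \<rho>) x * F x" for x
  have [measurable]: "FB \<in> borel_measurable borel"
    using integrable_on_cball[OF cF] by (auto simp: FB_def[abs_def])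
  have FC: "\<bar>FB x\<bar> \<le> C" for x using C C0 by (auto simp: FB_def indicator_def)
  \<comment> \<open>The shift by 2 keeps the inner radius strictly below \<rho> already for n =
    0.\<close>
  define \<sigma> where "\<sigma> n = \<rho> / real (n + 2)" for n
  have \<sigma>: "0 < \<sigma> n" "\<sigma> n < \<rho>" for n using r by (auto simp: \<sigma>_def field_simps intro: add_pos_nonneg)
  have \<sigma>0: "\<sigma> \<longlonglongrightarrow> 0" unfolding \<sigma>_def[abs_def] by real_asymp
  have ki: "integrable lborel (\<lambda>y. FB y * green_ker s (y - a))" if "0 < s" for s
  proof (rule Bochner_Integration.integrable_bound[OF integrable_mult_right[OF integrable_green_ker[OF that, of a], of C]])
    show "AE x in lborel. norm (FB x * green_ker s (x - a)) \<le> norm (C * green_ker s (x - a))"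
      using FC C0 green_ker_nonneg by (auto simp: abs_mult intro!: mult_mono)
  qed measurable
  have lim1: "(\<lambda>n. disc_mean (\<sigma> n) v a) \<longlonglongrightarrow> v a"
  proof (rule LIMSEQ_I)
    fix e :: real assume e: "0 < e"
    then obtain d where d: "d > 0" "\<And>x. x \<in> cball a \<rho> \<Longrightarrow> dist x a < d \<Longrightarrow> dist (v x) (v a) < e / 2"
      using cv r unfolding continuous_on_iff by (metis centre_in_cball less_imp_le half_gt_zero)
    obtain N where N: "\<And>n. n \<ge> N \<Longrightarrow> \<bar>\<sigma> n\<bar> < d"
      using LIMSEQ_D[OF \<sigma>0 d(1)] by auto
    show "\<exists>no. \<forall>n\<ge>no. norm (disc_mean (\<sigma> n) v a - v a) < e"
    proof (intro exI allI impI)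
      fix n assume n: "N \<le> n"
      have "set_integrable lborel (cball a \<rho>) v" using integrable_on_cball[OF cv] by (simp add: set_integrable_def)
      then have si: "set_integrable lborel (ball a (\<sigma> n)) v"
        by (rule set_integrable_subset) (use \<sigma>[of n] in auto)
      have b: "\<bar>v x - v a\<bar> < e / 2" if "x \<in> ball a (\<sigma> n)" for x
        using d(2)[of x] that N[OF n] \<sigma>[of n] by (auto simp: dist_real_def dist_commute)
      have b': "v a - e / 2 \<le> v x" "v x \<le> v a + e / 2" if "x \<in> ball a (\<sigma> n)" for x
        using b[OF that] by (auto simp only: abs_less_iff)
      have "v a - e / 2 \<le> disc_mean (\<sigma> n) v a" by (rule disc_mean_bounds(1)[OF si \<sigma>(1) b'(1)])
      moreover have "disc_mean (\<sigma> n) v a \<le> v a + e / 2" by (rule disc_mean_bounds(2)[OF si \<sigma>(1) b'(2)])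
      ultimately show "norm (disc_mean (\<sigma> n) v a - v a) < e" using e by (simp add: abs_less_iff)
    qed
  qed
  have lim2: "(\<lambda>n. \<integral>y. FB y * green_ker (\<sigma> n) (y - a) \<partial>lborel) \<longlonglongrightarrow> (\<integral>y. 0 \<partial>(lborel :: (real^2) measure))"
  proof (rule integral_dominated_convergence[where w="\<lambda>y. C * (\<rho> * (indicator (ball 0 \<rho>) (y - a) * norm (y - a) powr (-1)))"])
    show "integrable lborel (\<lambda>y. C * (\<rho> * (indicator (ball 0 \<rho>) (y - a) * norm (y - a) powr (-1))))"
      by (intro integrable_mult_right lborel_integrable_shift[OF integrable_norm_powr_disc[of 1 \<rho>], of a]) auto
    show "AE y in lborel. (\<lambda>n. FB y * green_ker (\<sigma> n) (y - a)) \<longlonglongrightarrow> 0"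
      using AE_lborel_singleton[of a]
    proof eventually_elim
      case (elim y)
      then have "0 < norm (y - a)" by simp
      from order_tendstoD(2)[OF \<sigma>0 this]
      have "\<forall>\<^sub>F n in sequentially. FB y * green_ker (\<sigma> n) (y - a) = 0"
        by (rule eventually_mono) (use green_ker_eq_0 \<sigma> in auto)
      then show ?case by (rule tendsto_eventually)
    qed
    show "AE y in lborel. norm (FB y * green_ker (\<sigma> n) (y - a)) \<le> C * (\<rho> * (indicator (ball 0 \<rho>) (y - a) * norm (y - a) powr (-1)))" for n
    proof (rule AE_I2)
      fix y
      have "green_ker (\<sigma> n) (y - a) \<le> \<sigma> n * (indicator (ball 0 (\<sigma> n)) (y - a) * norm (y - a) powr (-1))"
        by (rule green_ker_le[OF \<sigma>(1)])
      also have "\<dots> \<le> \<rho> * (indicator (ball 0 \<rho>) (y - a) * norm (y - a) powr (-1))"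
        using \<sigma>[of n] by (intro mult_mono) (auto simp: indicator_def)
      finally show "norm (FB y * green_ker (\<sigma> n) (y - a)) \<le> C * (\<rho> * (indicator (ball 0 \<rho>) (y - a) * norm (y - a) powr (-1)))"
        using FC[of y] C0 green_ker_nonneg[of "\<sigma> n" "y - a"] by (auto simp only: real_norm_def abs_mult abs_of_nonneg intro!: mult_mono)
    qed
  qed auto
  define I where "I s = (\<integral>y. FB y * green_ker s (y - a) \<partial>lborel)" for s
  have "disc_mean (\<sigma> n) v a = disc_mean \<rho> v a + (I \<rho> - I (\<sigma> n))" for n
  proof -
    have "(LINT x|lborel. indicator (cball a \<rho>) x * F x * (green_ker \<rho> (x - a) - green_ker (\<sigma> n) (x - a)))
        = (\<integral>y. FB y * green_ker \<rho> (y - a) - FB y * green_ker (\<sigma> n) (y - a) \<partial>lborel)"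
      by (simp add: FB_def algebra_simps)
    also have "\<dots> = I \<rho> - I (\<sigma> n)" unfolding I_def
      by (rule Bochner_Integration.integral_diff[OF ki[OF r] ki[OF \<sigma>(1)]])
    finally show ?thesis using disc_mean_diff[OF sol F sub \<sigma>[of n]] by simp
  qed
  moreover have "(\<lambda>n. disc_mean \<rho> v a + (I \<rho> - I (\<sigma> n))) \<longlonglongrightarrow> disc_mean \<rho> v a + (I \<rho> - 0)"
    using lim2 unfolding I_def by (intro tendsto_intros) simp
  ultimately have "(\<lambda>n. disc_mean (\<sigma> n) v a) \<longlonglongrightarrow> disc_mean \<rho> v a + I \<rho>" by simp
  from LIMSEQ_unique[OF lim1 this]
  show "v a = disc_mean \<rho> v a + (LINT y|lborel. indicator (cball a \<rho>) y * F y * green_ker \<rho> (y - a))"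
    by (simp add: I_def FB_def)
qed

section \<open>Kernel inequalities under dilation\<close>

text \<open>Follows from the subadditivity (1 + t)^q \<le> 1 + t^q. Trading the logarithm for a
  power q = p/2 will turn the quadratic error (s - 1)^2 / |x - y|^2 into (s - 1)^p / |x - y|^p,
  whose singularity is integrable in the plane.\<close>

lemma ln_one_plus_le_powr:
  fixes t q :: real
  assumes "0 \<le> t" "0 < q" "q \<le> 1"
  shows "ln (1 + t) \<le> t powr q / q"
proof (cases "t = 0")
  case False
  then have t: "t > 0" using assms by simp
  have "(1 + t) powr q \<le> 1 powr q + t powr q"
  proof -
    have "(1 / (1 + t)) powr q \<ge> 1 / (1 + t)" "(t / (1 + t)) powr q \<ge> t / (1 + t)"
      using powr_mono'[of q 1 "1 / (1 + t)"] powr_mono'[of q 1 "t / (1 + t)"] assms t by (auto simp: field_simps)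
    moreover have "1 / (1 + t) + t / (1 + t) = 1" using t by (simp add: add_divide_distrib[symmetric])
    ultimately have "1 \<le> (1 / (1 + t)) powr q + (t / (1 + t)) powr q" by linarith
    also have "\<dots> = (1 + t powr q) / (1 + t) powr q" using t by (simp add: powr_divide add_divide_distrib)
    finally show ?thesis using t by (simp add: field_simps)
  qed
  then have "ln ((1 + t) powr q) \<le> ln (1 + t powr q)" using t by (subst ln_le_cancel_iff) (auto intro: add_pos_nonneg)
  also have "\<dots> \<le> t powr q" by (intro ln_add_one_self_le_self) simp
  finally show ?thesis using t assms by (simp add: ln_powr field_simps)
qed (use assms in auto)

lemma powr_add_le:
  fixes x y q :: real
  assumes "0 \<le> x" "0 \<le> y" "0 < q" "q \<le> 1"
  shows "(x + y) powr q \<le> x powr q + y powr q"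
proof (cases "x + y = 0")
  case False
  then have s: "x + y > 0" using assms by simp
  have *: "(z / (x + y)) powr q \<ge> z / (x + y)" if "0 \<le> z" "z \<le> x + y" for z
    using powr_mono'[of q 1 "z / (x + y)"] assms s that by (auto simp: field_simps)
  have "1 = x / (x + y) + y / (x + y)" using s by (simp add: add_divide_distrib[symmetric])
  also have "\<dots> \<le> (x / (x + y)) powr q + (y / (x + y)) powr q" using * assms by (intro add_mono) auto
  also have "\<dots> = (x powr q + y powr q) / (x + y) powr q" using assms s by (simp add: powr_divide add_divide_distrib)
  finally show ?thesis using s by (simp add: field_simps)
qed (use assms in auto)

text \<open>Bounds, on the logarithmic scale, the excess of |s x - y| |s y - x| over s |x - y|^2.
  Away from the diagonal it is quadratic in s - 1.\<close>

definition dil_err :: "real \<Rightarrow> real^2 \<Rightarrow> real^2 \<Rightarrow> real" where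
  "dil_err s x y = ln (1 + (s - 1)\<^sup>2 * ((norm x)\<^sup>2 + (norm y)\<^sup>2) / (s * (norm (x - y))\<^sup>2))"

text \<open>This is 2 pi times the change of the logarithmic potential of a unit mass at y when the
  point x moves to s x.\<close>

definition dil_log :: "real \<Rightarrow> real^2 \<Rightarrow> real^2 \<Rightarrow> real" where
  "dil_log s x y = ln (norm (x - y) / norm (s *\<^sub>R x - y))"

lemma dil_err_nonneg: "1 < s \<Longrightarrow> 0 \<le> dil_err s x y"
  unfolding dil_err_def by (intro ln_ge_zero) (auto intro!: divide_nonneg_nonneg mult_nonneg_nonneg)

text \<open>Under exchange of x and y the last term changes its sign up to second order in s - 1, so
  that symmetrization leaves only the factor s.\<close>

lemma dil_norm_sq:
  fixes x y :: "'a::real_inner"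
  shows "(norm (s *\<^sub>R x - y))\<^sup>2 = s * (norm (x - y))\<^sup>2 + (s - 1) * (s * (norm x)\<^sup>2 - (norm y)\<^sup>2)"
  unfolding power2_norm_eq_inner by (simp add: algebra_simps inner_commute power2_eq_square)

text \<open>When x ranges over a disc and y lies outside, the pair cannot be symmetrized. Here |x|
  \<le> |y| fixes the sign of the first-order term of \<open>dil_norm_sq\<close>, and the loss is
  the same ln s / 2 that symmetrization yields on average. Hence mass inside and outside the disc
  will count alike.\<close>

lemma dil_log_lower:
  assumes s: "1 < s" and ne: "x \<noteq> y" "s *\<^sub>R x \<noteq> y" and le: "norm x \<le> norm y"
  shows "- ln s / 2 - dil_err s x y / 2 \<le> dil_log s x y"
proof -
  define d where "d = (norm (x - y))\<^sup>2"
  define D where "D = (norm (s *\<^sub>R x - y))\<^sup>2"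
  have pos: "d > 0" "D > 0" using ne by (auto simp: d_def D_def)
  have l2: "(norm x)\<^sup>2 \<le> (norm y)\<^sup>2" using le by (intro power_mono) auto
  have "D = s * d + (s - 1) * (s * (norm x)\<^sup>2 - (norm y)\<^sup>2)" unfolding d_def D_def by (rule dil_norm_sq)
  also have "\<dots> \<le> s * d + (s - 1) * ((s - 1) * ((norm x)\<^sup>2 + (norm y)\<^sup>2))"
  proof (intro add_left_mono mult_left_mono)
    have "s * (norm x)\<^sup>2 = (s - 1) * (norm x)\<^sup>2 + (norm x)\<^sup>2" by (simp add: algebra_simps)
    moreover have "0 \<le> (s - 1) * (norm y)\<^sup>2" using s by simp
    ultimately show "s * (norm x)\<^sup>2 - (norm y)\<^sup>2 \<le> (s - 1) * ((norm x)\<^sup>2 + (norm y)\<^sup>2)"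
      using l2 unfolding distrib_left by linarith
  qed (use s in auto)
  also have "\<dots> = s * d * (1 + (s - 1)\<^sup>2 * ((norm x)\<^sup>2 + (norm y)\<^sup>2) / (s * d))"
    using s pos by (simp add: field_simps power2_eq_square)
  finally have "ln D \<le> ln (s * d * (1 + (s - 1)\<^sup>2 * ((norm x)\<^sup>2 + (norm y)\<^sup>2) / (s * d)))"
    using pos by (intro ln_mono) auto
  also have "\<dots> = ln s + ln d + dil_err s x y"
  proof -
    have "0 < 1 + (s - 1)\<^sup>2 * ((norm x)\<^sup>2 + (norm y)\<^sup>2) / (s * d)" using s pos by (intro add_pos_nonneg) auto
    then show ?thesis using s pos by (subst ln_mult) (auto simp: dil_err_def ln_mult d_def)
  qed
  finally have "ln D \<le> ln s + ln d + dil_err s x y" .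
  moreover have "ln D = 2 * ln (norm (s *\<^sub>R x - y))" "ln d = 2 * ln (norm (x - y))"
    unfolding D_def d_def using ne by (auto simp: ln_realpow)
  moreover have "dil_log s x y = ln (norm (x - y)) - ln (norm (s *\<^sub>R x - y))"
    unfolding dil_log_def using ne by (simp add: ln_div)
  ultimately show ?thesis by linarith
qed

text \<open>By \<open>dil_norm_sq\<close> the two squared distances add up to 2 s |x - y|^2 plus a
  term quadratic in s - 1, and the inequality 4 D E \<le> (D + E)^2 transfers this to their
  product.\<close>

lemma dil_log_sym_lower:
  assumes s: "1 < s" and ne: "x \<noteq> y" "s *\<^sub>R x \<noteq> y" "s *\<^sub>R y \<noteq> x"
  shows "- ln s - dil_err s x y \<le> dil_log s x y + dil_log s y x"
proof -
  define d where "d = (norm (x - y))\<^sup>2"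
  define X where "X = (norm x)\<^sup>2 + (norm y)\<^sup>2"
  define D where "D = (norm (s *\<^sub>R x - y))\<^sup>2"
  define E where "E = (norm (s *\<^sub>R y - x))\<^sup>2"
  have pos: "d > 0" "D > 0" "E > 0" using ne by (auto simp: d_def D_def E_def)
  have X: "0 \<le> X" by (simp add: X_def)
  have "D = s * d + (s - 1) * (s * (norm x)\<^sup>2 - (norm y)\<^sup>2)" unfolding d_def D_def by (rule dil_norm_sq)
  moreover have "E = s * d + (s - 1) * (s * (norm y)\<^sup>2 - (norm x)\<^sup>2)"
    unfolding d_def E_def norm_minus_commute[of x y] by (rule dil_norm_sq)
  ultimately have sum: "D + E = 2 * (s * d) + (s - 1)\<^sup>2 * X"
    by (simp add: X_def algebra_simps power2_eq_square)
  have "4 * (D * E) \<le> (D + E)\<^sup>2" using sum_squares_bound[of D E] by (simp add: power2_eq_square algebra_simps)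
  also have "\<dots> \<le> (2 * (s * d + (s - 1)\<^sup>2 * X))\<^sup>2"
    unfolding sum using s pos X by (intro power_mono) (auto intro!: add_nonneg_nonneg)
  finally have "D * E \<le> (s * d + (s - 1)\<^sup>2 * X)\<^sup>2" by (simp add: power2_eq_square algebra_simps)
  also have "s * d + (s - 1)\<^sup>2 * X = s * d * (1 + (s - 1)\<^sup>2 * X / (s * d))"
    using s pos by (simp add: field_simps)
  finally have "ln (D * E) \<le> ln ((s * d * (1 + (s - 1)\<^sup>2 * X / (s * d)))\<^sup>2)"
    using pos by (intro ln_mono) auto
  also have "\<dots> = 2 * ln (s * d * (1 + (s - 1)\<^sup>2 * X / (s * d)))"
    using s pos X by (subst ln_realpow) (auto intro!: mult_pos_pos add_pos_nonneg)
  also have "ln (s * d * (1 + (s - 1)\<^sup>2 * X / (s * d))) = ln s + ln d + dil_err s x y"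
  proof -
    have "0 < 1 + (s - 1)\<^sup>2 * X / (s * d)" using s pos X by (intro add_pos_nonneg) auto
    then show ?thesis using s pos by (subst ln_mult) (auto simp: dil_err_def ln_mult d_def X_def)
  qed
  finally have "ln D + ln E \<le> 2 * (ln s + ln d + dil_err s x y)" using pos by (simp add: ln_mult)
  moreover have "ln D = 2 * ln (norm (s *\<^sub>R x - y))" "ln d = 2 * ln (norm (x - y))" "ln E = 2 * ln (norm (s *\<^sub>R y - x))"
    unfolding D_def d_def E_def using ne by (auto simp: ln_realpow)
  moreover have "dil_log s x y = ln (norm (x - y)) - ln (norm (s *\<^sub>R x - y))"
    "dil_log s y x = ln (norm (x - y)) - ln (norm (s *\<^sub>R y - x))"
    unfolding dil_log_def using ne by (auto simp: ln_div norm_minus_commute)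
  ultimately show ?thesis by simp
qed

lemma power2_powr_half:
  fixes a p :: real
  assumes "0 \<le> a"
  shows "(a\<^sup>2) powr (p / 2) = a powr p"
proof (cases "a = 0")
  case False
  then have "a\<^sup>2 = a powr 2" using assms by simp
  then have "(a\<^sup>2) powr (p / 2) = (a powr 2) powr (p / 2)" by simp
  also have "\<dots> = a powr p" by (subst powr_powr) simp
  finally show ?thesis .
qed simp

text \<open>The exponent p > 1 makes the error small against s - 1, while p < 2 keeps |x - y|^(-p)
  integrable. The dependence of the numerator on x is removed by |x| \<le> |x - y| + |y|; the factor
  |y|^p that remains is there to absorb a singularity |y|^(-p) of the density at the origin. The
  constant is 2 * 3, from 1/q \<le> 2 and 2^q, 3^q \<le> 3.\<close>

lemma dil_err_le:
  assumes s: "1 < s" and p: "1 < p" "p < 2" and ne: "x \<noteq> y"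
  shows "dil_err s x y \<le> 6 * (s - 1) powr p * (1 + norm y powr p * norm (x - y) powr (-p))"
proof -
  define q where "q = p / 2"
  have q: "0 < q" "q \<le> 1" "1 / q \<le> 2" using p by (auto simp: q_def field_simps)
  define d where "d = (norm (x - y))\<^sup>2"
  have d: "d > 0" using ne by (simp add: d_def)
  define t where "t = (s - 1)\<^sup>2 * ((norm x)\<^sup>2 + (norm y)\<^sup>2) / (s * d)"
  have t0: "0 \<le> t" using s d by (auto simp: t_def)
  have "(norm x)\<^sup>2 \<le> 2 * d + 2 * (norm y)\<^sup>2"
  proof -
    have "norm x \<le> norm (x - y) + norm y" using norm_triangle_ineq[of "x - y" y] by simp
    then have "(norm x)\<^sup>2 \<le> (norm (x - y) + norm y)\<^sup>2" by (intro power_mono) auto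
    also have "\<dots> \<le> 2 * d + 2 * (norm y)\<^sup>2"
      using sum_squares_bound[of "norm (x - y)" "norm y"] by (simp add: d_def power2_sum)
    finally show ?thesis .
  qed
  then have "t \<le> (s - 1)\<^sup>2 * (2 * d + 3 * (norm y)\<^sup>2) / (1 * d)"
    unfolding t_def using s d by (intro frac_le mult_left_mono mult_right_mono) auto
  also have "\<dots> = (s - 1)\<^sup>2 * (2 + 3 * (norm y)\<^sup>2 / d)" using d by (simp add: field_simps)
  finally have tle: "t \<le> (s - 1)\<^sup>2 * (2 + 3 * (norm y)\<^sup>2 / d)" .
  have "dil_err s x y \<le> t powr q / q"
    using ln_one_plus_le_powr[OF t0 q(1,2)] by (simp add: dil_err_def t_def d_def)
  also have "\<dots> \<le> 2 * t powr q" using mult_right_mono[OF q(3), of "t powr q"] by simp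
  also have "t powr q \<le> ((s - 1)\<^sup>2 * (2 + 3 * (norm y)\<^sup>2 / d)) powr q"
    using tle t0 q by (intro powr_mono2) auto
  also have "\<dots> = (s - 1) powr p * (2 + 3 * (norm y)\<^sup>2 / d) powr q"
  proof -
    have "((s - 1)\<^sup>2) powr q = (s - 1) powr p" unfolding q_def using s by (intro power2_powr_half) simp
    then show ?thesis by (simp only: powr_mult)
  qed
  also have "(2 + 3 * (norm y)\<^sup>2 / d) powr q \<le> 2 powr q + (3 * (norm y)\<^sup>2 / d) powr q"
    using d q by (intro powr_add_le) auto
  also have "\<dots> = 2 powr q + 3 powr q * (norm y powr p * norm (x - y) powr (-p))"
  proof -
    have "(3 * (norm y)\<^sup>2 / d) powr q = 3 powr q * ((norm y)\<^sup>2 powr q / d powr q)"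
      by (simp only: times_divide_eq_right[symmetric] powr_mult powr_divide)
    moreover have "(norm y)\<^sup>2 powr q = norm y powr p" "d powr q = norm (x - y) powr p"
      unfolding q_def d_def by (simp_all only: power2_powr_half norm_ge_zero)
    ultimately show ?thesis by (simp only: powr_minus divide_inverse)
  qed
  also have "\<dots> \<le> 3 + 3 * (norm y powr p * norm (x - y) powr (-p))"
  proof (intro add_mono mult_right_mono)
    show "(2::real) powr q \<le> 3" using powr_mono[of q 1 "2::real"] q by simp
    show "(3::real) powr q \<le> 3" using powr_mono[of q 1 "3::real"] q by simp
  qed auto
  finally show ?thesis using s by (simp add: algebra_simps mult_left_mono)
qed

text \<open>Inclusion of discs and positivity; the price is the ratio of the areas. This stands in
  for a gradient bound when the point of evaluation is moved.\<close>

lemma disc_mean_mono_shift: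
  assumes i: "set_integrable lborel (ball x (\<rho> + h)) g" and nn: "\<And>y. y \<in> ball x (\<rho> + h) \<Longrightarrow> 0 \<le> g y"
    and d: "dist x x' \<le> h" and \<rho>: "0 < \<rho>"
  shows "disc_mean \<rho> g x' \<le> ((\<rho> + h) / \<rho>)\<^sup>2 * disc_mean (\<rho> + h) g x"
proof -
  have h: "0 \<le> h" using d zero_le_dist order_trans by blast
  have sub: "ball x' \<rho> \<subseteq> ball x (\<rho> + h)"
  proof
    fix y assume "y \<in> ball x' \<rho>"
    then show "y \<in> ball x (\<rho> + h)" using d dist_triangle[of x y x'] by simp
  qed
  have "(LINT y:ball x' \<rho>|lborel. g y) \<le> (LINT y:ball x (\<rho> + h)|lborel. g y)"
    unfolding set_lebesgue_integral_def
    using set_integrable_subset[OF i _ sub] i sub nn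
    by (intro Bochner_Integration.integral_mono) (auto simp: set_integrable_def indicator_def)
  then have "disc_mean \<rho> g x' \<le> (LINT y:ball x (\<rho> + h)|lborel. g y) / (pi * \<rho>\<^sup>2)"
    unfolding disc_mean_def by (intro divide_right_mono) auto
  also have "\<dots> = ((\<rho> + h) / \<rho>)\<^sup>2 * disc_mean (\<rho> + h) g x"
    using \<rho> h by (simp add: disc_mean_def power_divide add_nonneg_eq_0_iff)
  finally show ?thesis .
qed

text \<open>Reduces truncated kernels at slightly different centres and radii to the pure logarithm.
  The change of the radius inside the logarithm and the change of the quadratic term, which carries
  a factor 1/2, cost h/\<rho> each. If z' has left its disc, its kernel is 0 and the ratio of norms
  is at most |z|/\<rho>.\<close>

lemma green_ker_diff_lower:
  assumes h: "0 < h" "0 < \<rho>" and z: "z \<noteq> 0" "z' \<noteq> 0" "norm (z' - z) \<le> h" "norm z < \<rho> + h"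
  shows "(ln (norm z / norm z') - 2 * h / \<rho>) / (2 * pi) \<le> green_ker \<rho> z' - green_ker (\<rho> + h) z"
proof -
  define A where "A = norm z / (\<rho> + h)"
  define B where "B = norm z' / \<rho>"
  have A: "0 \<le> A" "A \<le> 1" using h z by (auto simp: A_def)
  have kz: "green_ker (\<rho> + h) z = (ln ((\<rho> + h) / norm z) - 1 / 2 + A\<^sup>2 / 2) / (2 * pi)"
    using green_ker_eq[of z "\<rho> + h"] z by (simp add: A_def power_divide)
  have l1: "ln ((\<rho> + h) / \<rho>) \<le> h / \<rho>"
    using ln_add_one_self_le_self[of "h / \<rho>"] h by (simp add: add_divide_distrib)
  show ?thesis
  proof (cases "norm z' < \<rho>")
    case True
    have B1: "B \<le> 1" "0 \<le> B" using True h by (auto simp: B_def)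
    have "A - h / \<rho> \<le> A - h / (\<rho> + h)" using h by (simp add: frac_le)
    also have "\<dots> = (norm z - h) / (\<rho> + h)" by (simp add: A_def diff_divide_distrib)
    also have "\<dots> \<le> norm z' / (\<rho> + h)"
      using z norm_triangle_ineq2[of z z'] h by (intro divide_right_mono) (auto simp: norm_minus_commute)
    also have "\<dots> \<le> B" unfolding B_def using h by (intro divide_left_mono) auto
    finally have AB: "A - B \<le> h / \<rho>" by simp
    have "A\<^sup>2 - B\<^sup>2 \<le> 2 * (h / \<rho>)"
    proof (cases "A \<le> B")
      case True
      then have "A\<^sup>2 \<le> B\<^sup>2" using A by (intro power_mono) auto
      moreover have "0 \<le> h / \<rho>" using h by simp
      ultimately show ?thesis by linarith
    next
      case False
      have "A\<^sup>2 - B\<^sup>2 = (A + B) * (A - B)" by (simp add: power2_eq_square algebra_simps)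
      also have "\<dots> \<le> 2 * (h / \<rho>)" using A B1 AB False by (intro mult_mono) auto
      finally show ?thesis .
    qed
    moreover have kz': "green_ker \<rho> z' = (ln (\<rho> / norm z') - 1 / 2 + B\<^sup>2 / 2) / (2 * pi)"
      using green_ker_eq[of z' \<rho>] z True by (simp add: B_def power_divide)
    moreover have "ln (\<rho> / norm z') - ln ((\<rho> + h) / norm z) = ln (norm z / norm z') - ln ((\<rho> + h) / \<rho>)"
      using h z by (simp add: ln_div)
    ultimately have "(ln (norm z / norm z') - 2 * h / \<rho>) / (2 * pi) \<le>
        (ln (\<rho> / norm z') - 1 / 2 + B\<^sup>2 / 2 - (ln ((\<rho> + h) / norm z) - 1 / 2 + A\<^sup>2 / 2)) / (2 * pi)"
      using l1 by (intro divide_right_mono) auto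
    then show ?thesis unfolding kz kz' by (simp only: diff_divide_distrib)
  next
    case False
    then have "green_ker \<rho> z' = 0" using h by (intro green_ker_eq_0) auto
    moreover have "ln (norm z / norm z') \<le> ln (norm z / \<rho>)"
      using False z h by (intro ln_mono divide_left_mono) (auto intro!: mult_pos_pos divide_pos_pos)
    moreover have "ln ((\<rho> + h) / norm z) + ln (norm z / \<rho>) = ln ((\<rho> + h) / \<rho>)"
      using h z by (simp add: ln_div)
    moreover have "A\<^sup>2 \<le> 1" using A by (simp add: power_le_one)
    moreover have "0 < h / \<rho>" using h by simp
    ultimately have "ln (norm z / norm z') - 2 * h / \<rho> \<le> - (ln ((\<rho> + h) / norm z) - 1 / 2 + A\<^sup>2 / 2)"
      using l1 by simp
    then have "(ln (norm z / norm z') - 2 * h / \<rho>) / (2 * pi) \<le> - (ln ((\<rho> + h) / norm z) - 1 / 2 + A\<^sup>2 / 2) / (2 * pi)"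
      by (intro divide_right_mono) auto
    then show ?thesis unfolding kz \<open>green_ker \<rho> z' = 0\<close> by (simp only: minus_divide_left diff_0)
  qed
qed

section \<open>The discrete Pohozaev inequality\<close>

text \<open>Enters the estimates as a constant whose value is never computed.\<close>

definition powr_mass :: "real \<Rightarrow> real \<Rightarrow> real" where
  "powr_mass p r = (\<integral>z. indicator (ball 0 r) z * norm (z::real^2) powr (-p) \<partial>lborel)"

lemma powr_mass_nonneg: "0 \<le> powr_mass p r"
  unfolding powr_mass_def by (intro Bochner_Integration.integral_nonneg) auto

lemma powr_shift:
  fixes b :: "real^2"
  assumes p: "0 \<le> p" "p < 2" and sub: "\<And>y. y \<in> S \<Longrightarrow> dist y b < R" and S[measurable]: "S \<in> sets borel"
  shows "integrable lborel (\<lambda>y. indicator S y * norm (y - b) powr (-p))"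
    and "(\<integral>y. indicator S y * norm (y - b) powr (-p) \<partial>lborel) \<le> powr_mass p R"
proof -
  have i: "integrable lborel (\<lambda>y. indicator (ball 0 R) (y - b) * norm (y - b) powr (-p))"
    by (rule lborel_integrable_shift[OF integrable_norm_powr_disc[OF p]])
  have le: "indicator S y * norm (y - b) powr (-p) \<le> indicator (ball 0 R) (y - b) * norm (y - b) powr (-p)" for y
    using sub[of y] by (auto simp: indicator_def dist_norm norm_minus_commute)
  have m: "(\<lambda>y. norm (y - b) powr (-p)) \<in> borel_measurable borel"
    by (intro powr_real_measurable) auto
  show 1: "integrable lborel (\<lambda>y. indicator S y * norm (y - b) powr (-p))"
  proof (rule Bochner_Integration.integrable_bound[OF i])
    show "(\<lambda>y. indicator S y * norm (y - b) powr (-p)) \<in> borel_measurable lborel"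
      using m by measurable
  qed (use le in auto)
  have "(\<integral>y. indicator S y * norm (y - b) powr (-p) \<partial>lborel) \<le>
      (\<integral>y. indicator (ball 0 R) (y - b) * norm (y - b) powr (-p) \<partial>lborel)"
    by (rule Bochner_Integration.integral_mono[OF 1 i le])
  also have "\<dots> = powr_mass p R"
    unfolding powr_mass_def
    by (rule lborel_integral_shift)
      (use integrable_norm_powr_disc[OF p, of R] in auto)
  finally show "(\<integral>y. indicator S y * norm (y - b) powr (-p) \<partial>lborel) \<le> powr_mass p R" .
qed

lemma abs_ln_le:
  fixes t :: real
  assumes "0 \<le> t"
  shows "\<bar>ln t\<bar> \<le> t powr (-1) + t"
proof (cases "t = 0")
  case False
  then have t: "t > 0" using assms by simp
  have "ln t \<le> t" using ln_le_minus_one[OF t] by simp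
  moreover have "- ln t \<le> 1 / t" using ln_le_minus_one[of "1 / t"] t by (simp add: ln_div)
  moreover have "0 < 1 / t" using t by simp
  ultimately have "\<bar>ln t\<bar> \<le> 1 / t + t" using t by (simp only: abs_le_iff) linarith
  then show ?thesis using t by (simp add: powr_minus divide_inverse)
qed simp

lemma real_indicator_ball_measurable [measurable]:
  "(indicator (ball a r) :: 'a::metric_space \<Rightarrow> real) \<in> borel_measurable borel"
  by (intro borel_measurable_indicator) auto

text \<open>A solution after rescaling, on the disc of radius L, with its density extended by 0.
  Only the representation formula ties F to u here; that F is a weight times e^u enters later
  through assumptions on F exp (-u). The bound on F serves integrability alone: no estimate depends
  on its size.\<close>

locale disc_solution =
  fixes u F :: "real^2 \<Rightarrow> real" and L :: real
  assumes u_cont: "continuous_on (ball 0 L) u"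
    and F_borel [measurable]: "F \<in> borel_measurable borel"
    and F_nonneg: "\<And>y. 0 \<le> F y"
    and F_bounded: "\<exists>B. \<forall>y. F y \<le> B"
    and F_outside: "\<And>y. y \<notin> ball 0 L \<Longrightarrow> F y = 0"
    and rep: "\<And>a r. 0 < r \<Longrightarrow> cball a r \<subseteq> ball 0 L \<Longrightarrow>
      u a = disc_mean r u a + (\<integral>y. F y * green_ker r (y - a) \<partial>lborel)"
begin

definition M :: real where "M = (\<integral>y. F y \<partial>lborel)"

definition mass :: "real \<Rightarrow> real" where "mass r = (\<integral>y. indicator (ball 0 r) y * F y \<partial>lborel)"

lemma F_mult_integrable:
  assumes "integrable lborel g"
  shows "integrable lborel (\<lambda>y. F y * g y)"
proof -
  obtain B where B: "\<forall>y. F y \<le> B" using F_bounded by blast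
  have [measurable]: "g \<in> borel_measurable borel" using assms by auto
  show ?thesis
  proof (rule Bochner_Integration.integrable_bound[OF integrable_mult_right[OF assms, of B]])
    show "AE y in lborel. norm (F y * g y) \<le> norm (B * g y)"
    proof (rule AE_I2)
      fix y
      have "\<bar>F y\<bar> \<le> \<bar>B\<bar>" using B F_nonneg[of y] by (metis abs_of_nonneg order_trans)
      then show "norm (F y * g y) \<le> norm (B * g y)" by (simp add: abs_mult mult_right_mono)
    qed
  qed measurable
qed

lemma F_indicator: "F y = F y * indicator (ball 0 L) y"
  using F_outside[of y] by (auto simp: indicator_def)

lemma integrable_indicator_ball: "integrable lborel (\<lambda>y::real^2. indicator (ball a r) y :: real)"
  by (rule integrable_real_indicator) (use emeasure_lborel_ball_finite[of a r] in \<open>auto simp: less_top\<close>)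

lemma F_integrable: "integrable lborel F"
  using F_mult_integrable[OF integrable_indicator_ball[of 0 L]] by (simp flip: F_indicator)

lemma ball_F_integrable: "integrable lborel (\<lambda>y. indicator (ball a r) y * F y)"
  using F_mult_integrable[OF integrable_indicator_ball[of a r]] by (simp add: mult.commute)

lemma mass_nonneg: "0 \<le> mass r"
  unfolding mass_def using F_nonneg by (intro Bochner_Integration.integral_nonneg) auto

lemma mass_mono: "r \<le> r' \<Longrightarrow> mass r \<le> mass r'"
  unfolding mass_def using F_nonneg
  by (intro Bochner_Integration.integral_mono ball_F_integrable) (auto simp: indicator_def)

lemma ball_F_le_M: "(\<integral>y. indicator (ball a r) y * F y \<partial>lborel) \<le> M"
  unfolding M_def using F_nonneg
  by (intro Bochner_Integration.integral_mono ball_F_integrable F_integrable) (auto simp: indicator_def)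

lemma mass_le_M: "mass r \<le> M"
  unfolding mass_def by (rule ball_F_le_M)

lemma F_ker_integrable:
  assumes "0 < r"
  shows "integrable lborel (\<lambda>y. F y * green_ker r (y - a))"
  by (rule F_mult_integrable[OF integrable_green_ker[OF assms]])

lemma u_set_integrable:
  assumes "cball a r \<subseteq> ball 0 L"
  shows "set_integrable lborel (ball a r) u"
proof -
  have "set_integrable lborel (cball a r) u"
    using integrable_on_cball[of a r u] continuous_on_subset[OF u_cont assms] by (simp add: set_integrable_def)
  then show ?thesis by (rule set_integrable_subset) auto
qed

lemma disc_mean_defect:
  assumes "cball a r \<subseteq> ball 0 L" "0 < r"
  shows "disc_mean r (\<lambda>y. C - u y) a = C - disc_mean r u a"
    and "set_integrable lborel (ball a r) (\<lambda>y. C - u y)"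
proof -
  have c: "set_integrable lborel (ball a r) (\<lambda>_. C)"
    using integrable_indicator_ball[of a r] by (simp add: set_integrable_def)
  have "(LINT y:ball a r|lborel. C - u y) = pi * r\<^sup>2 * C - (LINT y:ball a r|lborel. u y)"
    using set_integral_diff(2)[OF c u_set_integrable[OF assms(1)]] circle_area[of r a] assms(2)
    by (simp add: set_lebesgue_integral_def mult.commute)
  then show "disc_mean r (\<lambda>y. C - u y) a = C - disc_mean r u a"
    using assms(2) by (simp add: disc_mean_def diff_divide_distrib)
  show "set_integrable lborel (ball a r) (\<lambda>y. C - u y)"
    by (rule set_integral_diff(1)[OF c u_set_integrable[OF assms(1)]])
qed

text \<open>No smoothness of \<open>u\<close> is used: the displacement is compared through disc means of the nonnegative
  function \<open>C - u\<close> over two slightly different radii.\<close>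

lemma displacement_lower:
  assumes h: "0 < h" "0 < \<rho>" and d: "dist x x' \<le> h"
    and sub: "cball x (\<rho> + h) \<subseteq> ball 0 L" and C: "\<And>y. y \<in> ball 0 L \<Longrightarrow> u y \<le> C"
  shows "u x' - u x \<ge> (\<integral>y. F y * (green_ker \<rho> (y - x') - green_ker (\<rho> + h) (y - x)) \<partial>lborel)
     - (((\<rho> + h) / \<rho>)\<^sup>2 - 1) * disc_mean (\<rho> + h) (\<lambda>y. C - u y) x"
proof -
  have sub': "cball x' \<rho> \<subseteq> ball 0 L"
  proof
    fix y assume "y \<in> cball x' \<rho>"
    then have "y \<in> cball x (\<rho> + h)" using d dist_triangle[of x y x'] by simp
    then show "y \<in> ball 0 L" using sub by blast
  qed
  have g0: "0 \<le> C - u y" if "y \<in> ball x (\<rho> + h)" for y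
    using C[of y] sub that by (auto simp: subset_eq)
  have "disc_mean \<rho> (\<lambda>y. C - u y) x' \<le> ((\<rho> + h) / \<rho>)\<^sup>2 * disc_mean (\<rho> + h) (\<lambda>y. C - u y) x"
    by (rule disc_mean_mono_shift[OF disc_mean_defect(2)[OF sub] g0 d h(2)]) (use h in auto)
  moreover have "u x' = C - disc_mean \<rho> (\<lambda>y. C - u y) x' + (\<integral>y. F y * green_ker \<rho> (y - x') \<partial>lborel)"
    using rep[OF h(2) sub'] disc_mean_defect(1)[OF sub' h(2), of C] by simp
  moreover have "u x = C - disc_mean (\<rho> + h) (\<lambda>y. C - u y) x + (\<integral>y. F y * green_ker (\<rho> + h) (y - x) \<partial>lborel)"
    using rep[OF _ sub] disc_mean_defect(1)[OF sub, of C] h by simp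
  moreover have "(\<integral>y. F y * (green_ker \<rho> (y - x') - green_ker (\<rho> + h) (y - x)) \<partial>lborel) =
     (\<integral>y. F y * green_ker \<rho> (y - x') \<partial>lborel) - (\<integral>y. F y * green_ker (\<rho> + h) (y - x) \<partial>lborel)"
    using F_ker_integrable[OF h(2), of x'] F_ker_integrable[of "\<rho> + h" x] h
    by (simp add: right_diff_distrib)
  ultimately show ?thesis by (simp add: left_diff_distrib)
qed

text \<open>The pole b enters the bound only through its distance to the centre. This uniformity is
  what the later application of Fubini needs, where the poles are x and s x with x varying.\<close>

lemma
  fixes a b :: "real^2"
  shows ln_kernel_integrable: "integrable lborel (\<lambda>y. indicator (ball a r) y * ln (norm (y - b)))"
  and ln_kernel_bound: "(\<integral>y. \<bar>indicator (ball a r) y * ln (norm (y - b))\<bar> \<partial>lborel) \<le>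
        powr_mass 1 (r + dist a b) + (r + dist a b) * (\<integral>y. indicator (ball a r) y \<partial>lborel)"
proof -
  let ?R = "r + dist a b"
  have d: "dist y b < ?R" if "y \<in> ball a r" for y
    using that dist_triangle[of y b a] by (simp add: dist_commute)
  have b: "\<bar>indicator (ball a r) y * ln (norm (y - b))\<bar> \<le>
      indicator (ball a r) y * norm (y - b) powr (-1) + ?R * indicator (ball a r) y" for y
    using abs_ln_le[of "norm (y - b)"] d[of y] by (auto simp: indicator_def dist_norm)
  have i1: "integrable lborel (\<lambda>y. indicator (ball a r) y * norm (y - b) powr (-1))"
    by (rule powr_shift(1)[where R="?R"]) (use d in auto)
  have i: "integrable lborel (\<lambda>y. indicator (ball a r) y * norm (y - b) powr (-1) + ?R * indicator (ball a r) y)"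
    by (intro Bochner_Integration.integrable_add integrable_mult_right integrable_indicator_ball i1)
  show 1: "integrable lborel (\<lambda>y. indicator (ball a r) y * ln (norm (y - b)))"
  proof (rule Bochner_Integration.integrable_bound[OF i])
    show "AE y in lborel. norm (indicator (ball a r) y * ln (norm (y - b))) \<le>
      norm (indicator (ball a r) y * norm (y - b) powr (-1) + ?R * indicator (ball a r) y)"
      unfolding real_norm_def by (intro AE_I2 order_trans[OF b abs_ge_self])
  qed measurable
  have "(\<integral>y. \<bar>indicator (ball a r) y * ln (norm (y - b))\<bar> \<partial>lborel) \<le>
    (\<integral>y. indicator (ball a r) y * norm (y - b) powr (-1) + ?R * indicator (ball a r) y \<partial>lborel)"
    by (rule Bochner_Integration.integral_mono[OF _ i b]) (use 1 in auto)
  also have "\<dots> = (\<integral>y. indicator (ball a r) y * norm (y - b) powr (-1) \<partial>lborel) + ?R * (\<integral>y. indicator (ball a r) y \<partial>lborel)"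
    by (subst Bochner_Integration.integral_add) (use i1 integrable_indicator_ball in auto)
  also have "\<dots> \<le> powr_mass 1 ?R + ?R * (\<integral>y. indicator (ball a r) y \<partial>lborel)"
    using powr_shift(2)[of 1 "ball a r" b ?R] d by auto
  finally show "(\<integral>y. \<bar>indicator (ball a r) y * ln (norm (y - b))\<bar> \<partial>lborel) \<le>
        powr_mass 1 ?R + ?R * (\<integral>y. indicator (ball a r) y \<partial>lborel)" .
qed

lemma dil_log_eq: "x \<noteq> y \<Longrightarrow> s *\<^sub>R x \<noteq> y \<Longrightarrow> dil_log s x y = ln (norm (y - x)) - ln (norm (y - s *\<^sub>R x))"
  by (simp add: dil_log_def ln_div norm_minus_commute)

text \<open>The part of the density whose pairwise interaction is symmetrized; the rest of F is
  treated by \<open>dil_log_lower\<close>.\<close>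

definition FR :: "real \<Rightarrow> real^2 \<Rightarrow> real" where "FR R y = indicator (ball 0 R) y * F y"

lemma FR_borel [measurable]: "FR R \<in> borel_measurable borel"
  unfolding FR_def[abs_def] by measurable

lemma FR_nonneg: "0 \<le> FR R y" by (simp add: FR_def F_nonneg)

lemma FR_integrable: "integrable lborel (FR R)" unfolding FR_def[abs_def] by (rule ball_F_integrable)

lemma mass_FR: "mass R = (\<integral>y. FR R y \<partial>lborel)" by (simp add: mass_def FR_def)

lemma FR_ln_integrable: "integrable lborel (\<lambda>y. FR R y * ln (norm (y - b)))"
  using F_mult_integrable[OF ln_kernel_integrable[of 0 R b]] by (simp add: FR_def mult_ac)

lemma FR_dil_log_integrable: "integrable lborel (\<lambda>y. FR R y * dil_log s x y)"
proof -
  have "integrable lborel (\<lambda>y. FR R y * ln (norm (y - x)) - FR R y * ln (norm (y - s *\<^sub>R x)))"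
    by (intro Bochner_Integration.integrable_diff FR_ln_integrable)
  moreover have "AE y in lborel. FR R y * ln (norm (y - x)) - FR R y * ln (norm (y - s *\<^sub>R x)) = FR R y * dil_log s x y"
    using AE_lborel_singleton[of x] AE_lborel_singleton[of "s *\<^sub>R x"]
    by eventually_elim (simp add: dil_log_eq right_diff_distrib)
  ultimately show ?thesis
    by (intro Bochner_Integration.integrable_cong_AE_imp[of _ _ "\<lambda>y. FR R y * dil_log s x y"]) (simp_all add: dil_log_def)
qed

text \<open>Here the integration variable is dilated, which moves the pole to x/s and adds a
  constant, since |s y - x| = s |y - x/s|.\<close>

lemma FR_dil_log_integrable': 
  assumes "s > 0"
  shows "integrable lborel (\<lambda>y. FR R y * dil_log s y x)"
proof -
  have "integrable lborel (\<lambda>y. FR R y * ln (norm (y - x)) - (ln s * FR R y + FR R y * ln (norm (y - (1/s) *\<^sub>R x))))"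
    by (intro Bochner_Integration.integrable_diff Bochner_Integration.integrable_add FR_ln_integrable integrable_mult_right FR_integrable)
  moreover have "AE y in lborel. FR R y * ln (norm (y - x)) - (ln s * FR R y + FR R y * ln (norm (y - (1/s) *\<^sub>R x))) = FR R y * dil_log s y x"
    using AE_lborel_singleton[of x] AE_lborel_singleton[of "(1/s) *\<^sub>R x"]
  proof eventually_elim
    case (elim y)
    have "s *\<^sub>R y - x = s *\<^sub>R (y - (1/s) *\<^sub>R x)" using assms by (simp add: scaleR_right_diff_distrib)
    then have n: "norm (s *\<^sub>R y - x) = s * norm (y - (1/s) *\<^sub>R x)" using assms by simp
    have eq: "dil_log s y x = ln (norm (y - x)) - (ln s + ln (norm (y - (1/s) *\<^sub>R x)))"
      unfolding dil_log_def n using assms elim by (simp add: ln_div ln_mult)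
    show ?case unfolding eq by (simp add: algebra_simps)
  qed
  ultimately show ?thesis
    by (intro Bochner_Integration.integrable_cong_AE_imp[of _ _ "\<lambda>y. FR R y * dil_log s y x"]) (simp_all add: dil_log_def)
qed

text \<open>For x in the disc of radius R both poles x and s x stay within (1 + |s|) R of the
  origin, so the inner integral of the absolute value is bounded by one constant K times
  \<open>FR R x\<close>, and Fubini's criterion applies.\<close>

lemma interaction_integrable:
  "integrable (lborel \<Otimes>\<^sub>M lborel) (\<lambda>(x, y). FR R x * (FR R y * dil_log s x y))"
proof (rule lborel_pair.Fubini_integrable)
  show meas: "(\<lambda>(x, y). FR R x * (FR R y * dil_log s x y)) \<in> borel_measurable (lborel \<Otimes>\<^sub>M lborel)"
    unfolding dil_log_def by measurable
  show "AE x in lborel. integrable lborel (\<lambda>y. case (x, y) of (x, y) \<Rightarrow> FR R x * (FR R y * dil_log s x y))"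
    using FR_dil_log_integrable by auto
  obtain B where B: "\<forall>y. F y \<le> B" using F_bounded by blast
  have B0: "0 \<le> B" using B F_nonneg[of 0] order_trans by blast
  define R' where "R' = R + (1 + \<bar>s\<bar>) * R"
  define K where "K = B * (2 * (powr_mass 1 R' + R' * (\<integral>y. indicator (ball (0::real^2) R) y \<partial>lborel)))"
  have J: "(\<integral>y. \<bar>FR R y * ln (norm (y - b))\<bar> \<partial>lborel) \<le> B * (powr_mass 1 R' + R' * (\<integral>y. indicator (ball (0::real^2) R) y \<partial>lborel))"
    if b: "norm b \<le> (1 + \<bar>s\<bar>) * R" for b
  proof -
    have le: "R + dist 0 b \<le> R'" using b by (simp add: R'_def)
    have "(\<integral>y. \<bar>FR R y * ln (norm (y - b))\<bar> \<partial>lborel) \<le> (\<integral>y. B * \<bar>indicator (ball 0 R) y * ln (norm (y - b))\<bar> \<partial>lborel)"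
    proof (rule Bochner_Integration.integral_mono)
      show "integrable lborel (\<lambda>y. \<bar>FR R y * ln (norm (y - b))\<bar>)" using FR_ln_integrable by auto
      show "integrable lborel (\<lambda>y. B * \<bar>indicator (ball 0 R) y * ln (norm (y - b))\<bar>)"
        by (intro integrable_mult_right integrable_abs ln_kernel_integrable)
      show "\<bar>FR R y * ln (norm (y - b))\<bar> \<le> B * \<bar>indicator (ball 0 R) y * ln (norm (y - b))\<bar>" for y
        using B[rule_format, of y] F_nonneg[of y] by (auto simp: FR_def abs_mult indicator_def mult_right_mono)
    qed
    also have "\<dots> = B * (\<integral>y. \<bar>indicator (ball 0 R) y * ln (norm (y - b))\<bar> \<partial>lborel)" by simp
    also have "\<dots> \<le> B * (powr_mass 1 (R + dist 0 b) + (R + dist 0 b) * (\<integral>y. indicator (ball (0::real^2) R) y \<partial>lborel))"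
      by (intro mult_left_mono ln_kernel_bound B0)
    also have "\<dots> \<le> B * (powr_mass 1 R' + R' * (\<integral>y. indicator (ball (0::real^2) R) y \<partial>lborel))"
    proof (intro mult_left_mono add_mono mult_right_mono le B0)
      show "powr_mass 1 (R + dist 0 b) \<le> powr_mass 1 R'"
        unfolding powr_mass_def using le
        by (intro Bochner_Integration.integral_mono integrable_norm_powr_disc) (auto simp: indicator_def)
    qed auto
    finally show ?thesis .
  qed
  show "integrable lborel (\<lambda>x. \<integral>y. norm (case (x, y) of (x, y) \<Rightarrow> FR R x * (FR R y * dil_log s x y)) \<partial>lborel)"
  proof (rule Bochner_Integration.integrable_bound[OF integrable_mult_right[OF FR_integrable[of R], of K]])
    show "(\<lambda>x. \<integral>y. norm (case (x, y) of (x, y) \<Rightarrow> FR R x * (FR R y * dil_log s x y)) \<partial>lborel) \<in> borel_measurable lborel"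
      using meas by (intro lborel.borel_measurable_lebesgue_integral) (simp add: case_prod_beta)
    show "AE x in lborel. norm (\<integral>y. norm (case (x, y) of (x, y) \<Rightarrow> FR R x * (FR R y * dil_log s x y)) \<partial>lborel) \<le> norm (K * FR R x)"
    proof (rule AE_I2)
      fix x :: "real^2"
      show "norm (\<integral>y. norm (case (x, y) of (x, y) \<Rightarrow> FR R x * (FR R y * dil_log s x y)) \<partial>lborel) \<le> norm (K * FR R x)"
      proof (cases "x \<in> ball 0 R")
        case True
        then have x: "norm x < R" by simp
        have nb: "norm x \<le> (1 + \<bar>s\<bar>) * R" "norm (s *\<^sub>R x) \<le> (1 + \<bar>s\<bar>) * R"
        proof -
          have "norm x \<le> 1 * R" using x by simp
          also have "\<dots> \<le> (1 + \<bar>s\<bar>) * R" using x norm_ge_zero[of x] by (intro mult_right_mono) linarith+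
          finally show "norm x \<le> (1 + \<bar>s\<bar>) * R" .
          have "norm (s *\<^sub>R x) \<le> \<bar>s\<bar> * R" using x by (simp add: mult_left_mono)
          also have "\<dots> \<le> (1 + \<bar>s\<bar>) * R" using x norm_ge_zero[of x] by (intro mult_right_mono) linarith+
          finally show "norm (s *\<^sub>R x) \<le> (1 + \<bar>s\<bar>) * R" .
        qed
        have "(\<integral>y. \<bar>FR R y * dil_log s x y\<bar> \<partial>lborel) \<le> (\<integral>y. \<bar>FR R y * ln (norm (y - x))\<bar> + \<bar>FR R y * ln (norm (y - s *\<^sub>R x))\<bar> \<partial>lborel)"
        proof (rule Bochner_Integration.integral_mono_AE)
          show "integrable lborel (\<lambda>y. \<bar>FR R y * dil_log s x y\<bar>)" using FR_dil_log_integrable by auto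
          show "integrable lborel (\<lambda>y. \<bar>FR R y * ln (norm (y - x))\<bar> + \<bar>FR R y * ln (norm (y - s *\<^sub>R x))\<bar>)"
            by (intro Bochner_Integration.integrable_add integrable_abs FR_ln_integrable)
          show "AE y in lborel. \<bar>FR R y * dil_log s x y\<bar> \<le> \<bar>FR R y * ln (norm (y - x))\<bar> + \<bar>FR R y * ln (norm (y - s *\<^sub>R x))\<bar>"
            using AE_lborel_singleton[of x] AE_lborel_singleton[of "s *\<^sub>R x"]
            by eventually_elim (simp add: dil_log_eq right_diff_distrib)
        qed
        also have "\<dots> = (\<integral>y. \<bar>FR R y * ln (norm (y - x))\<bar> \<partial>lborel) + (\<integral>y. \<bar>FR R y * ln (norm (y - s *\<^sub>R x))\<bar> \<partial>lborel)"
          by (rule Bochner_Integration.integral_add[OF integrable_abs[OF FR_ln_integrable] integrable_abs[OF FR_ln_integrable]])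
        also have "\<dots> \<le> K" using J[OF nb(1)] J[OF nb(2)] unfolding K_def mult.left_commute[of B 2] by linarith
        finally have "(\<integral>y. \<bar>FR R y * dil_log s x y\<bar> \<partial>lborel) \<le> K" .
        then have "FR R x * (\<integral>y. \<bar>FR R y * dil_log s x y\<bar> \<partial>lborel) \<le> FR R x * K"
          by (intro mult_left_mono FR_nonneg)
        moreover have "(\<integral>y. norm (case (x, y) of (x, y) \<Rightarrow> FR R x * (FR R y * dil_log s x y)) \<partial>lborel) =
          FR R x * (\<integral>y. \<bar>FR R y * dil_log s x y\<bar> \<partial>lborel)"
          using FR_nonneg[of R x] by (simp add: abs_mult)
        moreover have "0 \<le> FR R x * (\<integral>y. \<bar>FR R y * dil_log s x y\<bar> \<partial>lborel)" using FR_nonneg by simp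
        ultimately show ?thesis by (simp add: mult.commute abs_le_iff)
      next
        case False
        then show ?thesis by (simp add: FR_def)
      qed
    qed
  qed
qed

text \<open>By Fubini, twice the integral equals the integral of the kernel symmetrized in x and y,
  to which \<open>dil_log_sym_lower\<close> applies pair by pair. The excluded positions y = x, y =
  s x and y = x/s are null for each x.\<close>

lemma interaction_lower:
  assumes s: "1 < s"
    and ei: "\<And>x. x \<in> ball 0 R \<Longrightarrow> integrable lborel (\<lambda>y. F y * dil_err s x y)"
    and eb: "\<And>x. x \<in> ball 0 R \<Longrightarrow> (\<integral>y. F y * dil_err s x y \<partial>lborel) \<le> E"
  shows "(\<integral>x. FR R x * (\<integral>y. FR R y * dil_log s x y \<partial>lborel) \<partial>lborel) \<ge> - (ln s * (mass R)\<^sup>2 + E * mass R) / 2"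
    and "integrable lborel (\<lambda>x. FR R x * (\<integral>y. FR R y * dil_log s x y \<partial>lborel))"
proof -
  define G where "G x y = FR R x * (FR R y * dil_log s x y)" for x y
  have Gi: "integrable (lborel \<Otimes>\<^sub>M lborel) (\<lambda>(x, y). G x y)"
    using interaction_integrable[of R s] by (simp add: G_def)
  define I where "I = (\<integral>x. (\<integral>y. G x y \<partial>lborel) \<partial>lborel)"
  have I1: "integrable lborel (\<lambda>x. \<integral>y. G x y \<partial>lborel)" using lborel_pair.integrable_fst'[OF Gi] by simp
  have I2: "integrable lborel (\<lambda>y. \<integral>x. G x y \<partial>lborel)" using lborel_pair.integrable_snd[OF Gi] by simp
  have swap: "(\<integral>y. (\<integral>x. G x y \<partial>lborel) \<partial>lborel) = I"
    unfolding I_def by (rule lborel_pair.Fubini_integral[OF Gi])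
  have point: "- (ln s * mass R + E) * FR R x \<le> (\<integral>y. G x y \<partial>lborel) + (\<integral>y. G y x \<partial>lborel)" for x
  proof (cases "x \<in> ball 0 R")
    case True
    have FRe: "integrable lborel (\<lambda>y. FR R y * dil_err s x y)"
      "(\<integral>y. FR R y * dil_err s x y \<partial>lborel) \<le> E"
    proof -
      have le: "FR R y * dil_err s x y \<le> F y * dil_err s x y" for y
        using F_nonneg[of y] dil_err_nonneg[OF s, of x y] by (auto simp: FR_def indicator_def)
      show 1: "integrable lborel (\<lambda>y. FR R y * dil_err s x y)"
        by (rule Bochner_Integration.integrable_bound[OF ei[OF True]])
           (use le FR_nonneg F_nonneg dil_err_nonneg[OF s] in \<open>auto simp: abs_mult dil_err_def\<close>)
      show "(\<integral>y. FR R y * dil_err s x y \<partial>lborel) \<le> E"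
        using Bochner_Integration.integral_mono[OF 1 ei[OF True] le] eb[OF True] by simp
    qed
    have "- (ln s * mass R + E) \<le> - (ln s) * mass R - (\<integral>y. FR R y * dil_err s x y \<partial>lborel)"
      using FRe(2) by simp
    also have "\<dots> = (\<integral>y. - (ln s) * FR R y - FR R y * dil_err s x y \<partial>lborel)"
      using FR_integrable FRe(1) by (simp add: mass_FR)
    also have "\<dots> \<le> (\<integral>y. FR R y * dil_log s x y + FR R y * dil_log s y x \<partial>lborel)"
    proof (rule Bochner_Integration.integral_mono_AE)
      show "integrable lborel (\<lambda>y. - (ln s) * FR R y - FR R y * dil_err s x y)"
        using FR_integrable FRe(1) by auto
      show "integrable lborel (\<lambda>y. FR R y * dil_log s x y + FR R y * dil_log s y x)"
        using FR_dil_log_integrable FR_dil_log_integrable' s by auto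
      show "AE y in lborel. - (ln s) * FR R y - FR R y * dil_err s x y \<le> FR R y * dil_log s x y + FR R y * dil_log s y x"
        using AE_lborel_singleton[of x] AE_lborel_singleton[of "s *\<^sub>R x"] AE_lborel_singleton[of "(1/s) *\<^sub>R x"]
      proof eventually_elim
        case (elim y)
        have "s *\<^sub>R y \<noteq> x" using elim(3) s by auto
        then have "- ln s - dil_err s x y \<le> dil_log s x y + dil_log s y x"
          using elim s by (intro dil_log_sym_lower) auto
        then have "FR R y * (- ln s - dil_err s x y) \<le> FR R y * (dil_log s x y + dil_log s y x)"
          by (intro mult_left_mono FR_nonneg)
        then show ?case by (simp add: algebra_simps)
      qed
    qed
    also have "\<dots> = (\<integral>y. FR R y * dil_log s x y \<partial>lborel) + (\<integral>y. FR R y * dil_log s y x \<partial>lborel)"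
      using FR_dil_log_integrable FR_dil_log_integrable' s by (intro Bochner_Integration.integral_add) auto
    finally have "FR R x * (- (ln s * mass R + E)) \<le> FR R x * ((\<integral>y. FR R y * dil_log s x y \<partial>lborel) + (\<integral>y. FR R y * dil_log s y x \<partial>lborel))"
      by (intro mult_left_mono FR_nonneg)
    moreover have "(\<integral>y. G y x \<partial>lborel) = FR R x * (\<integral>y. FR R y * dil_log s y x \<partial>lborel)"
    proof -
      have "G y x = FR R x * (FR R y * dil_log s y x)" for y by (simp add: G_def)
      then show ?thesis by simp
    qed
    ultimately show ?thesis by (simp add: G_def distrib_left mult.commute)
  next
    case False
    then show ?thesis by (simp add: G_def FR_def)
  qed
  have "- (ln s * mass R + E) * mass R = (\<integral>x. - (ln s * mass R + E) * FR R x \<partial>lborel)"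
    by (simp add: mass_FR)
  also have "\<dots> \<le> (\<integral>x. (\<integral>y. G x y \<partial>lborel) + (\<integral>y. G y x \<partial>lborel) \<partial>lborel)"
    by (rule Bochner_Integration.integral_mono[OF integrable_mult_right[OF FR_integrable] Bochner_Integration.integrable_add[OF I1 I2] point])
  also have "\<dots> = I + I"
    using Bochner_Integration.integral_add[OF I1 I2] swap by (simp add: I_def)
  finally have "I \<ge> - (ln s * (mass R)\<^sup>2 + E * mass R) / 2"
    by (simp add: algebra_simps power2_eq_square)
  then show "(\<integral>x. FR R x * (\<integral>y. FR R y * dil_log s x y \<partial>lborel) \<partial>lborel) \<ge> - (ln s * (mass R)\<^sup>2 + E * mass R) / 2"
    by (simp add: I_def G_def)
  show "integrable lborel (\<lambda>x. FR R x * (\<integral>y. FR R y * dil_log s x y \<partial>lborel))"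
    using I1 by (simp add: G_def)
qed

end

section \<open>From the displacement estimate to a mass inequality\<close>

context disc_solution
begin

text \<open>The factor |y|^p in \<open>dil_err_le\<close> cancels the assumed singularity |y|^(-p)
  of F. What remains is |x - y|^(-p), integrable uniformly in x; the radius 2 L contains the disc as
  seen from any of its points.\<close>

lemma dil_err_integral:
  assumes s: "1 < s" and p: "1 < p" "p < 2" and x: "x \<in> ball 0 L" and A: "0 \<le> A"
    and F: "\<And>y. y \<noteq> 0 \<Longrightarrow> y \<in> ball 0 L \<Longrightarrow> F y \<le> A * norm y powr (-p)"
  shows "integrable lborel (\<lambda>y. F y * dil_err s x y)"
    and "(\<integral>y. F y * dil_err s x y \<partial>lborel) \<le> 6 * (s - 1) powr p * (M + A * powr_mass p (2 * L))"
proof -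
  define g where "g y = 6 * (s - 1) powr p * (F y + A * (indicator (ball 0 L) y * norm (y - x) powr (-p)))" for y
  have d: "dist y x < 2 * L" if "y \<in> ball 0 L" for y
    using that x dist_triangle[of y x 0] by simp
  have i: "integrable lborel (\<lambda>y. indicator (ball 0 L) y * norm (y - x) powr (-p))"
    by (rule powr_shift(1)[where R="2 * L"]) (use p d in auto)
  have gi: "integrable lborel g"
    unfolding g_def by (intro integrable_mult_right Bochner_Integration.integrable_add F_integrable i)
  have le: "AE y in lborel. norm (F y * dil_err s x y) \<le> g y"
    using AE_lborel_singleton[of 0] AE_lborel_singleton[of x]
  proof eventually_elim
    case (elim y)
    show ?case
    proof (cases "y \<in> ball 0 L")
      case True
      have "F y * dil_err s x y \<le> F y * (6 * (s - 1) powr p * (1 + norm y powr p * norm (x - y) powr (-p)))"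
        using elim by (intro mult_left_mono F_nonneg dil_err_le[OF s p]) auto
      also have "\<dots> = 6 * (s - 1) powr p * (F y + (F y * norm y powr p) * norm (y - x) powr (-p))"
        by (simp add: algebra_simps norm_minus_commute)
      also have "\<dots> \<le> g y"
      proof -
        have "F y * norm y powr p \<le> A * norm y powr (-p) * norm y powr p"
          using F elim True by (intro mult_right_mono) auto
        also have "\<dots> = A" using elim by (simp add: powr_minus)
        finally show ?thesis using True s unfolding g_def
          by (auto intro!: mult_left_mono add_left_mono mult_right_mono)
      qed
      finally show ?thesis using F_nonneg[of y] dil_err_nonneg[OF s, of x y] by simp
    next
      case False
      then show ?thesis using A s by (simp add: F_outside g_def)
    qed
  qed
  show 1: "integrable lborel (\<lambda>y. F y * dil_err s x y)"
  proof (rule Bochner_Integration.integrable_bound[OF gi])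
    show "AE y in lborel. norm (F y * dil_err s x y) \<le> norm (g y)"
      using le by eventually_elim simp
  qed (simp add: dil_err_def)
  have "(\<integral>y. F y * dil_err s x y \<partial>lborel) \<le> (\<integral>y. g y \<partial>lborel)"
    by (rule Bochner_Integration.integral_mono_AE[OF 1 gi]) (use le in eventually_elim, simp)
  also have "\<dots> = 6 * (s - 1) powr p * (M + A * (\<integral>y. indicator (ball 0 L) y * norm (y - x) powr (-p) \<partial>lborel))"
    unfolding g_def M_def using F_integrable i by simp
  also have "\<dots> \<le> 6 * (s - 1) powr p * (M + A * powr_mass p (2 * L))"
    using powr_shift(2)[of p "ball 0 L" x "2 * L"] p d s A by (intro mult_left_mono add_left_mono) auto
  finally show "(\<integral>y. F y * dil_err s x y \<partial>lborel) \<le> 6 * (s - 1) powr p * (M + A * powr_mass p (2 * L))" .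
qed

text \<open>For y in the disc of radius R the term \<open>dil_log\<close> is kept, to be symmetrized
  later; for all other y one has |x| < R \<le> |y| and \<open>dil_log_lower\<close> applies.
  \<open>R2\<close> bounds all radii that the pigeonhole argument may select, so that h and \<rho>
  do not depend on the selected one. The condition on \<rho> ensures that points beyond the support
  of the larger kernel lie outside the disc of radius R.\<close>

lemma dilation_lower:
  assumes s: "1 < s" and x: "x \<in> ball 0 R" and R: "0 < R" "R \<le> R2" and \<rho>: "2 * R2 \<le> \<rho>"
    and h: "h = (s - 1) * R2" and L: "\<rho> + h + R2 \<le> L"
    and C: "\<And>y. y \<in> ball 0 L \<Longrightarrow> u y \<le> C"
    and ei: "integrable lborel (\<lambda>y. F y * dil_err s x y)"
    and eb: "(\<integral>y. F y * dil_err s x y \<partial>lborel) \<le> E"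
    and G: "disc_mean (\<rho> + h) (\<lambda>y. C - u y) x \<le> G"
  shows "u (s *\<^sub>R x) - u x \<ge> ((\<integral>y. FR R y * dil_log s x y \<partial>lborel) - ln s / 2 * (M - mass R) - E / 2) / (2 * pi)
     - (2 * h / \<rho> * M / (2 * pi) + (((\<rho> + h) / \<rho>)\<^sup>2 - 1) * G)"
proof -
  have h0: "0 < h" using h s R by simp
  have \<rho>0: "0 < \<rho>" using \<rho> R by linarith
  have xR: "norm x < R" using x by simp
  have dx: "dist x (s *\<^sub>R x) \<le> h"
  proof -
    have "x - s *\<^sub>R x = (1 - s) *\<^sub>R x" by (simp add: scaleR_left_diff_distrib)
    then have "dist x (s *\<^sub>R x) = (s - 1) * norm x" using s by (simp add: dist_norm)
    also have "\<dots> \<le> h" unfolding h using xR R s by (intro mult_left_mono) auto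
    finally show ?thesis .
  qed
  have sub: "cball x (\<rho> + h) \<subseteq> ball 0 L"
  proof
    fix y assume "y \<in> cball x (\<rho> + h)"
    then have "norm y \<le> norm x + (\<rho> + h)" using norm_triangle_ineq[of x "y - x"] by (simp add: dist_norm norm_minus_commute)
    then show "y \<in> ball 0 L" using xR R L by simp
  qed
  \<comment> \<open>The second term carries the mass outside the disc of radius R, with the
    one-sided loss ln s / 2; the last one is the error of replacing the kernels by
    logarithms.\<close>
  define lo where "lo y = (FR R y * dil_log s x y - ln s / 2 * (F y - FR R y) - F y * dil_err s x y / 2 - 2 * h / \<rho> * F y) / (2 * pi)" for y
  have loi: "integrable lborel lo"
    unfolding lo_def
    by (intro Bochner_Integration.integrable_diff integrable_divide integrable_mult_right
        FR_dil_log_integrable F_integrable FR_integrable ei)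
  have point: "AE y in lborel. lo y \<le> F y * (green_ker \<rho> (y - s *\<^sub>R x) - green_ker (\<rho> + h) (y - x))"
    using AE_lborel_singleton[of x] AE_lborel_singleton[of "s *\<^sub>R x"]
  proof eventually_elim
    case (elim y)
    have e0: "0 \<le> F y * dil_err s x y" using F_nonneg dil_err_nonneg[OF s] by simp
    have lns: "0 < ln s" using s by simp
    have h\<rho>: "0 \<le> 2 * h / \<rho> * F y" using h0 \<rho>0 F_nonneg by simp
    show ?case
    proof (cases "norm (y - x) < \<rho> + h")
      case True
      have "norm ((y - s *\<^sub>R x) - (y - x)) \<le> h" using dx by (simp add: dist_norm)
      then have k: "(ln (norm (y - x) / norm (y - s *\<^sub>R x)) - 2 * h / \<rho>) / (2 * pi) \<le> green_ker \<rho> (y - s *\<^sub>R x) - green_ker (\<rho> + h) (y - x)"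
        using elim True by (intro green_ker_diff_lower h0 \<rho>0) auto
      have dl: "ln (norm (y - x) / norm (y - s *\<^sub>R x)) = dil_log s x y"
        by (simp add: dil_log_def norm_minus_commute)
      have "lo y \<le> F y * ((dil_log s x y - 2 * h / \<rho>) / (2 * pi))"
      proof (cases "y \<in> ball 0 R")
        case True
        then show ?thesis using e0 by (simp add: lo_def FR_def divide_right_mono algebra_simps)
      next
        case False
        then have "- ln s / 2 - dil_err s x y / 2 \<le> dil_log s x y"
          using elim s xR by (intro dil_log_lower) auto
        then have "F y * (- ln s / 2 - dil_err s x y / 2) \<le> F y * dil_log s x y"
          by (intro mult_left_mono F_nonneg)
        then have "(- (ln s / 2 * F y) - F y * dil_err s x y / 2 - 2 * h / \<rho> * F y) / (2 * pi) \<le> (F y * dil_log s x y - 2 * h / \<rho> * F y) / (2 * pi)"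
          by (intro divide_right_mono) (auto simp: algebra_simps)
        then show ?thesis using False by (simp add: lo_def FR_def algebra_simps)
      qed
      also have "\<dots> \<le> F y * (green_ker \<rho> (y - s *\<^sub>R x) - green_ker (\<rho> + h) (y - x))"
        using k unfolding dl by (intro mult_left_mono F_nonneg)
      finally show ?thesis .
    next
      case False
      have "R \<le> norm y"
      proof (rule ccontr)
        assume "\<not> R \<le> norm y"
        then have "norm (y - x) < 2 * R2" using xR R norm_triangle_ineq4[of y x] by linarith
        then show False using False \<rho> h0 by linarith
      qed
      then have "FR R y = 0" by (simp add: FR_def)
      moreover have "0 \<le> ln s * F y" using lns F_nonneg[of y] by simp
      ultimately have "lo y \<le> 0" using e0 h\<rho> by (auto simp: lo_def intro!: divide_nonpos_pos)
      also have "0 \<le> F y * (green_ker \<rho> (y - s *\<^sub>R x) - green_ker (\<rho> + h) (y - x))"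
        using False green_ker_eq_0[of "\<rho> + h" "y - x"] h0 \<rho>0 green_ker_nonneg F_nonneg by simp
      finally show ?thesis .
    qed
  qed
  have "(\<integral>y. lo y \<partial>lborel) \<le> (\<integral>y. F y * (green_ker \<rho> (y - s *\<^sub>R x) - green_ker (\<rho> + h) (y - x)) \<partial>lborel)"
  proof (rule Bochner_Integration.integral_mono_AE[OF loi _ point])
    have "integrable lborel (\<lambda>y. F y * green_ker \<rho> (y - s *\<^sub>R x) - F y * green_ker (\<rho> + h) (y - x))"
      using h0 \<rho>0 by (intro Bochner_Integration.integrable_diff F_ker_integrable) auto
    then show "integrable lborel (\<lambda>y. F y * (green_ker \<rho> (y - s *\<^sub>R x) - green_ker (\<rho> + h) (y - x)))"
      by (simp add: right_diff_distrib)
  qed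
  moreover have "(\<integral>y. lo y \<partial>lborel) = ((\<integral>y. FR R y * dil_log s x y \<partial>lborel) - ln s / 2 * (M - mass R)
      - (\<integral>y. F y * dil_err s x y \<partial>lborel) / 2 - 2 * h / \<rho> * M) / (2 * pi)"
    unfolding lo_def M_def mass_FR
    using FR_dil_log_integrable[of R s x] F_integrable FR_integrable[of R] ei
    by simp
  moreover have "((\<integral>y. FR R y * dil_log s x y \<partial>lborel) - ln s / 2 * (M - mass R) - E / 2 - 2 * h / \<rho> * M) / (2 * pi) \<le> \<dots>"
    using eb by (intro divide_right_mono) auto
  moreover have "(((\<rho> + h) / \<rho>)\<^sup>2 - 1) * disc_mean (\<rho> + h) (\<lambda>y. C - u y) x \<le> (((\<rho> + h) / \<rho>)\<^sup>2 - 1) * G"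
  proof (rule mult_left_mono[OF G])
    have "1 \<le> (\<rho> + h) / \<rho>" using h0 \<rho>0 by simp
    then have "1 \<le> ((\<rho> + h) / \<rho>)\<^sup>2" by (rule one_le_power)
    then show "0 \<le> ((\<rho> + h) / \<rho>)\<^sup>2 - 1" by simp
  qed
  moreover note displacement_lower[OF h0 \<rho>0 dx sub C]
  ultimately show ?thesis by (simp add: diff_divide_distrib)
qed

text \<open>Assumption \<open>dil\<close> takes the place of differentiating the weight F exp (-u):
  under dilation by s it may lose at most a factor \<kappa>. The losses from pairs inside the disc
  and from the mass outside add up to ln s / (4 pi) times the total mass M, not just
  \<open>mass R\<close>. The divisor s^2 is the Jacobian of the dilation.\<close>

lemma pohozaev_inequality:
  assumes s: "1 < s" and R: "0 < R" "R \<le> R2" and \<rho>: "2 * R2 \<le> \<rho>"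
    and h: "h = (s - 1) * R2" and L: "\<rho> + h + R2 \<le> L"
    and C: "\<And>y. y \<in> ball 0 L \<Longrightarrow> u y \<le> C"
    and ei: "\<And>x. x \<in> ball 0 R \<Longrightarrow> integrable lborel (\<lambda>y. F y * dil_err s x y)"
    and eb: "\<And>x. x \<in> ball 0 R \<Longrightarrow> (\<integral>y. F y * dil_err s x y \<partial>lborel) \<le> E"
    and G: "\<And>x. x \<in> ball 0 R \<Longrightarrow> disc_mean (\<rho> + h) (\<lambda>y. C - u y) x \<le> G"
    and dil: "\<And>x. x \<in> ball 0 R \<Longrightarrow> F x * exp (- u x) \<le> \<kappa> * (F (s *\<^sub>R x) * exp (- u (s *\<^sub>R x)))"
  shows "- (mass R / (4 * pi)) * (ln s * M + 2 * E) - (2 * h / \<rho> * M / (2 * pi) + (((\<rho> + h) / \<rho>)\<^sup>2 - 1) * G) * mass R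
    \<le> \<kappa> / s\<^sup>2 * mass (s * R) - mass R"
proof -
  define E2 where "E2 = 2 * h / \<rho> * M / (2 * pi) + (((\<rho> + h) / \<rho>)\<^sup>2 - 1) * G"
  define I where "I x = (\<integral>y. FR R y * dil_log s x y \<partial>lborel)" for x
  define k where "k = (ln s / 2 * (M - mass R) + E / 2) / (2 * pi) + E2"
  have Ii: "integrable lborel (\<lambda>x. FR R x * I x)"
    unfolding I_def by (rule interaction_lower(2)[OF s ei eb])
  have Il: "(\<integral>x. FR R x * I x \<partial>lborel) \<ge> - (ln s * (mass R)\<^sup>2 + E * mass R) / 2"
    unfolding I_def by (rule interaction_lower(1)[OF s ei eb])
  have FRs: "FR (s * R) (s *\<^sub>R x) = indicator (ball 0 R) x * F (s *\<^sub>R x)" for x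
    using s by (simp add: FR_def indicator_def)
  have si: "integrable lborel (\<lambda>x. FR (s * R) (s *\<^sub>R x))"
    using lborel_integrable_affine[OF FR_integrable[of "s * R"], of s 0] s by simp
  have sm: "(\<integral>x. FR (s * R) (s *\<^sub>R x) \<partial>lborel) = mass (s * R) / s\<^sup>2"
    using lborel_integral_affine[of "FR (s * R)" s 0] s by (simp add: mass_FR)
  have point: "FR R x * I x / (2 * pi) - k * FR R x \<le> \<kappa> * FR (s * R) (s *\<^sub>R x) - FR R x" for x
  proof (cases "x \<in> ball 0 R")
    case True
    have "I x / (2 * pi) - k \<le> u (s *\<^sub>R x) - u x"
      using dilation_lower[OF s True R \<rho> h L C ei[OF True] eb[OF True] G[OF True]]
      by (simp add: I_def k_def E2_def diff_divide_distrib add_divide_distrib)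
    also have "\<dots> \<le> exp (u (s *\<^sub>R x) - u x) - 1" using exp_ge_add_one_self[of "u (s *\<^sub>R x) - u x"] by linarith
    finally have "F x * (I x / (2 * pi) - k) \<le> F x * (exp (u (s *\<^sub>R x) - u x) - 1)"
      by (intro mult_left_mono F_nonneg)
    also have "\<dots> = (F x * exp (- u x)) * exp (u (s *\<^sub>R x)) - F x"
      by (simp add: exp_diff exp_minus field_simps)
    also have "\<dots> \<le> (\<kappa> * (F (s *\<^sub>R x) * exp (- u (s *\<^sub>R x)))) * exp (u (s *\<^sub>R x)) - F x"
      using dil[OF True] by (intro diff_right_mono mult_right_mono) auto
    also have "\<dots> = \<kappa> * F (s *\<^sub>R x) - F x" by (simp add: exp_minus)
    finally show ?thesis unfolding FRs using True by (simp add: FR_def[of R] algebra_simps)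
  next
    case False
    then show ?thesis by (simp add: FRs FR_def[of R])
  qed
  have "- (ln s * (mass R)\<^sup>2 + E * mass R) / 2 / (2 * pi) - k * mass R \<le> (\<integral>x. FR R x * I x \<partial>lborel) / (2 * pi) - k * mass R"
    using Il by (intro diff_right_mono divide_right_mono) auto
  also have "\<dots> = (\<integral>x. FR R x * I x / (2 * pi) - k * FR R x \<partial>lborel)"
    using Ii FR_integrable by (simp add: mass_FR)
  also have "\<dots> \<le> (\<integral>x. \<kappa> * FR (s * R) (s *\<^sub>R x) - FR R x \<partial>lborel)"
    by (rule Bochner_Integration.integral_mono[OF _ _ point]) (use Ii FR_integrable si in auto)
  also have "\<dots> = \<kappa> * (mass (s * R) / s\<^sup>2) - mass R"
    using si FR_integrable by (simp add: sm flip: mass_FR)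
  finally have "- (ln s * (mass R)\<^sup>2 + E * mass R) / 2 / (2 * pi) - k * mass R \<le> \<kappa> * (mass (s * R) / s\<^sup>2) - mass R" .
  moreover have "- (ln s * (mass R)\<^sup>2 + E * mass R) / 2 / (2 * pi) - k * mass R =
      - (mass R / (4 * pi)) * (ln s * M + 2 * E) - E2 * mass R"
    by (simp add: k_def field_simps power2_eq_square)
  ultimately show ?thesis by (simp add: E2_def)
qed

section \<open>A lower bound for the mass near the peak\<close>

definition log_peak :: "real^2 \<Rightarrow> real" where
  "log_peak z = indicator (ball 0 1) z * ln (1 / norm z)"

text \<open>The density has a pole at 0 and the logarithm one at x1, and they may be arbitrarily
  close. The logarithm is bounded by a small power \<delta>, and the product of powers is dominated
  by the nearer pole: s^(-p) t^(-\<delta>) \<le> s^(-q) + t^(-q) with q = p + \<delta>, halfway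
  between p and 2. Only the unit disc around x1 matters, so the bound is independent of L.\<close>

lemma peak_log_integral:
  assumes p: "1 < p" "p < 2" and x1: "norm x1 \<le> N" and L: "N + 1 \<le> L" and A: "0 \<le> A"
    and F: "\<And>y. y \<noteq> 0 \<Longrightarrow> y \<in> ball 0 L \<Longrightarrow> F y \<le> A * (1 + norm y) ^ 4 * norm y powr (-p)"
  shows "integrable lborel (\<lambda>y. F y * log_peak (y - x1))"
    and "(\<integral>y. F y * log_peak (y - x1) \<partial>lborel) \<le> A * (N + 2) ^ 4 * (4 / (2 - p) * powr_mass ((p + 2) / 2) (N + 1))"
proof -
  define q where "q = (p + 2) / 2"
  define \<delta> where "\<delta> = (2 - p) / 2"
  have q: "0 \<le> q" "q < 2" and \<delta>: "0 < \<delta>" using p by (auto simp: q_def \<delta>_def)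
  have pq: "p + \<delta> = q" by (simp add: q_def \<delta>_def diff_divide_distrib add_divide_distrib)
  have N0: "0 \<le> N" using x1 norm_ge_zero order_trans by blast
  define B where "B = A * (N + 2) ^ 4"
  have B: "0 \<le> B" using A N0 by (simp add: B_def)
  define g where "g y = B * (1 / \<delta> * (indicator (ball x1 1) y * norm (y - 0) powr (-q) + indicator (ball x1 1) y * norm (y - x1) powr (-q)))" for y
  have d0: "dist y 0 < N + 1" "dist y x1 < N + 1" if "y \<in> ball x1 1" for y
    using that x1 N0 norm_triangle_ineq[of x1 "y - x1"] by (auto simp: dist_norm norm_minus_commute)
  have i1: "integrable lborel (\<lambda>y. indicator (ball x1 1) y * norm (y - 0) powr (-q))"
    and b1: "(\<integral>y. indicator (ball x1 1) y * norm (y - 0) powr (-q) \<partial>lborel) \<le> powr_mass q (N + 1)"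
    by (intro powr_shift(1)[where R="N+1"] powr_shift(2); use q d0 in auto)+
  have i2: "integrable lborel (\<lambda>y. indicator (ball x1 1) y * norm (y - x1) powr (-q))"
    and b2: "(\<integral>y. indicator (ball x1 1) y * norm (y - x1) powr (-q) \<partial>lborel) \<le> powr_mass q (N + 1)"
    by (intro powr_shift(1)[where R="N+1"] powr_shift(2); use q d0 in auto)+
  have gi: "integrable lborel g"
    unfolding g_def by (intro integrable_mult_right Bochner_Integration.integrable_add i1 i2)
  have lp0: "0 \<le> log_peak z" for z
    by (cases "z = 0") (auto simp: log_peak_def indicator_def)
  have le: "AE y in lborel. F y * log_peak (y - x1) \<le> g y"
    using AE_lborel_singleton[of 0] AE_lborel_singleton[of x1]
  proof eventually_elim
    case (elim y)
    show ?case
    proof (cases "y \<in> ball x1 1")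
      case True
      define s where "s = norm y"
      define t where "t = norm (y - x1)"
      have st: "0 < s" "0 < t" "t < 1" using elim True by (auto simp: s_def t_def dist_norm norm_minus_commute)
      have yL: "y \<in> ball 0 L" using d0(1)[OF True] L by simp
      have "F y \<le> A * (1 + norm y) ^ 4 * norm y powr (-p)" using F elim yL by auto
      also have "\<dots> \<le> A * (N + 2) ^ 4 * norm y powr (-p)"
        using d0(1)[OF True] A by (intro mult_right_mono mult_left_mono power_mono) auto
      finally have Fy: "F y \<le> B * s powr (-p)" by (simp add: B_def s_def)
      have "ln (1 / t) \<le> t powr (-\<delta>) / \<delta>"
      proof -
        have "\<delta> * ln (1 / t) = ln (t powr (-\<delta>))" using st by (simp add: ln_powr ln_div)
        also have "\<dots> \<le> t powr (-\<delta>)" using ln_le_minus_one[of "t powr (-\<delta>)"] st by simp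
        finally show ?thesis using \<delta> by (simp add: field_simps)
      qed
      moreover have "0 \<le> ln (1 / t)" using st by simp
      ultimately have "F y * ln (1 / t) \<le> (B * s powr (-p)) * (t powr (-\<delta>) / \<delta>)"
        using Fy B by (intro mult_mono) auto
      also have "\<dots> = B * (1 / \<delta> * (s powr (-p) * t powr (-\<delta>)))" by simp
      also have "s powr (-p) * t powr (-\<delta>) \<le> s powr (-q) + t powr (-q)"
      proof (cases "s \<le> t")
        case True
        have "s powr (-p) * t powr (-\<delta>) \<le> s powr (-p) * s powr (-\<delta>)"
          using True st \<delta> by (intro mult_left_mono powr_mono2') auto
        also have "\<dots> = s powr (-q)" unfolding powr_add[symmetric] pq[symmetric] by simp
        finally show ?thesis by (meson add_increasing2 powr_ge_zero)
      next
        case False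
        have "s powr (-p) * t powr (-\<delta>) \<le> t powr (-p) * t powr (-\<delta>)"
          using False st p by (intro mult_right_mono powr_mono2') auto
        also have "\<dots> = t powr (-q)" unfolding powr_add[symmetric] pq[symmetric] by simp
        finally show ?thesis by (meson add_increasing powr_ge_zero)
      qed
      finally have "F y * ln (1 / t) \<le> B * (1 / \<delta> * (s powr (-q) + t powr (-q)))"
        using B \<delta> by (simp add: mult_left_mono divide_right_mono)
      moreover have "y - x1 \<in> ball 0 1" using True by (simp add: dist_norm norm_minus_commute)
      ultimately show ?thesis using True by (simp add: log_peak_def g_def s_def t_def)
    next
      case False
      then have "y - x1 \<notin> ball 0 1" by (simp add: dist_norm norm_minus_commute)
      then show ?thesis using False by (simp add: log_peak_def g_def)
    qed
  qed
  show 1: "integrable lborel (\<lambda>y. F y * log_peak (y - x1))"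
  proof (rule Bochner_Integration.integrable_bound[OF gi])
    show "AE y in lborel. norm (F y * log_peak (y - x1)) \<le> norm (g y)"
      using le by eventually_elim (use F_nonneg lp0 in \<open>simp add: abs_mult\<close>)
  qed (simp add: log_peak_def)
  have "(\<integral>y. F y * log_peak (y - x1) \<partial>lborel) \<le> (\<integral>y. g y \<partial>lborel)"
    by (rule Bochner_Integration.integral_mono_AE[OF 1 gi le])
  also have "\<dots> = B * (1 / \<delta> * ((\<integral>y. indicator (ball x1 1) y * norm (y - 0) powr (-q) \<partial>lborel) +
     (\<integral>y. indicator (ball x1 1) y * norm (y - x1) powr (-q) \<partial>lborel)))"
    unfolding g_def using i1 i2 by simp
  also have "\<dots> \<le> B * (1 / \<delta> * (powr_mass q (N + 1) + powr_mass q (N + 1)))"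
    using B \<delta> b1 b2 by (intro mult_left_mono add_mono) auto
  also have "\<dots> = A * (N + 2) ^ 4 * (4 / (2 - p) * powr_mass ((p + 2) / 2) (N + 1))"
    using p by (simp add: B_def \<delta>_def q_def field_simps)
  finally show "(\<integral>y. F y * log_peak (y - x1) \<partial>lborel) \<le> A * (N + 2) ^ 4 * (4 / (2 - p) * powr_mass ((p + 2) / 2) (N + 1))" .
qed

text \<open>Since u vanishes at x1, the representation formula equates minus the disc mean with a
  kernel integral, and ln (r/|z|) is at most ln r + \<open>log_peak z\<close>. At r = 1 the term
  with M disappears, which yields a bound involving neither the mass nor L.\<close>

lemma mean_at_peak:
  assumes r: "1 \<le> r" and sub: "cball x1 r \<subseteq> ball 0 L" and u: "u x1 = 0"
    and int: "integrable lborel (\<lambda>y. F y * log_peak (y - x1))"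
    and pb: "(\<integral>y. F y * log_peak (y - x1) \<partial>lborel) \<le> P"
  shows "- disc_mean r u x1 \<le> (ln r * M + P) / (2 * pi)"
proof -
  have "AE y in lborel. F y * green_ker r (y - x1) \<le> (ln r * F y + F y * log_peak (y - x1)) / (2 * pi)"
    using AE_lborel_singleton[of x1]
  proof eventually_elim
    case (elim y)
    define z where "z = y - x1"
    have z: "0 < norm z" using elim by (simp add: z_def)
    have lnr: "0 \<le> ln r" using r by simp
    have lp: "- ln (norm z) \<le> log_peak z" "0 \<le> log_peak z"
      using z by (auto simp: log_peak_def indicator_def ln_div)
    have "green_ker r z \<le> (ln r + log_peak z) / (2 * pi)"
    proof (cases "norm z < r")
      case True
      have "green_ker r z \<le> ln (r / norm z) / (2 * pi)" by (rule green_ker_le_ln[OF z True])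
      also have "\<dots> \<le> (ln r + log_peak z) / (2 * pi)"
        using z r lp by (intro divide_right_mono) (auto simp: ln_div)
      finally show ?thesis .
    next
      case False
      then show ?thesis using green_ker_eq_0[of r z] r lp lnr by simp
    qed
    then have "F y * green_ker r z \<le> F y * ((ln r + log_peak z) / (2 * pi))"
      by (intro mult_left_mono F_nonneg)
    then show ?case by (simp add: z_def algebra_simps)
  qed
  then have "(\<integral>y. F y * green_ker r (y - x1) \<partial>lborel) \<le> (\<integral>y. (ln r * F y + F y * log_peak (y - x1)) / (2 * pi) \<partial>lborel)"
    using r int F_integrable by (intro Bochner_Integration.integral_mono_AE F_ker_integrable) auto
  also have "\<dots> = (ln r * M + (\<integral>y. F y * log_peak (y - x1) \<partial>lborel)) / (2 * pi)"
    using int F_integrable by (simp add: M_def)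
  also have "\<dots> \<le> (ln r * M + P) / (2 * pi)" using pb by (intro divide_right_mono) auto
  finally show ?thesis using rep[of r x1] r sub u by simp
qed

text \<open>Jensen's inequality in the form of a tangent: e^u \<ge> e^(-Q) (1 + Q + u) is integrated
  over the unit disc around x1, where the mean of u is at least -Q. The lower bound of the weight
  degenerates quadratically at the origin, so a disc of radius t about 0 is given up, at a cost
  controlled by u \<le> C.\<close>

lemma mass_lower:
  assumes x1: "norm x1 \<le> N" and L: "N + 1 < L" and u: "u x1 = 0" and a0: "0 < a0"
    and C: "\<And>y. y \<in> ball 0 L \<Longrightarrow> u y \<le> C"
    and lo: "\<And>y. norm y \<le> N + 1 \<Longrightarrow> a0 * min 1 ((norm y)\<^sup>2) * exp (u y) \<le> F y"
    and mean: "- disc_mean 1 u x1 \<le> Q"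
  shows "a0 * pi / 4 * exp (- 2 * Q - C) \<le> mass (N + 1)"
proof -
  have N0: "0 \<le> N" using x1 norm_ge_zero order_trans by blast
  have bN: "norm y \<le> N + 1" if "y \<in> cball x1 1" for y
    using that x1 norm_triangle_ineq[of x1 "y - x1"] by (auto simp: dist_norm norm_minus_commute)
  have bN': "norm y < N + 1" if "y \<in> ball x1 1" for y
    using that x1 norm_triangle_ineq[of x1 "y - x1"] by (auto simp: dist_norm norm_minus_commute)
  have sub: "cball x1 1 \<subseteq> ball 0 L" using bN L by force
  have C0: "0 \<le> C" using C[of x1] sub u by (auto simp: subset_eq)
  have Q0: "0 \<le> Q"
  proof -
    have "0 \<le> (\<integral>y. F y * green_ker 1 (y - x1) \<partial>lborel)"
      using F_nonneg green_ker_nonneg by (intro Bochner_Integration.integral_nonneg) auto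
    then show ?thesis using rep[of 1 x1] sub u mean by simp
  qed
  \<comment> \<open>Chosen so that the part given up, exp C * pi * t^2, is half of the main term pi
    * exp (-Q).\<close>
  define t where "t = sqrt (exp (- Q - C) / 2)"
  have t2: "t\<^sup>2 = exp (- Q - C) / 2" by (simp add: t_def)
  have t: "0 < t" "t \<le> 1"
  proof -
    show "0 < t" by (simp add: t_def)
    have "exp (- Q - C) \<le> exp 0" using C0 Q0 by (intro exp_le_cancel_iff[THEN iffD2]) simp
    then have "exp (- Q - C) / 2 \<le> 1" by (simp only: exp_zero)
    then show "t \<le> 1" unfolding t_def by (simp only: real_sqrt_le_1_iff)
  qed
  define g where "g y = a0 * t\<^sup>2 * (exp (- Q) * (indicator (ball x1 1) y * (1 + Q) + indicator (ball x1 1) y * u y) - exp C * indicator (ball 0 t) y)" for y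
  have ui: "integrable lborel (\<lambda>y. indicator (ball x1 1) y * u y)"
    using u_set_integrable[OF sub] by (simp add: set_integrable_def)
  have gi: "integrable lborel g"
    unfolding g_def
    by (intro integrable_mult_right Bochner_Integration.integrable_diff Bochner_Integration.integrable_add
        integrable_mult_left ui integrable_indicator_ball)
  have point: "g y \<le> indicator (ball 0 (N + 1)) y * F y" for y
  proof (cases "y \<in> ball x1 1")
    case True
    have "exp (- Q) * (1 + Q + u y) \<le> exp (- Q) * exp (Q + u y)"
      using exp_ge_add_one_self[of "Q + u y"] by (intro mult_left_mono) (auto simp: add.assoc)
    also have "\<dots> = exp (u y)" by (simp add: exp_add[symmetric])
    finally have e: "exp (- Q) * (1 + Q + u y) \<le> exp (u y)" .
    have "a0 * t\<^sup>2 * (exp (u y) - exp C * indicator (ball 0 t) y) \<le> F y"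
    proof (cases "y \<in> ball 0 t")
      case True
      have "y \<in> ball 0 L" using \<open>y \<in> ball x1 1\<close> sub by (auto simp: subset_eq)
      then have "exp (u y) - exp C \<le> 0" using C by simp
      then have "a0 * t\<^sup>2 * (exp (u y) - exp C * indicator (ball 0 t) y) \<le> 0"
        using True a0 by (simp add: mult_nonneg_nonpos)
      then show ?thesis using F_nonneg[of y] by linarith
    next
      case False
      then have "t\<^sup>2 \<le> (norm y)\<^sup>2" using t by (intro power_mono) auto
      moreover have "t\<^sup>2 \<le> 1" using t by (simp add: power_le_one)
      ultimately have "a0 * t\<^sup>2 * exp (u y) \<le> a0 * min 1 ((norm y)\<^sup>2) * exp (u y)"
        using a0 by (intro mult_right_mono mult_left_mono) auto
      also have "\<dots> \<le> F y" using True bN by (intro lo) auto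
      finally show ?thesis using False by simp
    qed
    moreover have "g y \<le> a0 * t\<^sup>2 * (exp (u y) - exp C * indicator (ball 0 t) y)"
      unfolding g_def using e True a0 by (intro mult_left_mono) auto
    moreover have "y \<in> ball 0 (N + 1)" using bN'[OF True] by simp
    ultimately show ?thesis by simp
  next
    case False
    then have "g y \<le> 0" unfolding g_def using a0 by (simp add: mult_nonneg_nonpos)
    then show ?thesis using F_nonneg[of y] by (simp add: indicator_def)
  qed
  have mu: "(\<integral>y. indicator (ball x1 1) y * u y \<partial>lborel) = pi * disc_mean 1 u x1"
    by (simp add: disc_mean_def set_lebesgue_integral_def)
  have "a0 * pi / 4 * exp (- 2 * Q - C) = a0 * t\<^sup>2 * (exp (- Q) * pi - exp C * (pi * t\<^sup>2))"
  proof -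
    have "exp C * t\<^sup>2 = exp (- Q) / 2" by (simp add: t2 exp_diff)
    then have "exp (- Q) * pi - exp C * (pi * t\<^sup>2) = pi * exp (- Q) / 2" by (simp add: algebra_simps)
    moreover have "exp (- 2 * Q - C) = exp (- Q) * exp (- Q - C)" by (simp add: exp_add[symmetric])
    ultimately show ?thesis unfolding t2 by simp
  qed
  also have "\<dots> \<le> a0 * t\<^sup>2 * (exp (- Q) * (pi * (1 + Q) + pi * disc_mean 1 u x1) - exp C * (pi * t\<^sup>2))"
  proof (intro mult_left_mono diff_right_mono)
    have "pi * 1 \<le> pi * (1 + Q + disc_mean 1 u x1)" using mean by (intro mult_left_mono) auto
    then show "pi \<le> pi * (1 + Q) + pi * disc_mean 1 u x1" by (simp add: algebra_simps)
  qed (use a0 in auto)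
  also have "\<dots> = (\<integral>y. g y \<partial>lborel)"
  proof -
    have "(\<integral>y. g y \<partial>lborel) = a0 * t\<^sup>2 * (exp (- Q) * (measure lborel (ball x1 1) * (1 + Q) +
        (\<integral>y. indicator (ball x1 1) y * u y \<partial>lborel)) - exp C * measure lborel (ball (0::real^2) t))"
      unfolding g_def using ui integrable_indicator_ball[of x1 1] integrable_indicator_ball[of 0 t] by simp
    moreover have "measure lborel (ball x1 1) = pi" "measure lborel (ball (0::real^2) t) = pi * t\<^sup>2"
      using circle_area[of 1 x1] circle_area[of t 0] t by (simp_all add: mult.commute)
    ultimately show ?thesis by (simp only: mu)
  qed
  also have "\<dots> \<le> mass (N + 1)"
    unfolding mass_def by (rule Bochner_Integration.integral_mono[OF gi ball_F_integrable point])
  finally show ?thesis .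
qed

end

section \<open>Excluding a mass below the threshold\<close>

lemma exp_minus_le_quadratic:
  fixes x :: real
  assumes "0 \<le> x"
  shows "exp (- x) \<le> 1 - x + x\<^sup>2"
proof -
  have "exp (- x) = 1 / exp x" by (simp add: exp_minus divide_inverse)
  also have "\<dots> \<le> 1 / (1 + x)"
    using assms by (intro divide_left_mono) (auto intro!: mult_pos_pos exp_ge_add_one_self)
  also have "\<dots> \<le> 1 - x + x\<^sup>2"
  proof -
    have "(1 - x + x\<^sup>2) * (1 + x) = 1 + x ^ 3" by (simp add: algebra_simps power2_eq_square power3_eq_cube)
    then show ?thesis using assms by (simp add: divide_le_eq)
  qed
  finally show ?thesis .
qed

lemma telescoping_pigeonhole:
  fixes f :: "nat \<Rightarrow> real"
  assumes "f J - f 0 \<le> c" "0 < J"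
  shows "\<exists>j<J. f (Suc j) - f j \<le> c / J"
proof (rule ccontr)
  assume "\<not> ?thesis"
  then have "\<And>j. j < J \<Longrightarrow> c / J < f (Suc j) - f j" by (meson not_le)
  then have "(\<Sum>j<J. c / J) < (\<Sum>j<J. f (Suc j) - f j)"
    using assms(2) by (intro sum_strict_mono) auto
  also have "\<dots> = f J - f 0" by (rule sum_lessThan_telescope)
  finally show False using assms by simp
qed

text \<open>The gap g is the amount by which lam falls short of 8 pi (1 - \<beta>), in units of 4
  pi. After division by m and by \<tau> = ln s, the errors consume 9/10 of it: 1/5 each for E, for
  E2, for the mass gained in the step and for the quadratic term of the exponential, and 1/10 for
  \<theta>.\<close>

lemma core_arithmetic:
  fixes m M lam g b \<tau> \<theta> T E E2 m0 mR s \<kappa> :: real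
  assumes main: "- (m / (4 * pi)) * (\<tau> * M + 2 * E) - E2 * m \<le> \<kappa> / s\<^sup>2 * mR - m"
    and k: "\<kappa> = (1 + \<theta>) * s powr (2 * \<beta>)" and s: "s = exp \<tau>"
    and m: "0 < m0" "m0 \<le> m" and mR: "0 \<le> mR" "mR \<le> m + lam * \<tau> / T" and T: "0 < T"
    and b: "0 \<le> \<beta>" "\<beta> < 1" and g: "g = 2 - 2 * \<beta> - lam / (4 * pi)" "0 < g"
    and \<tau>: "0 < \<tau>" "4 * \<tau> < g / 5" and \<theta>: "\<theta> = \<tau> * g / 10" "\<theta> \<le> 1"
    and M: "M \<le> lam" "0 < lam" and Tb: "2 * lam / (T * m0) \<le> g / 5"
    and E: "0 \<le> E" "E \<le> \<tau> * g / 5" and E2: "E2 \<le> \<tau> * g / 5"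
  shows False
proof -
  define x where "x = (2 - 2 * \<beta>) * \<tau>"
  have x: "0 \<le> x" "x \<le> 2 * \<tau>" using b \<tau> by (auto simp: x_def intro!: mult_right_mono)
  have "s powr (2 * \<beta>) / s\<^sup>2 = exp (- x)"
    unfolding s x_def by (simp add: powr_def exp_diff[symmetric] exp_of_nat_mult[symmetric] power2_eq_square exp_add[symmetric] algebra_simps)
  then have ks: "\<kappa> / s\<^sup>2 = (1 + \<theta>) * exp (- x)" unfolding k by (simp only: times_divide_eq_right[symmetric])
  have \<theta>0: "0 < \<theta>" unfolding \<theta>(1) using mult_pos_pos[OF \<tau>(1) g(2)] by simp
  have mm: "0 < m" using m by linarith
  have e1: "exp (- x) \<le> 1" using x by simp
  have "\<kappa> / s\<^sup>2 * mR \<le> (1 + \<theta>) * exp (- x) * (m + lam * \<tau> / T)"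
    unfolding ks using mR \<theta>0 by (intro mult_left_mono) auto
  also have "\<dots> = exp (- x) * m + \<theta> * exp (- x) * m + (1 + \<theta>) * exp (- x) * (lam * \<tau> / T)"
    by (simp add: algebra_simps)
  also have "\<dots> \<le> exp (- x) * m + \<theta> * 1 * m + (1 + 1) * 1 * (lam * \<tau> / T)"
    using e1 \<theta>0 \<theta>(2) mm M \<tau> T by (intro add_mono mult_mono mult_right_mono) (auto intro!: mult_nonneg_nonneg divide_nonneg_nonneg)
  also have "lam * \<tau> / T \<le> m * (lam * \<tau> / (T * m0))"
  proof -
    have "lam * \<tau> / T = m0 * (lam * \<tau> / (T * m0))" using m by simp
    also have "\<dots> \<le> m * (lam * \<tau> / (T * m0))" using m M \<tau> T by (intro mult_right_mono) auto
    finally show ?thesis .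
  qed
  finally have "\<kappa> / s\<^sup>2 * mR \<le> m * (exp (- x) + \<theta> + \<tau> * (2 * lam / (T * m0)))"
    by (simp add: algebra_simps)
  also have "\<dots> \<le> m * (1 - x + x\<^sup>2 + \<theta> + \<tau> * (g / 5))"
    using mm exp_minus_le_quadratic[OF x(1)] Tb \<tau> by (intro mult_left_mono add_mono) auto
  finally have up: "\<kappa> / s\<^sup>2 * mR - m \<le> m * (- x + x\<^sup>2 + \<theta> + \<tau> * (g / 5))"
    by (simp add: algebra_simps)
  have pi1: "1 \<le> 2 * pi" using pi_gt3 by linarith
  have "\<tau> * M / (4 * pi) \<le> \<tau> * lam / (4 * pi)" using M \<tau> by (intro divide_right_mono mult_left_mono) auto
  moreover have "E / (2 * pi) \<le> E / 1" using E pi1 by (intro divide_left_mono) auto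
  ultimately have "(\<tau> * M + 2 * E) / (4 * pi) + E2 \<le> \<tau> * lam / (4 * pi) + \<tau> * g / 5 + \<tau> * g / 5"
    using E E2 by (simp add: add_divide_distrib)
  then have "- (m * (\<tau> * lam / (4 * pi) + \<tau> * g / 5 + \<tau> * g / 5)) \<le> - (m * ((\<tau> * M + 2 * E) / (4 * pi) + E2))"
    using mm by simp
  also have "\<dots> = - (m / (4 * pi)) * (\<tau> * M + 2 * E) - E2 * m"
  proof -
    have "- (m * (X / (4 * pi) + E2)) = - (m / (4 * pi)) * X - E2 * m" for X by (simp add: algebra_simps)
    then show ?thesis .
  qed
  also have "\<dots> \<le> m * (- x + x\<^sup>2 + \<theta> + \<tau> * (g / 5))" using main up by linarith
  finally have "m * (- (\<tau> * lam / (4 * pi) + \<tau> * g / 5 + \<tau> * g / 5)) \<le> m * (- x + x\<^sup>2 + \<theta> + \<tau> * (g / 5))"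
    by (simp only: mult_minus_right)
  then have "- (\<tau> * lam / (4 * pi) + \<tau> * g / 5 + \<tau> * g / 5) \<le> - x + x\<^sup>2 + \<theta> + \<tau> * (g / 5)"
    using mm by (simp only: mult_le_cancel_left_pos)
  moreover have "x\<^sup>2 \<le> 4 * \<tau> * \<tau>"
  proof -
    have "x\<^sup>2 \<le> (2 * \<tau>)\<^sup>2" using x by (intro power_mono) auto
    then show ?thesis by (simp add: power2_eq_square)
  qed
  moreover have "4 * \<tau> * \<tau> \<le> g / 5 * \<tau>" using \<tau> by (intro mult_right_mono) auto
  moreover have "\<tau> * g = x - \<tau> * lam / (4 * pi)" by (simp add: g(1) x_def algebra_simps)
  moreover have "0 < \<tau> * g" using \<tau> g by simp
  moreover have "\<theta> = \<tau> * g / 10" by (rule \<theta>(1))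
  ultimately show False by (simp add: algebra_simps)
qed

text \<open>Proved by contradiction from M < lam. The parameters s and \<theta> are exported because
  the weight has to be compared under this dilation and with this tolerance before the lemma can be
  applied. The two-sided bounds on F degenerate at the origin so that they hold uniformly for all
  weights (\<tau>^2 + |y|^2)^\<alpha> with small \<tau>. Constants are fixed in the order P, Q, m0,
  T, \<rho>, L, K, J, \<theta>, each in terms of earlier ones.\<close>

lemma core_mass_bound:
  fixes \<beta> lam p C a0 A N :: real
  assumes \<beta>: "0 \<le> \<beta>" "\<beta> < 1" and lam: "0 < lam" "lam < 8 * pi * (1 - \<beta>)" and p: "1 < p" "p < 2"
    and C: "0 \<le> C" and a0: "0 < a0" and A: "0 \<le> A" and N: "0 \<le> N"
  shows "\<exists>L s \<theta>. N + 1 < L \<and> 1 < s \<and> 0 < \<theta> \<and>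
    (\<forall>u F x1. disc_solution u F L \<longrightarrow> norm x1 \<le> N \<longrightarrow> u x1 = 0 \<longrightarrow> (\<forall>y\<in>ball 0 L. u y \<le> C) \<longrightarrow>
      (\<forall>y. norm y \<le> N + 1 \<longrightarrow> a0 * min 1 ((norm y)\<^sup>2) * exp (u y) \<le> F y) \<longrightarrow>
      (\<forall>y\<in>ball 0 L. y \<noteq> 0 \<longrightarrow> F y \<le> A * (1 + norm y) ^ 4 * norm y powr (-p)) \<longrightarrow>
      (\<forall>x. s * norm x < L \<longrightarrow>
         F x * exp (- u x) \<le> (1 + \<theta>) * s powr (2 * \<beta>) * (F (s *\<^sub>R x) * exp (- u (s *\<^sub>R x)))) \<longrightarrow>
      lam \<le> (\<integral>y. F y \<partial>lborel))"
proof -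
  \<comment> \<open>P, Q and m0 refer to the unit disc around the peak only and hence not to L.
    Otherwise the choice of T from m0, and of L from T, would be circular.\<close>
  define P where "P = A * (N + 2) ^ 4 * (4 / (2 - p) * powr_mass ((p + 2) / 2) (N + 1))"
  define Q where "Q = P / (2 * pi)"
  define m0 where "m0 = a0 * pi / 4 * exp (- 2 * Q - C)"
  define g where "g = 2 - 2 * \<beta> - lam / (4 * pi)"
  have P0: "0 \<le> P" unfolding P_def using A N p powr_mass_nonneg by auto
  have m0: "0 < m0" using a0 by (simp add: m0_def)
  have g0: "0 < g"
  proof -
    have "lam / (4 * pi) < 2 * (1 - \<beta>)" using lam by (simp add: field_simps)
    then show ?thesis by (simp add: g_def)
  qed
  \<comment> \<open>The length, in ln R, of the range of radii that is searched. One of J steps of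
    length \<tau> = T/J gains mass at most lam/J, which by this choice is \<tau> g / 10 times
    m0.\<close>
  define T where "T = 10 * lam / (m0 * g)"
  have T: "0 < T" using lam m0 g0 by (simp add: T_def)
  have Tb: "2 * lam / (T * m0) \<le> g / 5" using lam m0 g0 by (simp add: T_def field_simps)
  define R1 where "R1 = N + 1"
  define R2 where "R2 = R1 * exp T"
  have R1: "0 < R1" using N by (simp add: R1_def)
  have R12: "R1 \<le> R2" using R1 T by (simp add: R2_def)
  \<comment> \<open>A bound for the means of C - u over the discs used in the displacement estimate.
    It grows only like ln \<rho>, so the factor R2/\<rho> in the error wins for large
    \<rho>.\<close>
  define G where "G \<rho> = 4 * (C + (ln (2 * \<rho>) * lam + P) / (2 * pi))" for \<rho>
  obtain \<rho> where \<rho>: "4 * R2 \<le> \<rho>" "1 \<le> \<rho>" "2 * R2 / \<rho> * (lam / pi + 3 * G \<rho>) < g / 5"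
  proof -
    have "((\<lambda>\<rho>. 2 * R2 / \<rho> * (lam / pi + 3 * G \<rho>)) \<longlongrightarrow> 0) at_top"
      unfolding G_def by real_asymp
    then have "\<forall>\<^sub>F \<rho> in at_top. 2 * R2 / \<rho> * (lam / pi + 3 * G \<rho>) < g / 5"
      using g0 by (intro order_tendstoD(2)) auto
    then have "\<forall>\<^sub>F \<rho> in at_top. 4 * R2 \<le> \<rho> \<and> 1 \<le> \<rho> \<and> 2 * R2 / \<rho> * (lam / pi + 3 * G \<rho>) < g / 5"
      using eventually_ge_at_top[of "4 * R2"] eventually_ge_at_top[of 1] by eventually_elim auto
    then show thesis using that eventually_happens'[of at_top] by (metis (no_types, lifting) trivial_limit_at_top_linorder)
  qed
  define L where "L = 3 * \<rho>"
  have R2: "0 < R2" using R1 R12 by linarith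
  have NR: "N < R2" "N < \<rho>" using R12 \<rho> R2 by (auto simp: R1_def)
  have L: "N + 1 < L" using \<rho> R12 R2 by (simp add: L_def R1_def)
  define A' where "A' = A * (1 + L) ^ 4"
  have A': "0 \<le> A'" using A L N by (simp add: A'_def)
  define K where "K = lam + A' * powr_mass p (2 * L)"
  have K: "0 \<le> K" using A' lam powr_mass_nonneg by (simp add: K_def)
  \<comment> \<open>Here p > 1 is decisive: the dilation error is of order \<tau>^p, which becomes
    small against \<tau> once J is large.\<close>
  obtain J :: nat where J: "0 < J" "4 * (T / J) < g / 5" "T / J \<le> 1" "6 * 2 powr p * K * (T / J) powr (p - 1) < g / 5"
  proof -
    have t0: "(\<lambda>J::nat. T / J) \<longlonglongrightarrow> 0" by real_asymp
    have tp: "\<forall>\<^sub>F J::nat in sequentially. 0 \<le> T / J" using T by (auto intro: always_eventually)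
    have "(\<lambda>J::nat. 4 * (T / J)) \<longlonglongrightarrow> 4 * 0" by (intro tendsto_intros t0)
    then have 1: "\<forall>\<^sub>F J::nat in sequentially. 4 * (T / J) < g / 5" using g0 by (intro order_tendstoD(2)) auto
    have 2: "\<forall>\<^sub>F J::nat in sequentially. T / J < 1" using t0 by (intro order_tendstoD(2)) auto
    have "(\<lambda>J::nat. 6 * 2 powr p * K * (T / J) powr (p - 1)) \<longlonglongrightarrow> 6 * 2 powr p * K * 0 powr (p - 1)"
      using p tp by (intro tendsto_intros tendsto_powr2[OF t0]) auto
    then have 3: "\<forall>\<^sub>F J::nat in sequentially. 6 * 2 powr p * K * (T / J) powr (p - 1) < g / 5"
      using g0 by (intro order_tendstoD(2)) auto
    have "\<forall>\<^sub>F J::nat in sequentially. 0 < J \<and> 4 * (T / J) < g / 5 \<and> T / J \<le> 1 \<and> 6 * 2 powr p * K * (T / J) powr (p - 1) < g / 5"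
      using 1 2 3 eventually_gt_at_top[of 0] by eventually_elim auto
    from eventually_happens'[OF sequentially_bot this] show thesis using that by auto
  qed
  define \<tau> where "\<tau> = T / J"
  define s where "s = exp \<tau>"
  define \<theta> where "\<theta> = min 1 (\<tau> * g / 10)"
  have \<tau>: "0 < \<tau>" "\<tau> \<le> 1" "4 * \<tau> < g / 5" using J T by (auto simp: \<tau>_def)
  have s1: "1 < s" using \<tau> by (simp add: s_def)
  have s2: "s - 1 \<le> 2 * \<tau>"
  proof -
    have "exp \<tau> \<le> 1 + \<tau> + \<tau>\<^sup>2" using exp_bound[of \<tau>] \<tau> by simp
    moreover have "\<tau>\<^sup>2 \<le> \<tau>" using \<tau> by (simp add: power2_eq_square mult_left_le)
    ultimately show ?thesis by (simp add: s_def)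
  qed
  have \<theta>: "0 < \<theta>" using \<tau> g0 by (simp add: \<theta>_def)
  show ?thesis
  proof (intro exI conjI allI impI)
    show "N + 1 < L" "1 < s" "0 < \<theta>" by (fact L s1 \<theta>)+
    fix u F x1
    assume sol: "disc_solution u F L" and x1: "norm x1 \<le> N" and u1: "u x1 = 0"
      and uC: "\<forall>y\<in>ball 0 L. u y \<le> C"
      and lo: "\<forall>y. norm y \<le> N + 1 \<longrightarrow> a0 * min 1 ((norm y)\<^sup>2) * exp (u y) \<le> F y"
      and hi: "\<forall>y\<in>ball 0 L. y \<noteq> 0 \<longrightarrow> F y \<le> A * (1 + norm y) ^ 4 * norm y powr (-p)"
      and dil: "\<forall>x. s * norm x < L \<longrightarrow>
         F x * exp (- u x) \<le> (1 + \<theta>) * s powr (2 * \<beta>) * (F (s *\<^sub>R x) * exp (- u (s *\<^sub>R x)))"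
    interpret disc_solution u F L by (rule sol)
    show "lam \<le> (\<integral>y. F y \<partial>lborel)"
    proof (rule ccontr)
      assume "\<not> lam \<le> (\<integral>y. F y \<partial>lborel)"
      then have M: "M \<le> lam" by (simp add: M_def)
      have pk: "integrable lborel (\<lambda>y. F y * log_peak (y - x1))" "(\<integral>y. F y * log_peak (y - x1) \<partial>lborel) \<le> P"
        using peak_log_integral[OF p x1 _ A, of] L hi unfolding P_def by auto
      have m0R: "m0 \<le> mass R1"
        unfolding m0_def R1_def
      proof (rule mass_lower[OF x1 L u1 a0])
        have "cball x1 1 \<subseteq> ball 0 L"
        proof
          fix y assume "y \<in> cball x1 1"
          then have "norm y \<le> norm x1 + 1" using norm_triangle_ineq[of x1 "y - x1"] by (simp add: dist_norm norm_minus_commute)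
          then show "y \<in> ball 0 L" using x1 L by simp
        qed
        from mean_at_peak[OF _ this u1 pk] show "- disc_mean 1 u x1 \<le> Q" by (simp add: Q_def)
      qed (use uC lo in auto)
      define f where "f j = mass (R1 * s ^ j)" for j
      have "f J - f 0 \<le> lam" using mass_le_M[of "R1 * s ^ J"] mass_nonneg[of "R1 * s ^ 0"] M by (simp add: f_def)
      from telescoping_pigeonhole[OF this J(1)] obtain j where j: "j < J" "f (Suc j) - f j \<le> lam / J" by blast
      define R where "R = R1 * s ^ j"
      have R0: "0 < R" using R1 s1 by (simp add: R_def)
      \<comment> \<open>R is the radius at which the pigeonhole step starts: passing from R to s R
        adds little mass, and the disc of radius R contains the unit disc around the peak, whence
        the lower bound m0.\<close>
      have R1R: "R1 \<le> R" using R1 s1 by (simp add: R_def one_le_power)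
      have sJ: "s ^ J = exp T" unfolding s_def \<tau>_def exp_of_nat_mult[symmetric] using J(1) by simp
      have RR2: "R \<le> R2"
      proof -
        have "s ^ j \<le> s ^ J" using j s1 by (intro power_increasing) auto
        then show ?thesis unfolding R_def R2_def sJ[symmetric] using R1 by (intro mult_left_mono) auto
      qed
      have sR: "s * R \<le> R2"
      proof -
        have "s ^ Suc j \<le> s ^ J" using j s1 by (intro power_increasing) auto
        then have "R1 * s ^ Suc j \<le> R1 * s ^ J" using R1 by (intro mult_left_mono) auto
        then show ?thesis by (simp add: R_def R2_def sJ mult_ac)
      qed
      define h where "h = (s - 1) * R2"
      have h0: "0 < h" using s1 R2 by (simp add: h_def)
      have h\<tau>: "h \<le> 2 * \<tau> * R2" unfolding h_def using s2 R2 by (intro mult_right_mono) auto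
      have "\<tau> * R2 \<le> 1 * R2" using \<tau> R2 by (intro mult_right_mono) auto
      then have h2: "h \<le> 2 * R2" using h\<tau> by linarith
      define E where "E = 6 * (s - 1) powr p * K"
      have hi': "F y \<le> A' * norm y powr (-p)" if "y \<noteq> 0" "y \<in> ball 0 L" for y
      proof -
        have "F y \<le> A * (1 + norm y) ^ 4 * norm y powr (-p)" using hi that by auto
        also have "\<dots> \<le> A' * norm y powr (-p)" unfolding A'_def
          using that A by (intro mult_right_mono mult_left_mono power_mono) auto
        finally show ?thesis .
      qed
      have xL: "x \<in> ball 0 L" if "x \<in> ball 0 R" for x
        using that RR2 \<rho> R2 by (simp add: L_def)
      have e: "integrable lborel (\<lambda>y. F y * dil_err s x y)" "(\<integral>y. F y * dil_err s x y \<partial>lborel) \<le> E"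
        if "x \<in> ball 0 R" for x
      proof -
        show "integrable lborel (\<lambda>y. F y * dil_err s x y)"
          by (rule dil_err_integral(1)[OF s1 p xL[OF that] A' hi'])
        have "(\<integral>y. F y * dil_err s x y \<partial>lborel) \<le> 6 * (s - 1) powr p * (M + A' * powr_mass p (2 * L))"
          by (rule dil_err_integral(2)[OF s1 p xL[OF that] A' hi'])
        also have "\<dots> \<le> E" unfolding E_def K_def using M s1 by (intro mult_left_mono add_right_mono) auto
        finally show "(\<integral>y. F y * dil_err s x y \<partial>lborel) \<le> E" .
      qed
      have sub1: "cball x1 (2 * \<rho>) \<subseteq> ball 0 L"
      proof
        fix y assume "y \<in> cball x1 (2 * \<rho>)"
        then have "norm y \<le> norm x1 + 2 * \<rho>" using norm_triangle_ineq[of x1 "y - x1"] by (simp add: dist_norm norm_minus_commute)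
        then show "y \<in> ball 0 L" using x1 NR by (simp add: L_def)
      qed
      have mean1: "disc_mean (2 * \<rho>) (\<lambda>y. C - u y) x1 \<le> G \<rho> / 4"
      proof -
        have "- disc_mean (2 * \<rho>) u x1 \<le> (ln (2 * \<rho>) * M + P) / (2 * pi)"
          by (rule mean_at_peak[OF _ sub1 u1 pk]) (use \<rho> in auto)
        also have "\<dots> \<le> (ln (2 * \<rho>) * lam + P) / (2 * pi)"
          using M \<rho> by (intro divide_right_mono add_right_mono mult_left_mono) auto
        finally have "- disc_mean (2 * \<rho>) u x1 \<le> (ln (2 * \<rho>) * lam + P) / (2 * pi)" .
        moreover have "G \<rho> / 4 = C + (ln (2 * \<rho>) * lam + P) / (2 * pi)"
          unfolding G_def by (rule nonzero_mult_div_cancel_left) simp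
        moreover have "disc_mean (2 * \<rho>) (\<lambda>y. C - u y) x1 = C - disc_mean (2 * \<rho>) u x1"
          by (rule disc_mean_defect(1)[OF sub1]) (use \<rho> in auto)
        ultimately show ?thesis by linarith
      qed
      have G0: "0 \<le> G \<rho>" unfolding G_def using C \<rho> lam P0 by (auto intro!: add_nonneg_nonneg divide_nonneg_nonneg mult_nonneg_nonneg)
      \<comment> \<open>The disc of radius \<rho> + h around x lies in the disc of radius 2 \<rho>
        around x1, where the mean is controlled through u x1 = 0; the ratio of the areas is at most
        4, the factor built into \<open>G\<close>.\<close>
      have Gx: "disc_mean (\<rho> + h) (\<lambda>y. C - u y) x \<le> G \<rho>" if "x \<in> ball 0 R" for x
      proof -
        have eqr: "(\<rho> + h) + (\<rho> - h) = 2 * \<rho>" by simp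
        have "dist x1 x \<le> norm x1 + norm x" by (rule dist_triangle_le[of _ 0]) (simp add: dist_norm) 
        also have "\<dots> \<le> \<rho> - h" using x1 NR that RR2 h2 \<rho> by simp
        finally have d: "dist x1 x \<le> \<rho> - h" .
        have "disc_mean (\<rho> + h) (\<lambda>y. C - u y) x \<le>
          (((\<rho> + h) + (\<rho> - h)) / (\<rho> + h))\<^sup>2 * disc_mean ((\<rho> + h) + (\<rho> - h)) (\<lambda>y. C - u y) x1"
        proof (rule disc_mean_mono_shift[OF _ _ d])
          show "set_integrable lborel (ball x1 ((\<rho> + h) + (\<rho> - h))) (\<lambda>y. C - u y)"
            unfolding eqr by (rule disc_mean_defect(2)[OF sub1]) (use \<rho> in auto)
          show "0 \<le> C - u y" if "y \<in> ball x1 ((\<rho> + h) + (\<rho> - h))" for y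
            using that uC sub1 unfolding eqr by (auto simp: subset_eq)
        qed (use \<rho> h0 in auto)
        also have "\<dots> = (2 * \<rho> / (\<rho> + h))\<^sup>2 * disc_mean (2 * \<rho>) (\<lambda>y. C - u y) x1" by simp
        also have "\<dots> \<le> 2\<^sup>2 * (G \<rho> / 4)"
        proof (rule mult_mono[OF power_mono mean1])
          show "2 * \<rho> / (\<rho> + h) \<le> 2" using \<rho> h0 by (simp add: divide_le_eq)
          show "0 \<le> disc_mean (2 * \<rho>) (\<lambda>y. C - u y) x1"
            by (rule disc_mean_bounds(1)[OF disc_mean_defect(2)[OF sub1]]) (use \<rho> uC sub1 in \<open>auto simp: subset_eq\<close>)
        qed (use \<rho> h0 in auto)
        finally show ?thesis by simp
      qed
      define \<kappa> where "\<kappa> = (1 + \<theta>) * s powr (2 * \<beta>)"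
      have main: "- (mass R / (4 * pi)) * (ln s * M + 2 * E) - (2 * h / \<rho> * M / (2 * pi) + (((\<rho> + h) / \<rho>)\<^sup>2 - 1) * G \<rho>) * mass R
          \<le> \<kappa> / s\<^sup>2 * mass (s * R) - mass R"
      proof (rule pohozaev_inequality[OF s1 R0 RR2 _ h_def _ _ e Gx])
        show "2 * R2 \<le> \<rho>" "\<rho> + h + R2 \<le> L" using \<rho> R2 h2 by (auto simp: L_def)
        show "u y \<le> C" if "y \<in> ball 0 L" for y using uC that by auto
        show "F x * exp (- u x) \<le> \<kappa> * (F (s *\<^sub>R x) * exp (- u (s *\<^sub>R x)))" if "x \<in> ball 0 R" for x
        proof -
          have "s * norm x \<le> s * R" using that s1 by (intro mult_left_mono) auto
          also have "\<dots> < L" using sR \<rho> R2 by (simp add: L_def)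
          finally show ?thesis using dil by (simp add: \<kappa>_def)
        qed
      qed
      have \<kappa>le: "\<kappa> / s\<^sup>2 * mass (s * R) \<le> ((1 + \<tau> * g / 10) * s powr (2 * \<beta>)) / s\<^sup>2 * mass (s * R)"
        unfolding \<kappa>_def using mass_nonneg s1 by (intro mult_right_mono divide_right_mono) (auto simp: \<theta>_def)
      have E2: "2 * h / \<rho> * M / (2 * pi) + (((\<rho> + h) / \<rho>)\<^sup>2 - 1) * G \<rho> \<le> \<tau> * g / 5"
      proof -
        define t where "t = h / \<rho>"
        have t: "0 < t" "t \<le> 1" using h0 h2 \<rho> R2 by (auto simp: t_def)
        have t\<tau>: "t \<le> \<tau> * (2 * R2 / \<rho>)" unfolding t_def using h\<tau> \<rho> by (simp add: divide_right_mono mult_ac)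
        have "(\<rho> + h) / \<rho> = 1 + t" using \<rho> by (simp add: t_def add_divide_distrib)
        then have "((\<rho> + h) / \<rho>)\<^sup>2 - 1 = 2 * t + t * t" by (simp add: power2_eq_square algebra_simps)
        also have "\<dots> \<le> 3 * t" using t mult_left_mono[of t 1 t] by simp
        finally have "(((\<rho> + h) / \<rho>)\<^sup>2 - 1) * G \<rho> \<le> 3 * t * G \<rho>" using G0 by (intro mult_right_mono) auto
        moreover have "2 * h / \<rho> * M / (2 * pi) \<le> t * (lam / pi)"
        proof -
          have "2 * h / \<rho> * M / (2 * pi) = t * (M / pi)" by (simp add: t_def)
          also have "\<dots> \<le> t * (lam / pi)" using t M by (intro mult_left_mono divide_right_mono) auto
          finally show ?thesis .
        qed
        ultimately have "2 * h / \<rho> * M / (2 * pi) + (((\<rho> + h) / \<rho>)\<^sup>2 - 1) * G \<rho> \<le> t * (lam / pi + 3 * G \<rho>)"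
          by (simp add: algebra_simps)
        also have "\<dots> \<le> \<tau> * (2 * R2 / \<rho>) * (lam / pi + 3 * G \<rho>)"
          using t\<tau> G0 lam by (intro mult_right_mono) auto
        also have "\<dots> \<le> \<tau> * (g / 5)" using \<rho>(3) \<tau> by (simp only: mult.assoc) (intro mult_left_mono, auto)
        finally show ?thesis by simp
      qed
      have E5: "E \<le> \<tau> * g / 5"
      proof -
        have "(s - 1) powr p \<le> (2 * \<tau>) powr p" using s1 s2 p by (intro powr_mono2) auto
        also have "\<dots> = 2 powr p * (\<tau> powr (p - 1) * \<tau>)"
          using \<tau> by (simp add: powr_mult powr_diff)
        finally have "E \<le> 6 * (2 powr p * (\<tau> powr (p - 1) * \<tau>)) * K"
          unfolding E_def using K by (intro mult_right_mono mult_left_mono) auto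
        also have "\<dots> = (6 * 2 powr p * K * \<tau> powr (p - 1)) * \<tau>" by simp
        also have "\<dots> \<le> g / 5 * \<tau>" using J(4) \<tau> unfolding \<tau>_def[symmetric] by (intro mult_right_mono) auto
        finally show ?thesis by (simp add: mult.commute)
      qed
      have "0 < lam / (4 * pi)" using lam by simp
      then have g2: "g \<le> 2" using \<beta> unfolding g_def by linarith
      have th1: "\<tau> * g / 10 \<le> 1" using mult_mono[of \<tau> 1 g 2] \<tau> g0 g2 by simp
      show False
      proof (rule core_arithmetic[where m = "mass R" and M = M and E = E and mR = "mass (s * R)" and \<tau> = \<tau> and s = s
            and lam = lam and T = T and ?m0.0 = m0 and g = g and \<beta> = \<beta> and \<theta> = "\<tau> * g / 10"
            and ?E2.0 = "2 * h / \<rho> * M / (2 * pi) + (((\<rho> + h) / \<rho>)\<^sup>2 - 1) * G \<rho>"])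
        show "- (mass R / (4 * pi)) * (\<tau> * M + 2 * E) - (2 * h / \<rho> * M / (2 * pi) + (((\<rho> + h) / \<rho>)\<^sup>2 - 1) * G \<rho>) * mass R
          \<le> ((1 + \<tau> * g / 10) * s powr (2 * \<beta>)) / s\<^sup>2 * mass (s * R) - mass R"
          using main \<kappa>le by (simp add: s_def)
        show "mass (s * R) \<le> mass R + lam * \<tau> / T"
          using j(2) T by (simp add: f_def R_def \<tau>_def mult_ac)
        show "m0 \<le> mass R" using m0R mass_mono[OF R1R] by linarith
        show "0 \<le> E" using K by (simp add: E_def)
      qed (use s_def m0 mass_nonneg T \<beta> g_def g0 \<tau> M lam Tb E5 E2 th1 in auto)
    qed
  qed
qed

section \<open>Concentration of mass near a peak\<close>

text \<open>Scale invariance: \<open>green_ker\<close> depends on the ratio of |z| and r only, the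
  Jacobian \<delta>^2 goes into the density, and subtracting a constant from v shifts the disc means
  by the same constant. The closed disc is required in S so that f is bounded on the open
  one.\<close>

lemma scaled_disc_solution:
  fixes x0 :: "real^2"
  assumes gr: "green_on S v f" and cv: "continuous_on S v" and cf: "continuous_on S f"
    and nn: "\<And>y. y \<in> S \<Longrightarrow> 0 \<le> f y" and \<delta>: "0 < \<delta>" and L: "0 < L" and sub: "cball x0 (\<delta> * L) \<subseteq> S"
  defines "F \<equiv> \<lambda>z. indicator (ball 0 L) z * (\<delta>\<^sup>2 * f (x0 + \<delta> *\<^sub>R z))"
  shows "disc_solution (\<lambda>z. v (x0 + \<delta> *\<^sub>R z) - c) F L"
    and "(\<integral>z. F z \<partial>lborel) = (\<integral>y. indicator (ball x0 (\<delta> * L)) y * f y \<partial>lborel)"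
proof -
  have ds: "dist (\<delta> *\<^sub>R a) (\<delta> *\<^sub>R z) = \<delta> * dist a z" for a z :: "real^2"
    using \<delta> by (simp add: dist_norm flip: scaleR_right_diff_distrib)
  have ind: "indicator (ball (x0 + \<delta> *\<^sub>R a) (\<delta> * r)) (x0 + \<delta> *\<^sub>R z) = (indicator (ball a r) z :: real)"
    "indicator (cball (x0 + \<delta> *\<^sub>R a) (\<delta> * r)) (x0 + \<delta> *\<^sub>R z) = (indicator (cball a r) z :: real)" for a z r
    using \<delta> by (auto simp: indicator_def ds)
  have inc: "x0 + \<delta> *\<^sub>R z \<in> cball x0 (\<delta> * L)" if "z \<in> cball 0 L" for z
    using that \<delta> by (simp add: dist_norm mult_left_mono)
  have subr: "cball (x0 + \<delta> *\<^sub>R a) (\<delta> * r) \<subseteq> cball x0 (\<delta> * L)" if "cball a r \<subseteq> ball 0 L" for a r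
  proof
    fix y assume y: "y \<in> cball (x0 + \<delta> *\<^sub>R a) (\<delta> * r)"
    define z where "z = (1 / \<delta>) *\<^sub>R (y - x0)"
    have yz: "y = x0 + \<delta> *\<^sub>R z" using \<delta> by (simp add: z_def)
    have "z \<in> cball a r" using y \<delta> unfolding yz by (simp add: ds)
    then have "z \<in> cball 0 L" using that ball_subset_cball by blast
    then show "y \<in> cball x0 (\<delta> * L)" unfolding yz by (rule inc)
  qed
  have fB: "(\<lambda>y. indicator (ball x0 (\<delta> * L)) y * f y) \<in> borel_measurable borel"
  proof -
    have "set_borel_measurable borel (ball x0 (\<delta> * L)) f"
      by (intro set_measurable_continuous_on continuous_on_subset[OF cf]) (use sub ball_subset_cball in auto)
    then show ?thesis by (simp add: set_borel_measurable_def)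
  qed
  have F_eq: "F z = \<delta>\<^sup>2 * (indicator (ball x0 (\<delta> * L)) (x0 + \<delta> *\<^sub>R z) * f (x0 + \<delta> *\<^sub>R z))" for z
    using ind(1)[of 0 L z] by (simp add: F_def)
  have Fm: "F \<in> borel_measurable borel"
    unfolding F_eq[abs_def] by (intro borel_measurable_times borel_measurable_const measurable_compose[OF _ fB]) auto
  show "(\<integral>z. F z \<partial>lborel) = (\<integral>y. indicator (ball x0 (\<delta> * L)) y * f y \<partial>lborel)"
    using lborel_integral_affine[OF fB \<delta>, of x0] by (simp add: F_eq)
  show "disc_solution (\<lambda>z. v (x0 + \<delta> *\<^sub>R z) - c) F L"
  proof
    show "continuous_on (ball 0 L) (\<lambda>z. v (x0 + \<delta> *\<^sub>R z) - c)"
      by (intro continuous_intros continuous_on_compose2[OF cv]) (use inc sub in \<open>force intro!: continuous_intros\<close>)+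
    show "F \<in> borel_measurable borel" by (rule Fm)
    show "0 \<le> F y" for y
      using nn inc[of y] sub by (auto simp: F_def indicator_def)
    have "compact (cball x0 (\<delta> * L))" by simp
    then have "bounded (f ` cball x0 (\<delta> * L))"
      using continuous_on_subset[OF cf sub] compact_continuous_image compact_imp_bounded by blast
    then obtain B where "\<forall>y\<in>cball x0 (\<delta> * L). \<bar>f y\<bar> \<le> B" by (auto simp: bounded_iff)
    then have B: "\<And>y. y \<in> cball x0 (\<delta> * L) \<Longrightarrow> \<bar>f y\<bar> \<le> B" by blast
    have "0 \<le> B" using B[of x0] \<delta> L by (meson abs_ge_zero centre_in_cball less_imp_le mult_pos_pos order_trans)
    then have "F y \<le> \<delta>\<^sup>2 * B" for y
      using B[OF inc[of y]] by (auto simp: F_def indicator_def abs_le_iff mult_left_mono)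
    then show "\<exists>B. \<forall>y. F y \<le> B" by blast
    show "F y = 0" if "y \<notin> ball 0 L" for y using that by (simp add: F_def)
    fix a :: "real^2" and r :: real
    assume r: "0 < r" and ar: "cball a r \<subseteq> ball 0 L"
    define b where "b = x0 + \<delta> *\<^sub>R a"
    have bs: "cball b (\<delta> * r) \<subseteq> S" using subr[OF ar] sub by (auto simp: b_def)
    have eq: "v b = disc_mean (\<delta> * r) v b + (LINT y|lborel. indicator (cball b (\<delta> * r)) y * f y * green_ker (\<delta> * r) (y - b))"
      using gr bs r \<delta> unfolding green_on_def by (meson mult_pos_pos)
    have vm: "(\<lambda>y. indicator (ball b (\<delta> * r)) y * v y) \<in> borel_measurable borel"
    proof -
      have "set_borel_measurable borel (ball b (\<delta> * r)) v"
        by (intro set_measurable_continuous_on continuous_on_subset[OF cv]) (use bs ball_subset_cball in auto)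
      then show ?thesis by (simp add: set_borel_measurable_def)
    qed
    have "(LINT y:ball b (\<delta> * r)|lborel. v y) = \<delta>\<^sup>2 * (LINT z:ball a r|lborel. v (x0 + \<delta> *\<^sub>R z))"
      using lborel_integral_affine[OF vm \<delta>, of x0] by (simp add: set_lebesgue_integral_def b_def ind)
    then have m1: "disc_mean (\<delta> * r) v b = disc_mean r (\<lambda>z. v (x0 + \<delta> *\<^sub>R z)) a"
      using \<delta> by (simp add: disc_mean_def power_mult_distrib)
    have "set_integrable lborel (cball a r) (\<lambda>z. v (x0 + \<delta> *\<^sub>R z))"
    proof -
      have "continuous_on (cball a r) (\<lambda>z. v (x0 + \<delta> *\<^sub>R z))"
        by (intro continuous_on_compose2[OF cv]) (use inc sub ar in \<open>force intro!: continuous_intros\<close>)+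
      from integrable_on_cball[OF this] show ?thesis by (simp add: set_integrable_def)
    qed
    then have si: "set_integrable lborel (ball a r) (\<lambda>z. v (x0 + \<delta> *\<^sub>R z))" by (rule set_integrable_subset) auto
    have ci: "set_integrable lborel (ball a r) (\<lambda>_. c)"
      using emeasure_lborel_ball_finite[of a r] by (auto simp: set_integrable_def less_top intro!: integrable_mult_left integrable_real_indicator)
    have m2: "disc_mean r (\<lambda>z. v (x0 + \<delta> *\<^sub>R z) - c) a = disc_mean r (\<lambda>z. v (x0 + \<delta> *\<^sub>R z)) a - c"
    proof -
      have "(LINT z:ball a r|lborel. v (x0 + \<delta> *\<^sub>R z) - c) = (LINT z:ball a r|lborel. v (x0 + \<delta> *\<^sub>R z)) - pi * r\<^sup>2 * c"
        using set_integral_diff(2)[OF si ci] circle_area[of r a] r by (simp add: set_lebesgue_integral_def mult.commute)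
      then show ?thesis using r by (simp add: disc_mean_def diff_divide_distrib)
    qed
    have km: "(\<lambda>y. indicator (cball b (\<delta> * r)) y * f y * green_ker (\<delta> * r) (y - b)) \<in> borel_measurable borel"
    proof -
      have "set_borel_measurable borel (cball b (\<delta> * r)) f"
        by (intro set_measurable_continuous_on continuous_on_subset[OF cf]) (use bs in auto)
      then have "(\<lambda>y. indicator (cball b (\<delta> * r)) y * f y) \<in> borel_measurable borel"
        by (simp add: set_borel_measurable_def)
      then show ?thesis by measurable
    qed
    have kz: "\<delta>\<^sup>2 * (indicator (cball a r) z * f (x0 + \<delta> *\<^sub>R z) * green_ker (\<delta> * r) (x0 + \<delta> *\<^sub>R z - b)) = F z * green_ker r (z - a)" for z
    proof -
      have "x0 + \<delta> *\<^sub>R z - b = \<delta> *\<^sub>R (z - a)" by (simp add: b_def scaleR_right_diff_distrib)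
      then have k: "green_ker (\<delta> * r) (x0 + \<delta> *\<^sub>R z - b) = green_ker r (z - a)"
        using \<delta> by (simp add: green_ker_def power_mult_distrib)
      show ?thesis
      proof (cases "z \<in> cball a r")
        case True
        then have "z \<in> ball 0 L" using ar by blast
        then show ?thesis unfolding k using True by (simp add: F_def)
      next
        case False
        then have "green_ker r (z - a) = 0" using r by (intro green_ker_eq_0) (auto simp: dist_norm norm_minus_commute)
        then show ?thesis using False by simp
      qed
    qed
    have "(LINT y|lborel. indicator (cball b (\<delta> * r)) y * f y * green_ker (\<delta> * r) (y - b)) = (\<integral>z. F z * green_ker r (z - a) \<partial>lborel)"
    proof -
      have "(LINT y|lborel. indicator (cball b (\<delta> * r)) y * f y * green_ker (\<delta> * r) (y - b)) =
         (\<integral>z. \<delta>\<^sup>2 * (indicator (cball a r) z * f (x0 + \<delta> *\<^sub>R z) * green_ker (\<delta> * r) (x0 + \<delta> *\<^sub>R z - b)) \<partial>lborel)"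
        using lborel_integral_affine[OF km \<delta>, of x0] by (simp add: b_def ind)
      then show ?thesis unfolding kz .
    qed
    then show "v (x0 + \<delta> *\<^sub>R a) - c = disc_mean r (\<lambda>z. v (x0 + \<delta> *\<^sub>R z) - c) a + (\<integral>y. F y * green_ker r (y - a) \<partial>lborel)"
      using eq unfolding m2 m1 by (simp add: b_def)
  qed
qed

section \<open>The weight far from its pole and near it\<close>

lemma powr_le_one_plus:
  fixes r e :: real
  assumes "0 < r" "0 \<le> e" "e \<le> real n"
  shows "r powr e \<le> (1 + r) ^ n"
proof -
  have "r powr e \<le> (1 + r) powr e" using assms by (intro powr_mono2) auto
  also have "\<dots> \<le> (1 + r) powr real n" using assms by (intro powr_mono) auto
  also have "\<dots> = (1 + r) ^ n" using assms by (simp add: powr_realpow)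
  finally show ?thesis .
qed

lemma powr_between:
  fixes q \<alpha> K :: real
  assumes "\<bar>\<alpha>\<bar> \<le> 1" "1 / K \<le> q" "q \<le> K" "1 \<le> K"
  shows "1 / K \<le> q powr \<alpha>" "q powr \<alpha> \<le> K"
proof -
  have K: "K > 0" "q > 0" using assms by (auto intro: less_le_trans[of 0 "1 / K"])
  have ln: "\<bar>ln q\<bar> \<le> ln K"
  proof -
    have "ln q \<le> ln K" using assms K by simp
    moreover have "ln (1 / K) \<le> ln q" using assms K by (intro ln_mono) auto
    ultimately show ?thesis using K by (simp add: ln_div abs_le_iff)
  qed
  have "\<bar>\<alpha> * ln q\<bar> \<le> 1 * ln K" unfolding abs_mult using assms ln by (intro mult_mono) auto
  then have b: "- ln K \<le> \<alpha> * ln q" "\<alpha> * ln q \<le> ln K" by (auto simp: abs_le_iff)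
  have "q powr \<alpha> = exp (\<alpha> * ln q)" using K by (simp add: powr_def)
  moreover have "1 / K = exp (- ln K)" using K by (simp add: exp_minus divide_inverse)
  moreover have "K = exp (ln K)" using K by simp
  ultimately show "1 / K \<le> q powr \<alpha>" "q powr \<alpha> \<le> K" using b by (metis exp_le_cancel_iff)+
qed

text \<open>The weight is its power 2 \<alpha>. Being the norm of the pair of \<epsilon> and x, it
  is 1-Lipschitz in x, which is how values of the weight at nearby points are compared.\<close>

definition pole_dist :: "real \<Rightarrow> real^2 \<Rightarrow> real" where
  "pole_dist \<epsilon> x = sqrt (\<epsilon>\<^sup>2 + (norm x)\<^sup>2)"

lemma pole_dist_sq: "(pole_dist \<epsilon> x)\<^sup>2 = \<epsilon>\<^sup>2 + (norm x)\<^sup>2"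
  by (simp add: pole_dist_def)

lemma pole_dist_pos: "0 < \<epsilon> \<Longrightarrow> 0 < pole_dist \<epsilon> x"
  by (simp add: pole_dist_def add_pos_nonneg)

lemma norm_le_pole_dist: "norm x \<le> pole_dist \<epsilon> x" "0 \<le> \<epsilon> \<Longrightarrow> \<epsilon> \<le> pole_dist \<epsilon> x"
  unfolding pole_dist_def by (auto intro: real_le_rsqrt)

lemma pole_dist_lipschitz: "\<bar>pole_dist \<epsilon> x - pole_dist \<epsilon> y\<bar> \<le> dist x y"
proof -
  have p: "pole_dist \<epsilon> x = norm (\<epsilon>, x)" for x by (simp add: pole_dist_def norm_Pair)
  have "\<bar>norm (\<epsilon>, x) - norm (\<epsilon>, y)\<bar> \<le> norm ((\<epsilon>, x) - (\<epsilon>, y))" by (rule norm_triangle_ineq3)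
  then show ?thesis by (simp add: p dist_norm norm_Pair)
qed

text \<open>If the pole is at least N scales away, the weight is almost constant on the blow-up
  disc, since \<open>pole_dist\<close> is Lipschitz; hence \<beta> = 0. The scale \<delta>
  normalises \<delta>^2 times the weight times e^v to 1 at the peak. As the rescaled density is
  bounded, the exponent 3/2 is an arbitrary choice between 1 and 2; the 4 is the excess permitted by
  the selection of the peak, and the constants a/4 and 4 b reflect a weight ratio between 1/4 and
  4.\<close>

lemma concentration_regular:
  fixes a b \<sigma> :: real
  assumes ab: "0 < a" "a \<le> b" and \<sigma>: "0 < \<sigma>" "\<sigma> < 1"
  shows "\<exists>L N \<theta>. 0 < L \<and> 1 \<le> N \<and> 0 < \<theta> \<and>
    (\<forall>\<epsilon> \<alpha> V v x0 S \<delta>. 0 < \<epsilon> \<longrightarrow> \<bar>\<alpha>\<bar> \<le> 1 \<longrightarrow>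
      \<delta> = exp (- v x0 / 2) * pole_dist \<epsilon> x0 powr (-\<alpha>) \<longrightarrow> N * \<delta> \<le> pole_dist \<epsilon> x0 \<longrightarrow>
      cball x0 (\<delta> * L) \<subseteq> S \<longrightarrow> continuous_on S v \<longrightarrow> continuous_on S V \<longrightarrow>
      (\<forall>x\<in>S. a \<le> V x \<and> V x \<le> b) \<longrightarrow> (\<forall>x\<in>S. \<forall>y\<in>S. V x \<le> (1 + \<theta>) * V y) \<longrightarrow>
      (\<forall>y\<in>ball x0 (\<delta> * L). v y \<le> v x0 + 4) \<longrightarrow>
      green_on S v (\<lambda>x. (\<epsilon>\<^sup>2 + (norm x)\<^sup>2) powr \<alpha> * V x * exp (v x)) \<longrightarrow>
      8 * pi * (1 - \<sigma>) \<le>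
        (\<integral>y. indicator (ball x0 (\<delta> * L)) y * ((\<epsilon>\<^sup>2 + (norm y)\<^sup>2) powr \<alpha> * V y * exp (v y)) \<partial>lborel))"
proof -
  have "0 < 8 * pi * (1 - \<sigma>)" "8 * pi * (1 - \<sigma>) < 8 * pi * (1 - 0)" using \<sigma> by auto
  from core_mass_bound[of 0 "8 * pi * (1 - \<sigma>)" "3/2" 4 "a / 4" "4 * b * exp 4" 0, OF _ _ this]
  obtain L s \<theta>c where L: "1 < L" and s: "1 < s" and \<theta>c: "0 < \<theta>c" and
    core: "\<And>u F x1. disc_solution u F L \<Longrightarrow> norm x1 \<le> 0 \<Longrightarrow> u x1 = 0 \<Longrightarrow> (\<forall>y\<in>ball 0 L. u y \<le> 4) \<Longrightarrow>
      (\<forall>y. norm y \<le> 0 + 1 \<longrightarrow> a / 4 * min 1 ((norm y)\<^sup>2) * exp (u y) \<le> F y) \<Longrightarrow>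
      (\<forall>y\<in>ball 0 L. y \<noteq> 0 \<longrightarrow> F y \<le> 4 * b * exp 4 * (1 + norm y) ^ 4 * norm y powr (-(3/2))) \<Longrightarrow>
      (\<forall>x. s * norm x < L \<longrightarrow>
         F x * exp (- u x) \<le> (1 + \<theta>c) * s powr (2 * 0) * (F (s *\<^sub>R x) * exp (- u (s *\<^sub>R x)))) \<Longrightarrow>
      8 * pi * (1 - \<sigma>) \<le> (\<integral>y. F y \<partial>lborel)"
    using ab by auto
  \<comment> \<open>The tolerance is shared: one factor 1 + t is spent on the oscillation of V, the
    other on that of the weight.\<close>
  define t where "t = min 1 \<theta>c / 3"
  have t: "0 < t" "(1 + t) * (1 + t) \<le> 1 + \<theta>c"
  proof -
    show "0 < t" using \<theta>c by (simp add: t_def)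
    have "t \<le> 1" "3 * t \<le> \<theta>c" by (auto simp: t_def)
    moreover have "t * t \<le> t" using \<open>0 < t\<close> \<open>t \<le> 1\<close> by (simp add: mult_left_le)
    ultimately show "(1 + t) * (1 + t) \<le> 1 + \<theta>c" by (simp add: algebra_simps)
  qed
  obtain \<eta> :: real where \<eta>: "0 < \<eta>" "\<eta> \<le> 1/2" "((1 + \<eta>) / (1 - \<eta>))\<^sup>2 \<le> 1 + t"
  proof -
    have "((\<lambda>\<eta>. ((1 + \<eta>) / (1 - \<eta>))\<^sup>2) \<longlongrightarrow> ((1 + 0) / (1 - 0))\<^sup>2) (at_right (0::real))"
      by (intro tendsto_intros) auto
    then have "\<forall>\<^sub>F \<eta> in at_right (0::real). ((1 + \<eta>) / (1 - \<eta>))\<^sup>2 < 1 + t"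
      using t by (intro order_tendstoD(2)) auto
    moreover have "\<forall>\<^sub>F \<eta> in at_right (0::real). 0 < \<eta> \<and> \<eta> \<le> 1/2"
      by (rule eventually_at_rightI[of 0 "1/2"]) auto
    ultimately have "\<forall>\<^sub>F \<eta> in at_right (0::real). 0 < \<eta> \<and> \<eta> \<le> 1/2 \<and> ((1 + \<eta>) / (1 - \<eta>))\<^sup>2 \<le> 1 + t"
      by eventually_elim auto
    from eventually_happens'[OF trivial_limit_at_right_real this] show thesis using that by blast
  qed
  \<comment> \<open>With this N the blow-up disc has radius at most \<eta> times the distance m to
    the pole, so q stays between (1 - \<eta>)^2 and (1 + \<eta>)^2.\<close>
  define N where "N = max 1 (L / \<eta>)"
  show ?thesis
  proof (rule exI[of _ L], rule exI[of _ N], rule exI[of _ t], intro conjI allI impI)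
    show "0 < L" "1 \<le> N" "0 < t" using L t by (auto simp: N_def)
    fix \<epsilon> \<alpha> :: real and V v :: "real^2 \<Rightarrow> real" and x0 :: "real^2" and S \<delta>
    assume \<epsilon>: "0 < \<epsilon>" and \<alpha>: "\<bar>\<alpha>\<bar> \<le> 1" and \<delta>_def: "\<delta> = exp (- v x0 / 2) * pole_dist \<epsilon> x0 powr (-\<alpha>)"
      and N\<delta>: "N * \<delta> \<le> pole_dist \<epsilon> x0" and sub: "cball x0 (\<delta> * L) \<subseteq> S"
      and cv: "continuous_on S v" and cV: "continuous_on S V"
      and Vab: "\<forall>x\<in>S. a \<le> V x \<and> V x \<le> b" and Vosc: "\<forall>x\<in>S. \<forall>y\<in>S. V x \<le> (1 + t) * V y"
      and vle: "\<forall>y\<in>ball x0 (\<delta> * L). v y \<le> v x0 + 4"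
      and gr: "green_on S v (\<lambda>x. (\<epsilon>\<^sup>2 + (norm x)\<^sup>2) powr \<alpha> * V x * exp (v x))"
    define m where "m = pole_dist \<epsilon> x0"
    have m: "0 < m" using \<epsilon> by (simp add: m_def pole_dist_pos)
    have \<delta>: "0 < \<delta>" using m by (simp add: \<delta>_def m_def[symmetric])
    define f where "f x = (\<epsilon>\<^sup>2 + (norm x)\<^sup>2) powr \<alpha> * V x * exp (v x)" for x
    define u where "u z = v (x0 + \<delta> *\<^sub>R z) - v x0" for z
    define F where "F z = indicator (ball 0 L) z * (\<delta>\<^sup>2 * f (x0 + \<delta> *\<^sub>R z))" for z
    define q where "q z = (pole_dist \<epsilon> (x0 + \<delta> *\<^sub>R z) / m)\<^sup>2" for z
    have pne: "\<epsilon>\<^sup>2 + (norm x)\<^sup>2 \<noteq> 0" for x :: "real^2" using \<epsilon> by (simp add: add_nonneg_eq_0_iff)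
    have cf: "continuous_on S f" unfolding f_def[abs_def]
      by (intro continuous_intros cv cV) (use pne in auto)
    have inS: "x0 + \<delta> *\<^sub>R z \<in> S" "x0 + \<delta> *\<^sub>R z \<in> ball x0 (\<delta> * L)" if "z \<in> ball 0 L" for z
      using that sub \<delta> by (auto simp: subset_eq dist_norm mult_left_mono intro: less_imp_le)
    have V0: "0 \<le> V y" if "y \<in> S" for y using Vab that ab by force
    then have fnn: "0 \<le> f y" if "y \<in> S" for y using that by (simp add: f_def)
    have L0: "0 < L" using L by simp
    have gr': "green_on S v f" using gr by (simp add: f_def[abs_def])
    note sc1 = scaled_disc_solution(1)[OF gr' cv cf fnn \<delta> L0 sub, of "v x0"]
    note sc2 = scaled_disc_solution(2)[OF gr' cv cf fnn \<delta> L0 sub]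
    have d2: "\<delta>\<^sup>2 * exp (v x0) = (m\<^sup>2) powr (-\<alpha>)"
    proof -
      have "\<delta>\<^sup>2 = (exp (- v x0 / 2) * exp (- v x0 / 2)) * (m powr (-\<alpha>) * m powr (-\<alpha>))"
        unfolding \<delta>_def m_def power2_eq_square by (simp only: mult_ac)
      also have "exp (- v x0 / 2) * exp (- v x0 / 2) = exp (- v x0)" by (simp flip: exp_add)
      also have "m powr (-\<alpha>) * m powr (-\<alpha>) = (m\<^sup>2) powr (-\<alpha>)"
        by (simp only: power2_eq_square powr_mult)
      finally have "\<delta>\<^sup>2 * exp (v x0) = (exp (- v x0) * exp (v x0)) * (m\<^sup>2) powr (-\<alpha>)" by (simp only: mult_ac)
      also have "exp (- v x0) * exp (v x0) = 1" by (simp flip: exp_add)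
      finally show ?thesis by (simp only: mult_1)
    qed
    have Fq: "F z = q z powr \<alpha> * V (x0 + \<delta> *\<^sub>R z) * exp (u z)" if "z \<in> ball 0 L" for z
    proof -
      have "q z powr \<alpha> = (\<epsilon>\<^sup>2 + (norm (x0 + \<delta> *\<^sub>R z))\<^sup>2) powr \<alpha> * (m\<^sup>2) powr (-\<alpha>)"
        unfolding q_def power_divide pole_dist_sq powr_divide by (simp only: powr_minus divide_inverse)
      moreover have "exp (v (x0 + \<delta> *\<^sub>R z)) = exp (v x0) * exp (u z)" by (simp add: u_def exp_diff)
      ultimately show ?thesis using that by (simp add: F_def f_def d2[symmetric])
    qed
    have q: "(1 - \<eta>)\<^sup>2 \<le> q z" "q z \<le> (1 + \<eta>)\<^sup>2" if "z \<in> ball 0 L" for z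
    proof -
      have "\<bar>pole_dist \<epsilon> (x0 + \<delta> *\<^sub>R z) - m\<bar> \<le> dist (x0 + \<delta> *\<^sub>R z) x0" unfolding m_def by (rule pole_dist_lipschitz)
      also have "\<dots> = \<delta> * norm z" using \<delta> by (simp add: dist_norm)
      also have "\<dots> \<le> \<delta> * L" using that \<delta> by (intro mult_left_mono) auto
      also have "\<dots> \<le> m * \<eta>"
      proof -
        have "L / \<eta> * \<delta> \<le> N * \<delta>" using \<delta> by (intro mult_right_mono) (auto simp: N_def)
        also have "\<dots> \<le> m" using N\<delta> by (simp add: m_def)
        finally show ?thesis using \<eta> by (simp add: field_simps)
      qed
      finally have d: "\<bar>pole_dist \<epsilon> (x0 + \<delta> *\<^sub>R z) - m\<bar> \<le> m * \<eta>" .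
      have "1 - \<eta> \<le> pole_dist \<epsilon> (x0 + \<delta> *\<^sub>R z) / m" "pole_dist \<epsilon> (x0 + \<delta> *\<^sub>R z) / m \<le> 1 + \<eta>"
        using d m by (auto simp: abs_le_iff field_simps)
      then show "(1 - \<eta>)\<^sup>2 \<le> q z" "q z \<le> (1 + \<eta>)\<^sup>2"
        unfolding q_def using \<eta> m pole_dist_pos[OF \<epsilon>, of "x0 + \<delta> *\<^sub>R z"]
        by (auto intro!: power_mono)
    qed
    have \<eta>4: "1 / 4 \<le> (1 - \<eta>)\<^sup>2" "(1 + \<eta>)\<^sup>2 \<le> 4"
      using power_mono[of "1/2" "1 - \<eta>" 2] power_mono[of "1 + \<eta>" 2 2] \<eta> by (auto simp: power2_eq_square)
    have q4: "1 / 4 \<le> q z powr \<alpha>" "q z powr \<alpha> \<le> 4" if "z \<in> ball 0 L" for z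
      using powr_between[OF \<alpha>, of 4 "q z"] q[OF that] \<eta>4 by auto
    have "8 * pi * (1 - \<sigma>) \<le> (\<integral>y. F y \<partial>lborel)"
    proof (rule core)
      show "disc_solution u F L" using sc1 by (simp add: u_def[abs_def] F_def[abs_def])
      show "norm (0::real^2) \<le> 0" by simp
      show "u 0 = 0" by (simp add: u_def)
      show "\<forall>y\<in>ball 0 L. u y \<le> 4" using vle inS by (auto simp: u_def algebra_simps)
      show "\<forall>y. norm y \<le> 0 + 1 \<longrightarrow> a / 4 * min 1 ((norm y)\<^sup>2) * exp (u y) \<le> F y"
      proof (intro allI impI)
        fix y :: "real^2" assume "norm y \<le> 0 + 1"
        then have y: "y \<in> ball 0 L" using L by simp
        have "a / 4 * min 1 ((norm y)\<^sup>2) \<le> a / 4 * 1" using ab by (intro mult_left_mono) auto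
        also have "\<dots> \<le> q y powr \<alpha> * V (x0 + \<delta> *\<^sub>R y)"
          using mult_mono[of "1/4" "q y powr \<alpha>" a "V (x0 + \<delta> *\<^sub>R y)"] q4(1)[OF y] Vab inS[OF y] ab by auto
        finally show "a / 4 * min 1 ((norm y)\<^sup>2) * exp (u y) \<le> F y" unfolding Fq[OF y] by (intro mult_right_mono) auto
      qed
      show "\<forall>y\<in>ball 0 L. y \<noteq> 0 \<longrightarrow> F y \<le> 4 * b * exp 4 * (1 + norm y) ^ 4 * norm y powr (-(3/2))"
      proof (intro ballI impI)
        fix y :: "real^2" assume y: "y \<in> ball 0 L" and y0: "y \<noteq> 0"
        have "u y \<le> 4" using vle inS[OF y] by (auto simp: u_def algebra_simps)
        then have "F y \<le> 4 * b * exp 4"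
          unfolding Fq[OF y] using q4(2)[OF y] Vab V0 inS[OF y] ab by (intro mult_mono) auto
        also have "\<dots> = 4 * b * exp 4 * 1" by simp
        also have "1 \<le> (1 + norm y) ^ 4 * norm y powr (-(3/2))"
        proof -
          have "norm y powr (3/2) * norm y powr (-(3/2)) \<le> (1 + norm y) ^ 4 * norm y powr (-(3/2))"
            using powr_le_one_plus[of "norm y" "3/2" 4] y0 by (intro mult_right_mono) auto
          then show ?thesis using y0 by (simp flip: powr_add)
        qed
        finally show "F y \<le> 4 * b * exp 4 * (1 + norm y) ^ 4 * norm y powr (-(3/2))"
          using ab by (simp add: mult.assoc)
      qed
      show "\<forall>x. s * norm x < L \<longrightarrow>
         F x * exp (- u x) \<le> (1 + \<theta>c) * s powr (2 * 0) * (F (s *\<^sub>R x) * exp (- u (s *\<^sub>R x)))"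
      proof (intro allI impI)
        fix x :: "real^2" assume sx: "s * norm x < L"
        have "norm x \<le> s * norm x" using s mult_right_mono[of 1 s "norm x"] by simp
        then have x: "x \<in> ball 0 L" "s *\<^sub>R x \<in> ball 0 L" using sx s by auto
        have F1: "F x * exp (- u x) = q x powr \<alpha> * V (x0 + \<delta> *\<^sub>R x)"
          and F2: "F (s *\<^sub>R x) * exp (- u (s *\<^sub>R x)) = q (s *\<^sub>R x) powr \<alpha> * V (x0 + \<delta> *\<^sub>R (s *\<^sub>R x))"
          using x by (auto simp: Fq exp_minus)
        have \<eta>p: "0 < (1 - \<eta>)\<^sup>2" using \<eta> by simp
        have qpos: "0 < q x" "0 < q (s *\<^sub>R x)" using q[OF x(1)] q[OF x(2)] \<eta>p by linarith+
        have r: "q y / q z \<le> ((1 + \<eta>) / (1 - \<eta>))\<^sup>2" if "y \<in> ball 0 L" "z \<in> ball 0 L" for y z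
          unfolding power_divide using q[OF that(1)] q[OF that(2)] \<eta>p by (intro frac_le) auto
        have "q x / q (s *\<^sub>R x) \<le> 1 + t" using r[OF x] \<eta>(3) by linarith
        moreover have "1 / (1 + t) \<le> q x / q (s *\<^sub>R x)"
        proof -
          have "q (s *\<^sub>R x) / q x \<le> 1 + t" using r[OF x(2,1)] \<eta>(3) by linarith
          then show ?thesis using qpos t by (simp add: field_simps)
        qed
        ultimately have "(q x / q (s *\<^sub>R x)) powr \<alpha> \<le> 1 + t" using powr_between(2)[OF \<alpha>] t by auto
        then have "q x powr \<alpha> \<le> (1 + t) * q (s *\<^sub>R x) powr \<alpha>" using qpos by (simp add: powr_divide field_simps)
        then have "q x powr \<alpha> * V (x0 + \<delta> *\<^sub>R x) \<le> ((1 + t) * q (s *\<^sub>R x) powr \<alpha>) * ((1 + t) * V (x0 + \<delta> *\<^sub>R (s *\<^sub>R x)))"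
          using Vosc V0 inS(1)[OF x(1)] inS(1)[OF x(2)] t by (intro mult_mono) auto
        also have "\<dots> = ((1 + t) * (1 + t)) * (q (s *\<^sub>R x) powr \<alpha> * V (x0 + \<delta> *\<^sub>R (s *\<^sub>R x)))" by simp
        also have "\<dots> \<le> (1 + \<theta>c) * (q (s *\<^sub>R x) powr \<alpha> * V (x0 + \<delta> *\<^sub>R (s *\<^sub>R x)))"
          using t(2) V0[OF inS(1)[OF x(2)]] by (intro mult_right_mono mult_nonneg_nonneg) auto
        finally show "F x * exp (- u x) \<le> (1 + \<theta>c) * s powr (2 * 0) * (F (s *\<^sub>R x) * exp (- u (s *\<^sub>R x)))"
          unfolding F1 F2 using s by simp
      qed
    qed
    also have "\<dots> = (\<integral>y. indicator (ball x0 (\<delta> * L)) y * f y \<partial>lborel)"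
      using sc2 by (simp add: F_def[abs_def])
    finally show "8 * pi * (1 - \<sigma>) \<le>
        (\<integral>y. indicator (ball x0 (\<delta> * L)) y * ((\<epsilon>\<^sup>2 + (norm y)\<^sup>2) powr \<alpha> * V y * exp (v y)) \<partial>lborel)"
      by (simp add: f_def)
  qed
qed

text \<open>The pole is within N scales of the peak, so the blow-up is centred at the origin
  instead, where a dilation acts on the weight (\<tau>^2 + |z|^2)^\<alpha> with a loss of at most
  s^(2 \<beta>). The peak becomes a point of norm at most N. The ratio \<tau> = \<epsilon>/\<delta>
  is at most N but not bounded away from 0, and all bounds have to be uniform in it.\<close>

lemma concentration_singular:
  fixes a b \<beta> \<sigma> N :: real
  assumes ab: "0 < a" "a \<le> b" and \<beta>: "0 \<le> \<beta>" "\<beta> < 1" and \<sigma>: "0 < \<sigma>" "\<sigma> < 1" and N: "1 \<le> N"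
  shows "\<exists>L \<theta>. N + 1 < L \<and> 0 < \<theta> \<and>
    (\<forall>\<epsilon> \<alpha> V v x0 S \<delta>. 0 < \<epsilon> \<longrightarrow> - \<beta> \<le> \<alpha> \<longrightarrow> \<alpha> \<le> 1 \<longrightarrow>
      \<delta> = exp (- v x0 / (2 + 2 * \<alpha>)) \<longrightarrow> pole_dist \<epsilon> x0 \<le> N * \<delta> \<longrightarrow>
      cball 0 (\<delta> * L) \<subseteq> S \<longrightarrow> continuous_on S v \<longrightarrow> continuous_on S V \<longrightarrow>
      (\<forall>x\<in>S. a \<le> V x \<and> V x \<le> b) \<longrightarrow> (\<forall>x\<in>S. \<forall>y\<in>S. V x \<le> (1 + \<theta>) * V y) \<longrightarrow>
      (\<forall>y\<in>ball 0 (\<delta> * L). v y \<le> v x0 + 4) \<longrightarrow>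
      green_on S v (\<lambda>x. (\<epsilon>\<^sup>2 + (norm x)\<^sup>2) powr \<alpha> * V x * exp (v x)) \<longrightarrow>
      8 * pi * ((1 - \<beta>) * (1 - \<sigma>)) \<le>
        (\<integral>y. indicator (ball 0 (\<delta> * L)) y * ((\<epsilon>\<^sup>2 + (norm y)\<^sup>2) powr \<alpha> * V y * exp (v y)) \<partial>lborel))"
proof -
  \<comment> \<open>Any p in (1,2) with 2 \<beta> \<le> p serves: then |y|^(2 \<alpha>) is no worse
    than |y|^(-p) near 0 for all \<alpha> \<ge> - \<beta>.\<close>
  define p where "p = (3 + \<beta>) / 2"
  define a0 where "a0 = a / (2 * (N + 1)\<^sup>2)"
  define A where "A = b * exp 4 * (1 + N)\<^sup>2"
  have p: "1 < p" "p < 2" "2 * \<beta> \<le> p" using \<beta> by (auto simp: p_def)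
  have N2: "1 \<le> 2 * (N + 1)\<^sup>2"
  proof -
    have "1 \<le> (N + 1)\<^sup>2" using N by (intro one_le_power) auto
    then show ?thesis by simp
  qed
  have a0: "0 < a0" unfolding a0_def by (rule divide_pos_pos) (use ab N2 in linarith)+
  have A0: "0 \<le> A" using ab by (simp add: A_def)
  have lm: "0 < 8 * pi * ((1 - \<beta>) * (1 - \<sigma>))" "8 * pi * ((1 - \<beta>) * (1 - \<sigma>)) < 8 * pi * (1 - \<beta>)"
    using \<beta> \<sigma> by auto
  have N0: "0 \<le> N" using N by simp
  obtain L s \<theta> where L: "N + 1 < L" and s: "1 < s" and \<theta>: "0 < \<theta>" and
    core: "\<And>u F x1. disc_solution u F L \<Longrightarrow> norm x1 \<le> N \<Longrightarrow> u x1 = 0 \<Longrightarrow> (\<forall>y\<in>ball 0 L. u y \<le> 4) \<Longrightarrow>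
      (\<forall>y. norm y \<le> N + 1 \<longrightarrow> a0 * min 1 ((norm y)\<^sup>2) * exp (u y) \<le> F y) \<Longrightarrow>
      (\<forall>y\<in>ball 0 L. y \<noteq> 0 \<longrightarrow> F y \<le> A * (1 + norm y) ^ 4 * norm y powr (-p)) \<Longrightarrow>
      (\<forall>x. s * norm x < L \<longrightarrow>
         F x * exp (- u x) \<le> (1 + \<theta>) * s powr (2 * \<beta>) * (F (s *\<^sub>R x) * exp (- u (s *\<^sub>R x)))) \<Longrightarrow>
      8 * pi * ((1 - \<beta>) * (1 - \<sigma>)) \<le> (\<integral>y. F y \<partial>lborel)"
    using core_mass_bound[OF \<beta> lm p(1,2) _ a0 A0 N0, of 4] by auto
  show ?thesis
  proof (rule exI[of _ L], rule exI[of _ \<theta>], intro conjI allI impI)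
    show "N + 1 < L" "0 < \<theta>" by (fact L \<theta>)+
    fix \<epsilon> \<alpha> :: real and V v :: "real^2 \<Rightarrow> real" and x0 :: "real^2" and S \<delta>
    assume \<epsilon>: "0 < \<epsilon>" and \<alpha>: "- \<beta> \<le> \<alpha>" "\<alpha> \<le> 1" and \<delta>_def: "\<delta> = exp (- v x0 / (2 + 2 * \<alpha>))"
      and m: "pole_dist \<epsilon> x0 \<le> N * \<delta>" and sub: "cball 0 (\<delta> * L) \<subseteq> S"
      and cv: "continuous_on S v" and cV: "continuous_on S V"
      and Vab: "\<forall>x\<in>S. a \<le> V x \<and> V x \<le> b" and Vosc: "\<forall>x\<in>S. \<forall>y\<in>S. V x \<le> (1 + \<theta>) * V y"
      and vle: "\<forall>y\<in>ball 0 (\<delta> * L). v y \<le> v x0 + 4"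
      and gr: "green_on S v (\<lambda>x. (\<epsilon>\<^sup>2 + (norm x)\<^sup>2) powr \<alpha> * V x * exp (v x))"
    have \<delta>: "0 < \<delta>" by (simp add: \<delta>_def)
    have \<alpha>1: "0 < 1 + \<alpha>" using \<alpha> \<beta> by linarith
    define f where "f x = (\<epsilon>\<^sup>2 + (norm x)\<^sup>2) powr \<alpha> * V x * exp (v x)" for x
    define u where "u z = v (0 + \<delta> *\<^sub>R z) - v x0" for z
    define F where "F z = indicator (ball 0 L) z * (\<delta>\<^sup>2 * f (0 + \<delta> *\<^sub>R z))" for z
    define \<tau> where "\<tau> = \<epsilon> / \<delta>"
    define q where "q z = \<tau>\<^sup>2 + (norm z)\<^sup>2" for z :: "real^2"
    have \<tau>: "0 < \<tau>" "\<tau> \<le> N"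
    proof -
      show "0 < \<tau>" using \<epsilon> \<delta> by (simp add: \<tau>_def)
      have "\<epsilon> \<le> N * \<delta>" using m norm_le_pole_dist(2)[of \<epsilon> x0] \<epsilon> by linarith
      then show "\<tau> \<le> N" using \<delta> by (simp add: \<tau>_def divide_le_eq)
    qed
    have qpos: "0 < q z" for z using \<tau> by (simp add: q_def add_pos_nonneg)
    have pne: "\<epsilon>\<^sup>2 + (norm x)\<^sup>2 \<noteq> 0" for x :: "real^2" using \<epsilon> by (simp add: add_nonneg_eq_0_iff)
    have cf: "continuous_on S f" unfolding f_def[abs_def]
      by (intro continuous_intros cv cV) (use pne in auto)
    have inS: "0 + \<delta> *\<^sub>R z \<in> S" "0 + \<delta> *\<^sub>R z \<in> ball 0 (\<delta> * L)" if "z \<in> ball 0 L" for z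
      using that sub \<delta> by (auto simp: subset_eq dist_norm mult_left_mono intro: less_imp_le)
    have V0: "0 \<le> V y" if "y \<in> S" for y using Vab that ab by force
    then have fnn: "0 \<le> f y" if "y \<in> S" for y using that by (simp add: f_def)
    have L0: "0 < L" using L N by simp
    have gr': "green_on S v f" using gr by (simp add: f_def[abs_def])
    note sc1 = scaled_disc_solution(1)[OF gr' cv cf fnn \<delta> L0 sub, of "v x0"]
    note sc2 = scaled_disc_solution(2)[OF gr' cv cf fnn \<delta> L0 sub]
    have d2: "\<delta>\<^sup>2 * (\<delta>\<^sup>2) powr \<alpha> * exp (v x0) = 1"
    proof -
      have "\<delta>\<^sup>2 = exp (- v x0 / (1 + \<alpha>))"
      proof -
        have "- v x0 / (2 + 2 * \<alpha>) + - v x0 / (2 + 2 * \<alpha>) = - v x0 / (1 + \<alpha>)"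
        proof -
          have "x / (2 * c) + x / (2 * c) = x / c" for x c :: real by simp
          from this[of "- v x0" "1 + \<alpha>"] show ?thesis by (simp only: distrib_left mult_1_right)
        qed
        then show ?thesis unfolding \<delta>_def power2_eq_square exp_add[symmetric] by (rule arg_cong)
      qed
      then have "(\<delta>\<^sup>2) powr (1 + \<alpha>) = exp (- v x0)"
        using \<alpha>1 by (simp add: exp_powr_real)
      moreover have "(\<delta>\<^sup>2) powr (1 + \<alpha>) = \<delta>\<^sup>2 * (\<delta>\<^sup>2) powr \<alpha>" using \<delta> by (simp add: powr_add)
      ultimately show ?thesis by (simp add: exp_minus)
    qed
    have Fq: "F z = q z powr \<alpha> * V (0 + \<delta> *\<^sub>R z) * exp (u z)" if "z \<in> ball 0 L" for z
    proof -
      have "\<epsilon>\<^sup>2 + (norm (0 + \<delta> *\<^sub>R z))\<^sup>2 = \<delta>\<^sup>2 * q z"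
        using \<delta> by (simp add: q_def \<tau>_def power_divide power_mult_distrib distrib_left)
      then have e1: "(\<epsilon>\<^sup>2 + (norm (0 + \<delta> *\<^sub>R z))\<^sup>2) powr \<alpha> = (\<delta>\<^sup>2) powr \<alpha> * q z powr \<alpha>"
        by (simp only: powr_mult)
      have e2: "exp (v (0 + \<delta> *\<^sub>R z)) = exp (v x0) * exp (u z)" by (simp add: u_def exp_diff)
      have "F z = \<delta>\<^sup>2 * ((\<delta>\<^sup>2) powr \<alpha> * q z powr \<alpha> * V (0 + \<delta> *\<^sub>R z) * (exp (v x0) * exp (u z)))"
        unfolding F_def f_def e1 e2 using that by simp
      also have "\<dots> = (\<delta>\<^sup>2 * (\<delta>\<^sup>2) powr \<alpha> * exp (v x0)) * (q z powr \<alpha> * V (0 + \<delta> *\<^sub>R z) * exp (u z))"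
        by (simp only: mult_ac)
      finally show ?thesis unfolding d2 by simp
    qed
    have "8 * pi * ((1 - \<beta>) * (1 - \<sigma>)) \<le> (\<integral>y. F y \<partial>lborel)"
    proof (rule core)
      show "disc_solution u F L" using sc1 by (simp add: u_def[abs_def] F_def[abs_def])
      show "norm ((1 / \<delta>) *\<^sub>R x0) \<le> N"
        using m norm_le_pole_dist(1)[of x0 \<epsilon>] \<delta> by (simp add: divide_le_eq)
      show "u ((1 / \<delta>) *\<^sub>R x0) = 0" using \<delta> by (simp add: u_def)
      show "\<forall>y\<in>ball 0 L. u y \<le> 4" using vle inS by (auto simp: u_def algebra_simps)
      show "\<forall>y. norm y \<le> N + 1 \<longrightarrow> a0 * min 1 ((norm y)\<^sup>2) * exp (u y) \<le> F y"
      proof (intro allI impI)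
        fix y :: "real^2" assume yN: "norm y \<le> N + 1"
        then have y: "y \<in> ball 0 L" using L by simp
        \<comment> \<open>For \<alpha> \<ge> 0 the weight may degenerate with \<tau>, but \<alpha>
          \<le> 1 keeps it above min 1 (|y|^2). For \<alpha> < 0 it is smallest where q is largest,
          and \<alpha> > -1 suffices.\<close>
        have "1 / (2 * (N + 1)\<^sup>2) * min 1 ((norm y)\<^sup>2) \<le> q y powr \<alpha>"
        proof (cases "0 \<le> \<alpha>")
          case True
          have "1 / (2 * (N + 1)\<^sup>2) * min 1 ((norm y)\<^sup>2) \<le> 1 * min 1 ((norm y)\<^sup>2)"
          proof (rule mult_right_mono)
            show "1 / (2 * (N + 1)\<^sup>2) \<le> 1" using N2 divide_le_eq_1_pos[of "2 * (N + 1)\<^sup>2" 1] by linarith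
          qed simp
          also have "\<dots> \<le> q y powr \<alpha>"
          proof (cases "1 \<le> q y")
            case True
            then have "1 \<le> q y powr \<alpha>" using \<open>0 \<le> \<alpha>\<close> by (rule ge_one_powr_ge_zero)
            then show ?thesis by linarith
          next
            case False
            have "(norm y)\<^sup>2 \<le> q y" by (simp add: q_def)
            also have "q y = q y powr 1" using qpos[of y] by simp
            also have "\<dots> \<le> q y powr \<alpha>" using False qpos[of y] \<alpha> by (intro powr_mono') auto
            finally show ?thesis by linarith
          qed
          finally show ?thesis .
        next
          case False
          have "q y \<le> 2 * (N + 1)\<^sup>2"
          proof -
            have "\<tau>\<^sup>2 \<le> (N + 1)\<^sup>2" "(norm y)\<^sup>2 \<le> (N + 1)\<^sup>2" using \<tau> yN by (auto intro!: power_mono)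
            then show ?thesis by (simp add: q_def)
          qed
          then have "(2 * (N + 1)\<^sup>2) powr \<alpha> \<le> q y powr \<alpha>" using False qpos[of y] by (intro powr_mono2') auto
          moreover have "(2 * (N + 1)\<^sup>2) powr (-1) \<le> (2 * (N + 1)\<^sup>2) powr \<alpha>" using \<alpha>1 N2 by (intro powr_mono) auto
          moreover have "(2 * (N + 1)\<^sup>2) powr (-1) = 1 / (2 * (N + 1)\<^sup>2)" using N2 by (simp add: powr_minus_divide)
          moreover have "1 / (2 * (N + 1)\<^sup>2) * min 1 ((norm y)\<^sup>2) \<le> 1 / (2 * (N + 1)\<^sup>2) * 1"
            by (intro mult_left_mono) auto
          ultimately show ?thesis by linarith
        qed
        then have "a * (1 / (2 * (N + 1)\<^sup>2) * min 1 ((norm y)\<^sup>2)) \<le> V (0 + \<delta> *\<^sub>R y) * q y powr \<alpha>"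
          using Vab inS(1)[OF y] ab N2 by (intro mult_mono) auto
        then show "a0 * min 1 ((norm y)\<^sup>2) * exp (u y) \<le> F y"
          unfolding Fq[OF y] a0_def by (intro mult_right_mono) (auto simp: mult.commute)
      qed
      show "\<forall>y\<in>ball 0 L. y \<noteq> 0 \<longrightarrow> F y \<le> A * (1 + norm y) ^ 4 * norm y powr (-p)"
      proof (intro ballI impI)
        fix y :: "real^2" assume y: "y \<in> ball 0 L" and y0: "y \<noteq> 0"
        define r where "r = norm y"
        have r: "0 < r" using y0 by (simp add: r_def)
        have "u y \<le> 4" using vle inS[OF y] by (auto simp: u_def algebra_simps)
        then have "F y \<le> q y powr \<alpha> * b * exp 4"
          unfolding Fq[OF y] using Vab V0 inS[OF y] ab by (intro mult_mono) auto
        \<comment> \<open>The fourth power leaves room for two things: growth of the weight up to (1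
          + r)^2 when \<alpha> is near 1, and another (1 + r)^2 that compensates the decaying factor
          r^(-p) at large r.\<close>
        also have "q y powr \<alpha> \<le> (1 + N)\<^sup>2 * ((1 + r) ^ 4 * r powr (-p))"
        proof (cases "0 \<le> \<alpha>")
          case True
          have "q y powr \<alpha> \<le> (1 + q y) powr 1"
          proof -
            have "q y powr \<alpha> \<le> (1 + q y) powr \<alpha>" using qpos[of y] True by (intro powr_mono2) auto
            also have "\<dots> \<le> (1 + q y) powr 1" using qpos[of y] \<alpha> by (intro powr_mono) auto
            finally show ?thesis .
          qed
          also have "\<dots> = 1 + q y" using qpos[of y] by simp
          also have "\<dots> \<le> (1 + N)\<^sup>2 * (1 + r)\<^sup>2"
          proof -
            have "\<tau>\<^sup>2 \<le> N\<^sup>2" using \<tau> by (intro power_mono) auto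
            then have "1 + q y \<le> 1 + N\<^sup>2 + r\<^sup>2" by (simp add: q_def r_def)
            also have "\<dots> \<le> (1 + N\<^sup>2) * (1 + r\<^sup>2)" by (simp add: algebra_simps)
            also have "\<dots> \<le> (1 + N)\<^sup>2 * (1 + r)\<^sup>2"
              using N r by (intro mult_mono) (auto simp: power2_sum)
            finally show ?thesis .
          qed
          also have "(1 + r)\<^sup>2 \<le> (1 + r) ^ 4 * r powr (-p)"
          proof -
            have "r powr p \<le> (1 + r)\<^sup>2" using powr_le_one_plus[of r p 2] r p by simp
            then have "(1 + r)\<^sup>2 * (r powr p * r powr (-p)) \<le> (1 + r)\<^sup>2 * ((1 + r)\<^sup>2 * r powr (-p))"
              by (intro mult_left_mono mult_right_mono) auto
            moreover have "r powr p * r powr (-p) = 1" using r by (simp flip: powr_add)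
            moreover have "(1 + r)\<^sup>2 * ((1 + r)\<^sup>2 * r powr (-p)) = (1 + r) ^ 4 * r powr (-p)"
              by (simp add: power2_eq_square power4_eq_xxxx mult_ac)
            ultimately show ?thesis by simp
          qed
          finally show ?thesis by (simp add: mult_left_mono)
        next
          case False
          have "(r\<^sup>2) powr \<alpha> = r powr (2 * \<alpha>)"
            using power2_powr_half[of r "2 * \<alpha>"] r by simp
          moreover have "q y powr \<alpha> \<le> (r\<^sup>2) powr \<alpha>" using False r by (intro powr_mono2') (auto simp: q_def r_def)
          moreover have "r powr (2 * \<alpha>) = r powr (2 * \<alpha> + p) * r powr (-p)" by (simp flip: powr_add)
          moreover have "r powr (2 * \<alpha> + p) \<le> (1 + r) ^ 4"
            by (rule powr_le_one_plus[OF r]) (use p \<alpha> False in auto)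
          then have "r powr (2 * \<alpha> + p) * r powr (-p) \<le> (1 + r) ^ 4 * r powr (-p)"
            by (intro mult_right_mono) auto
          moreover have "1 * ((1 + r) ^ 4 * r powr (-p)) \<le> (1 + N)\<^sup>2 * ((1 + r) ^ 4 * r powr (-p))"
            using N r by (intro mult_right_mono one_le_power) auto
          ultimately show ?thesis by linarith
        qed
        finally show "F y \<le> A * (1 + norm y) ^ 4 * norm y powr (-p)"
          using ab by (simp add: A_def r_def mult_ac)
      qed
      show "\<forall>x. s * norm x < L \<longrightarrow>
         F x * exp (- u x) \<le> (1 + \<theta>) * s powr (2 * \<beta>) * (F (s *\<^sub>R x) * exp (- u (s *\<^sub>R x)))"
      proof (intro allI impI)
        fix x :: "real^2" assume sx: "s * norm x < L"
        have "norm x \<le> s * norm x" using s mult_right_mono[of 1 s "norm x"] by simp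
        then have x: "x \<in> ball 0 L" "s *\<^sub>R x \<in> ball 0 L" using sx s by auto
        have F1: "F x * exp (- u x) = q x powr \<alpha> * V (0 + \<delta> *\<^sub>R x)"
          and F2: "F (s *\<^sub>R x) * exp (- u (s *\<^sub>R x)) = q (s *\<^sub>R x) powr \<alpha> * V (0 + \<delta> *\<^sub>R (s *\<^sub>R x))"
          using x by (auto simp: Fq exp_minus)
        have s2: "1 \<le> s\<^sup>2" using s by (simp add: one_le_power)
        have qq: "q x powr \<alpha> \<le> s powr (2 * \<beta>) * q (s *\<^sub>R x) powr \<alpha>"
        proof (cases "0 \<le> \<alpha>")
          case True
          have "(norm x)\<^sup>2 \<le> s\<^sup>2 * (norm x)\<^sup>2" using mult_right_mono[OF s2, of "(norm x)\<^sup>2"] by simp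
          then have "q x \<le> q (s *\<^sub>R x)" by (simp add: q_def power_mult_distrib)
          then have "1 * q x powr \<alpha> \<le> s powr (2 * \<beta>) * q (s *\<^sub>R x) powr \<alpha>"
            using True qpos[of x] s \<beta> by (intro mult_mono powr_mono2 ge_one_powr_ge_zero) auto
          then show ?thesis by simp
        next
          case False
          have "\<tau>\<^sup>2 \<le> s\<^sup>2 * \<tau>\<^sup>2" using mult_right_mono[OF s2, of "\<tau>\<^sup>2"] by simp
          then have "q (s *\<^sub>R x) \<le> s\<^sup>2 * q x" by (simp add: q_def power_mult_distrib distrib_left)
          then have "(s\<^sup>2 * q x) powr \<alpha> \<le> q (s *\<^sub>R x) powr \<alpha>" using False qpos[of "s *\<^sub>R x"] by (intro powr_mono2') auto
          then have "(s\<^sup>2) powr \<alpha> * q x powr \<alpha> \<le> q (s *\<^sub>R x) powr \<alpha>" by (simp only: powr_mult)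
          moreover have "(s\<^sup>2) powr \<alpha> = s powr (2 * \<alpha>)" using power2_powr_half[of s "2 * \<alpha>"] s by simp
          moreover have "s powr (- (2 * \<beta>)) * q x powr \<alpha> \<le> s powr (2 * \<alpha>) * q x powr \<alpha>"
            using s \<alpha> by (intro mult_right_mono powr_mono) auto
          ultimately have "s powr (- (2 * \<beta>)) * q x powr \<alpha> \<le> q (s *\<^sub>R x) powr \<alpha>" by simp
          then have "s powr (2 * \<beta>) * (s powr (- (2 * \<beta>)) * q x powr \<alpha>) \<le> s powr (2 * \<beta>) * q (s *\<^sub>R x) powr \<alpha>"
            by (intro mult_left_mono) auto
          moreover have "s powr (2 * \<beta>) * (s powr (- (2 * \<beta>)) * q x powr \<alpha>) = q x powr \<alpha>"
            using s by (simp add: mult.assoc[symmetric] powr_add[symmetric])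
          ultimately show ?thesis by simp
        qed
        have "q x powr \<alpha> * V (0 + \<delta> *\<^sub>R x) \<le> (s powr (2 * \<beta>) * q (s *\<^sub>R x) powr \<alpha>) * ((1 + \<theta>) * V (0 + \<delta> *\<^sub>R (s *\<^sub>R x)))"
          using qq Vosc V0 inS(1)[OF x(1)] inS(1)[OF x(2)] by (intro mult_mono) auto
        then show "F x * exp (- u x) \<le> (1 + \<theta>) * s powr (2 * \<beta>) * (F (s *\<^sub>R x) * exp (- u (s *\<^sub>R x)))"
          unfolding F1 F2 by (simp only: mult_ac)
      qed
    qed
    also have "\<dots> = (\<integral>y. indicator (ball 0 (\<delta> * L)) y * f y \<partial>lborel)"
      using sc2 by (simp add: F_def[abs_def])
    finally show "8 * pi * ((1 - \<beta>) * (1 - \<sigma>)) \<le>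
        (\<integral>y. indicator (ball 0 (\<delta> * L)) y * ((\<epsilon>\<^sup>2 + (norm y)\<^sup>2) powr \<alpha> * V y * exp (v y)) \<partial>lborel)"
      by (simp add: f_def)
  qed
qed

text \<open>A lower bound l of v is at most the disc mean, which is v x0 minus the kernel integral,
  and on the disc of radius r the kernel is at least (ln (D/r) - 1/2) / (2 pi). Should this number
  be negative, positivity of the kernel is enough.\<close>

lemma infimum_bound:
  assumes gr: "green_on S v f" and cv: "continuous_on S v" and cf: "continuous_on S f"
    and nn: "\<And>y. y \<in> S \<Longrightarrow> 0 \<le> f y" and D: "0 < D" "cball x0 D \<subseteq> S"
    and l: "\<And>y. y \<in> S \<Longrightarrow> l \<le> v y"
    and r: "0 < r" "r < D" and sub: "ball c s \<subseteq> cball x0 r"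
    and lam: "0 \<le> lam" "lam \<le> (\<integral>y. indicator (ball c s) y * f y \<partial>lborel)"
  shows "l \<le> v x0 - lam / (2 * pi) * (ln (D / r) - 1 / 2)"
proof -
  define k where "k = (ln (D / r) - 1 / 2) / (2 * pi)"
  have cvb: "continuous_on (cball x0 D) v" and cfb: "continuous_on (cball x0 D) f"
    using cv cf D(2) continuous_on_subset by blast+
  have "set_integrable lborel (cball x0 D) v" using integrable_on_cball[OF cvb] by (simp add: set_integrable_def)
  then have "set_integrable lborel (ball x0 D) v" by (rule set_integrable_subset) auto
  then have "l \<le> disc_mean D v x0"
    by (rule disc_mean_bounds(1)[OF _ D(1)]) (use l D(2) ball_subset_cball in blast)
  moreover have "v x0 = disc_mean D v x0 + (LINT y|lborel. indicator (cball x0 D) y * f y * green_ker D (y - x0))"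
    using gr D unfolding green_on_def by blast
  moreover have "lam * k \<le> (LINT y|lborel. indicator (cball x0 D) y * f y * green_ker D (y - x0))"
  proof (cases "0 \<le> k")
    case True
    obtain B where "\<forall>y\<in>cball x0 D. \<bar>f y\<bar> \<le> B"
      using compact_imp_bounded[OF compact_continuous_image[OF cfb compact_cball]] by (auto simp: bounded_iff)
    then have B: "\<bar>indicator (cball x0 D) y * f y\<bar> \<le> \<bar>B\<bar>" for y by (force simp: indicator_def)
    have fi: "integrable lborel (\<lambda>y. indicator (cball x0 D) y * f y)" by (rule integrable_on_cball[OF cfb])
    have ki: "integrable lborel (\<lambda>y. indicator (cball x0 D) y * f y * green_ker D (y - x0))"
    proof (rule Bochner_Integration.integrable_bound[OF integrable_mult_right[OF integrable_green_ker[OF D(1), of x0], of "\<bar>B\<bar>"]])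
      show "AE y in lborel. norm (indicator (cball x0 D) y * f y * green_ker D (y - x0)) \<le> norm (\<bar>B\<bar> * green_ker D (y - x0))"
        unfolding real_norm_def abs_mult[of _ "green_ker D (_ - x0)"] abs_abs
        by (intro AE_I2 mult_right_mono B) auto
      show "(\<lambda>y. indicator (cball x0 D) y * f y * green_ker D (y - x0)) \<in> borel_measurable lborel"
        by (rule borel_measurable_times[OF borel_measurable_integrable[OF fi]]) measurable
    qed
    have subS: "ball c s \<subseteq> cball x0 D" using sub r by (auto simp: subset_eq)
    have bi: "integrable lborel (\<lambda>y. indicator (ball c s) y * f y)"
    proof -
      have "set_integrable lborel (cball x0 D) f" using fi by (simp add: set_integrable_def)
      then have "set_integrable lborel (ball c s) f" by (rule set_integrable_subset) (use subS in auto)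
      then show ?thesis by (simp add: set_integrable_def)
    qed
    have "lam * k \<le> (\<integral>y. indicator (ball c s) y * f y \<partial>lborel) * k"
      using lam True by (intro mult_right_mono) auto
    also have "\<dots> = (\<integral>y. indicator (ball c s) y * f y * k \<partial>lborel)" by simp
    also have "\<dots> \<le> (LINT y|lborel. indicator (cball x0 D) y * f y * green_ker D (y - x0))"
    proof (rule Bochner_Integration.integral_mono_AE[OF _ ki])
      show "integrable lborel (\<lambda>y. indicator (ball c s) y * f y * k)" using bi by simp
      show "AE y in lborel. indicator (ball c s) y * f y * k \<le> indicator (cball x0 D) y * f y * green_ker D (y - x0)"
        using AE_lborel_singleton[of x0]
      proof eventually_elim
        case (elim y)
        show ?case
        proof (cases "y \<in> ball c s")
          case True
          have y: "y \<in> cball x0 D" "y \<in> S" using True subS D(2) by auto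
          have z: "0 < norm (y - x0)" "norm (y - x0) \<le> r"
            using elim True sub by (auto simp: subset_eq dist_norm norm_minus_commute)
          have "ln (D / r) \<le> ln (D / norm (y - x0))"
            using z r D by (intro ln_mono divide_left_mono) (auto intro!: mult_pos_pos divide_pos_pos)
          moreover have "0 \<le> (norm (y - x0))\<^sup>2 / (2 * D\<^sup>2)" by simp
          ultimately have "ln (D / r) - 1 / 2 \<le> ln (D / norm (y - x0)) - 1 / 2 + (norm (y - x0))\<^sup>2 / (2 * D\<^sup>2)"
            by linarith
          moreover have "norm (y - x0) < D" using z r by linarith
          ultimately have "k \<le> green_ker D (y - x0)"
            unfolding k_def using z(1) by (simp only: green_ker_eq) (intro divide_right_mono, auto)
          then have "f y * k \<le> f y * green_ker D (y - x0)" using nn[OF y(2)] by (intro mult_left_mono) auto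
          then show ?thesis using True y by simp
        next
          case False
          have "0 \<le> indicator (cball x0 D) y * f y * green_ker D (y - x0)"
            using nn D(2) green_ker_nonneg by (auto simp: indicator_def subset_eq intro!: mult_nonneg_nonneg)
          then show ?thesis using False by simp
        qed
      qed
    qed
    finally show ?thesis .
  next
    case False
    then have "lam * k \<le> 0" using lam by (simp add: mult_nonneg_nonpos)
    also have "0 \<le> (LINT y|lborel. indicator (cball x0 D) y * f y * green_ker D (y - x0))"
      using nn D(2) green_ker_nonneg
      by (intro Bochner_Integration.integral_nonneg) (auto simp: indicator_def subset_eq intro!: mult_nonneg_nonneg)
    finally show ?thesis .
  qed
  ultimately show ?thesis by (simp add: k_def)
qed

section \<open>The sup+inf estimate\<close>

text \<open>The conditions from above on t are open and hold strictly at t = 0. The main one reads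
  (1 + \<alpha>0) (1 + 1/C1) < 2 (1 - max 0 (-\<alpha>0)) there: for \<alpha>0 \<ge> 0 this is C1 >
  (1 + \<alpha>0)/(1 - \<alpha>0), for \<alpha>0 < 0 it is C1 > 1. The same t later serves as slack
  for the exponent and for the mass bounds.\<close>

lemma exponent_choice:
  fixes \<alpha>0 C1 :: real
  assumes "-1 < \<alpha>0" "\<alpha>0 < 1" "C1 > max 1 ((1 + \<alpha>0) / (1 - \<alpha>0))"
  obtains t where "0 < t" "t < 1" "max 0 (-\<alpha>0) + t < 1" "\<alpha>0 + t \<le> 1" "-1 < \<alpha>0 - t"
    "(1 + \<alpha>0 + t) * (1 + 1 / C1) \<le> 2 * ((1 - (max 0 (-\<alpha>0) + t)) * (1 - t))"
    "1 + 1 / C1 \<le> 2 * (1 - t)"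
proof -
  have C1: "1 < C1" "(1 + \<alpha>0) / (1 - \<alpha>0) < C1" using assms by auto
  have c: "1 / C1 < 1" using C1 by simp
  have key: "(1 + \<alpha>0 + 0) * (1 + 1 / C1) < 2 * ((1 - (max 0 (-\<alpha>0) + 0)) * (1 - 0))"
  proof (cases "0 \<le> \<alpha>0")
    case True
    have "1 + \<alpha>0 < C1 * (1 - \<alpha>0)" using C1(2) assms by (simp add: divide_less_eq)
    then have "(1 + \<alpha>0) * (1 / C1) < 1 - \<alpha>0" using C1 by (simp add: divide_less_eq mult.commute)
    then show ?thesis using True by (simp add: distrib_left)
  next
    case False
    have "(1 + \<alpha>0) * (1 + 1 / C1) < (1 + \<alpha>0) * 2" using assms c by (intro mult_strict_left_mono) auto
    then show ?thesis using False by simp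
  qed
  have "((\<lambda>t. (1 + \<alpha>0 + t) * (1 + 1 / C1) - 2 * ((1 - (max 0 (-\<alpha>0) + t)) * (1 - t))) \<longlongrightarrow>
      (1 + \<alpha>0 + 0) * (1 + 1 / C1) - 2 * ((1 - (max 0 (-\<alpha>0) + 0)) * (1 - 0))) (at_right (0::real))"
    by (intro tendsto_intros)
  then have e1: "\<forall>\<^sub>F t in at_right (0::real). (1 + \<alpha>0 + t) * (1 + 1 / C1) - 2 * ((1 - (max 0 (-\<alpha>0) + t)) * (1 - t)) < 0"
    using key by (intro order_tendstoD(2)) auto
  define r where "r = Min {1, 1 - max 0 (-\<alpha>0), 1 - \<alpha>0, 1 + \<alpha>0, (1 - 1 / C1) / 2}"
  have r: "0 < r" unfolding r_def using assms c by auto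
  have e2: "\<forall>\<^sub>F t in at_right (0::real). 0 < t \<and> t < r"
    by (rule eventually_at_rightI[of 0 r]) (use r in auto)
  have "\<forall>\<^sub>F t in at_right (0::real). (1 + \<alpha>0 + t) * (1 + 1 / C1) \<le> 2 * ((1 - (max 0 (-\<alpha>0) + t)) * (1 - t)) \<and> 0 < t \<and> t < r"
    using e1 e2 by eventually_elim auto
  from eventually_happens'[OF trivial_limit_at_right_real this]
  obtain t where t: "(1 + \<alpha>0 + t) * (1 + 1 / C1) \<le> 2 * ((1 - (max 0 (-\<alpha>0) + t)) * (1 - t))" "0 < t" "t < r" by blast
  have "t < 1" "t < 1 - max 0 (-\<alpha>0)" "t < 1 - \<alpha>0" "t < 1 + \<alpha>0" "t < (1 - 1 / C1) / 2"
    using t(3) unfolding r_def by auto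
  then show thesis using t by (intro that[of t]) auto
qed

text \<open>A doubling argument: x0 maximises e^v times the power 2 \<gamma> of the distance to the
  boundary of the disc. Within half of its own distance \<rho>0 to the boundary, this distance at
  most halves, so v can exceed v x0 by at most 2 \<gamma> ln 2 \<le> 4. Comparison with the centre
  gives the lower bound on \<rho>0, which makes \<rho>0 large against exp (- v x0 / (2 \<gamma>))
  once v xs is large.\<close>

lemma peak_selection:
  fixes v :: "'a::euclidean_space \<Rightarrow> real"
  assumes D: "0 < D" and cv: "continuous_on (cball xs D) v" and \<gamma>: "1 \<le> \<gamma>" "\<gamma> \<le> 2"
  obtains x0 \<rho>0 where "0 < \<rho>0" "\<rho>0 \<le> D" "dist x0 xs = D - \<rho>0" "v xs \<le> v x0"
    "exp ((v xs - v x0) / (2 * \<gamma>)) * D \<le> \<rho>0"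
    "\<And>y. y \<in> cball x0 (\<rho>0 / 2) \<Longrightarrow> v y \<le> v x0 + 4"
proof -
  define \<Psi> where "\<Psi> y = exp (v y) * (D - dist y xs) powr (2 * \<gamma>)" for y
  have "continuous_on (cball xs D) \<Psi>"
    unfolding \<Psi>_def[abs_def] using \<gamma>
    by (intro continuous_intros cv continuous_on_powr') (auto simp: dist_commute)
  then obtain x0 where x0: "x0 \<in> cball xs D" "\<And>y. y \<in> cball xs D \<Longrightarrow> \<Psi> y \<le> \<Psi> x0"
    using continuous_attains_sup[OF compact_cball, of xs D \<Psi>] D by force
  define \<rho>0 where "\<rho>0 = D - dist x0 xs"
  have "0 \<le> \<rho>0" using x0(1) by (simp add: \<rho>0_def dist_commute)
  have le: "\<Psi> xs \<le> \<Psi> x0" using x0(2) D by simp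
  have \<Psi>xs: "\<Psi> xs = exp (v xs) * D powr (2 * \<gamma>)" by (simp add: \<Psi>_def)
  have \<Psi>x0: "\<Psi> x0 = exp (v x0) * \<rho>0 powr (2 * \<gamma>)" by (simp add: \<Psi>_def \<rho>0_def)
  have "0 < \<Psi> xs" using D by (simp add: \<Psi>xs)
  then have "\<rho>0 \<noteq> 0" using le \<Psi>x0 by auto
  then have \<rho>0: "0 < \<rho>0" using \<open>0 \<le> \<rho>0\<close> by simp
  have \<rho>D: "\<rho>0 \<le> D" by (simp add: \<rho>0_def)
  have ln: "v xs + 2 * \<gamma> * ln D \<le> v x0 + 2 * \<gamma> * ln \<rho>0"
  proof -
    have "ln (\<Psi> xs) \<le> ln (\<Psi> x0)" using le \<open>0 < \<Psi> xs\<close> by (intro ln_mono) auto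
    then show ?thesis using D \<rho>0 by (simp add: \<Psi>xs \<Psi>x0 ln_mult ln_powr)
  qed
  show thesis
  proof (rule that[of \<rho>0 x0])
    show "0 < \<rho>0" "\<rho>0 \<le> D" "dist x0 xs = D - \<rho>0" using \<rho>0 \<rho>D by (auto simp: \<rho>0_def)
    have "2 * \<gamma> * ln \<rho>0 \<le> 2 * \<gamma> * ln D" using \<rho>0 \<rho>D \<gamma> by (intro mult_left_mono ln_mono) auto
    then show "v xs \<le> v x0" using ln by linarith
    have "(v xs - v x0) / (2 * \<gamma>) + ln D \<le> ln \<rho>0" using ln \<gamma> by (simp add: field_simps)
    then have "exp ((v xs - v x0) / (2 * \<gamma>) + ln D) \<le> exp (ln \<rho>0)" by simp
    then show "exp ((v xs - v x0) / (2 * \<gamma>)) * D \<le> \<rho>0" using D \<rho>0 by (simp add: exp_add)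
    show "v y \<le> v x0 + 4" if "y \<in> cball x0 (\<rho>0 / 2)" for y
    proof -
      have d: "dist y xs \<le> dist x0 xs + \<rho>0 / 2" using that dist_triangle[of y xs x0] by (simp add: dist_commute)
      then have h: "\<rho>0 / 2 \<le> D - dist y xs" by (simp add: \<rho>0_def field_simps)
      have "\<Psi> y \<le> \<Psi> x0" using h \<rho>0 by (intro x0(2)) (simp add: dist_commute)
      moreover have "exp (v y) * (\<rho>0 / 2) powr (2 * \<gamma>) \<le> \<Psi> y"
        unfolding \<Psi>_def using h \<rho>0 \<gamma> by (intro mult_left_mono powr_mono2) auto
      ultimately have "exp (v y) * (\<rho>0 / 2) powr (2 * \<gamma>) \<le> exp (v x0) * \<rho>0 powr (2 * \<gamma>)" by (simp add: \<Psi>x0)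
      then have "ln (exp (v y) * (\<rho>0 / 2) powr (2 * \<gamma>)) \<le> ln (exp (v x0) * \<rho>0 powr (2 * \<gamma>))"
        using \<rho>0 by (intro ln_mono) auto
      then have "v y + 2 * \<gamma> * ln (\<rho>0 / 2) \<le> v x0 + 2 * \<gamma> * ln \<rho>0" using \<rho>0 by (simp add: ln_mult ln_powr)
      then have "v y \<le> v x0 + 2 * \<gamma> * ln 2" using \<rho>0 by (simp add: ln_div right_diff_distrib)
      also have "2 * \<gamma> * ln 2 \<le> 4 * 1" using \<gamma> ln_2_less_1 by (intro mult_mono) auto
      finally show ?thesis by simp
    qed
  qed
qed

text \<open>Here w * v0 is the logarithm of the inverse scale up to constants, and \<mu> is the mass
  divided by 2 pi. In v0 + C1 * l the coefficient of v0 becomes 1 + C1 - C1 * \<mu> * w, and the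
  condition 1 + 1/C1 \<le> \<mu> * w makes it nonpositive.\<close>

lemma final_arithmetic:
  fixes vs v0 l C1 \<mu> w K :: real
  assumes "vs \<le> v0" "0 \<le> v0" "0 < C1" "l \<le> v0 - \<mu> * (w * v0 - K)" "1 + 1 / C1 \<le> \<mu> * w" "0 \<le> \<mu>" "\<mu> \<le> 4"
  shows "vs + C1 * l \<le> 4 * C1 * \<bar>K\<bar>"
proof -
  have "C1 * l \<le> C1 * (v0 - \<mu> * (w * v0 - K))" using assms by (intro mult_left_mono) auto
  also have "\<dots> = C1 * v0 - C1 * v0 * (\<mu> * w) + C1 * (\<mu> * K)" by (simp add: algebra_simps)
  also have "\<dots> \<le> C1 * v0 - C1 * v0 * (1 + 1 / C1) + C1 * (4 * \<bar>K\<bar>)"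
  proof (intro add_mono diff_mono mult_left_mono)
    have "\<mu> * K \<le> \<mu> * \<bar>K\<bar>" using assms by (intro mult_left_mono) auto
    also have "\<dots> \<le> 4 * \<bar>K\<bar>" using assms by (intro mult_right_mono) auto
    finally show "\<mu> * K \<le> 4 * \<bar>K\<bar>" .
  qed (use assms in auto)
  also have "\<dots> = - v0 + 4 * C1 * \<bar>K\<bar>" using assms by (simp add: distrib_left)
  finally show ?thesis using assms by linarith
qed

text \<open>Isolates the quantifier order: \<eta> depends on a, b, \<alpha>0 and C1, the radius D is
  then dictated by the oscillation of V, and C2 comes last. An arbitrary lower bound l represents
  the infimum, which may be infinite. \<kappa> limits, for negative \<alpha>, how far the disc may
  lie from the origin, and the factor 3 leaves room for a disc of radius D around every peak in the
  closed disc of radius D.\<close>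

definition estimate_constant :: "real \<Rightarrow> real \<Rightarrow> real \<Rightarrow> real \<Rightarrow> real \<Rightarrow> real \<Rightarrow> real \<Rightarrow> real \<Rightarrow> bool" where
  "estimate_constant a b \<alpha>0 C1 \<eta> D \<kappa> C2 \<longleftrightarrow> (\<forall>\<epsilon> \<alpha> V v xs l. 0 < \<epsilon> \<longrightarrow> \<bar>\<alpha> - \<alpha>0\<bar> < \<eta> \<longrightarrow>
     continuous_on (ball xs (3 * D)) v \<longrightarrow> continuous_on (ball xs (3 * D)) V \<longrightarrow>
     (\<forall>x\<in>ball xs (3 * D). a \<le> V x \<and> V x \<le> b) \<longrightarrow>
     (\<forall>x\<in>ball xs (3 * D). \<forall>y\<in>ball xs (3 * D). \<bar>V x - V y\<bar> \<le> \<eta>) \<longrightarrow>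
     (\<alpha> < 0 \<longrightarrow> (\<forall>x\<in>ball xs (3 * D). \<kappa> \<le> (\<epsilon>\<^sup>2 + (norm x)\<^sup>2) powr \<alpha>)) \<longrightarrow>
     green_on (ball xs (3 * D)) v (\<lambda>x. (\<epsilon>\<^sup>2 + (norm x)\<^sup>2) powr \<alpha> * V x * exp (v x)) \<longrightarrow>
     (\<forall>x\<in>ball xs (3 * D). l \<le> v x) \<longrightarrow> v xs + C1 * l \<le> C2)"

text \<open>For v xs below a threshold the claim follows from l \<le> v xs. Otherwise a peak x0 is
  selected, and the cases are whether its distance m to the pole is at least \<open>N1\<close>
  regular scales or not. In either case the scale is at most k e, with e = exp (- v x0 / (2
  \<gamma>)), so the blow-up disc fits where v is controlled, and the mass found there pulls the
  infimum down.\<close>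

lemma local_estimate:
  fixes a b \<alpha>0 C1 :: real
  assumes ab: "0 < a" "a \<le> b" and \<alpha>0: "-1 < \<alpha>0" "\<alpha>0 < 1" and C1: "C1 > max 1 ((1 + \<alpha>0) / (1 - \<alpha>0))"
  shows "\<exists>\<eta>>0. \<forall>D>0. \<forall>\<kappa>>0. \<exists>C2>0. estimate_constant a b \<alpha>0 C1 \<eta> D \<kappa> C2"
proof -
  have C1': "1 < C1" using C1 by simp
  obtain t where t: "0 < t" "t < 1" "max 0 (-\<alpha>0) + t < 1" "\<alpha>0 + t \<le> 1" "-1 < \<alpha>0 - t"
    "(1 + \<alpha>0 + t) * (1 + 1 / C1) \<le> 2 * ((1 - (max 0 (-\<alpha>0) + t)) * (1 - t))"
    "1 + 1 / C1 \<le> 2 * (1 - t)"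
    by (rule exponent_choice[OF \<alpha>0 C1])
  \<comment> \<open>The slack t makes - \<beta> \<le> \<alpha> hold for every \<alpha> within \<eta>
    of \<alpha>0.\<close>
  define \<beta> where "\<beta> = max 0 (-\<alpha>0) + t"
  have \<beta>: "0 \<le> \<beta>" "\<beta> < 1" using t by (auto simp: \<beta>_def)
  have pi8: "8 * pi * x / (2 * pi) = 4 * x" for x :: real by simp
  obtain L1 N1 \<theta>1 where L1: "0 < L1" and N1: "1 \<le> N1" and \<theta>1: "0 < \<theta>1" and
    reg0: "\<forall>\<epsilon> \<alpha> V v x0 S \<delta>. 0 < \<epsilon> \<longrightarrow> \<bar>\<alpha>\<bar> \<le> 1 \<longrightarrow>
      \<delta> = exp (- v x0 / 2) * pole_dist \<epsilon> x0 powr (-\<alpha>) \<longrightarrow> N1 * \<delta> \<le> pole_dist \<epsilon> x0 \<longrightarrow>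
      cball x0 (\<delta> * L1) \<subseteq> S \<longrightarrow> continuous_on S v \<longrightarrow> continuous_on S V \<longrightarrow>
      (\<forall>x\<in>S. a \<le> V x \<and> V x \<le> b) \<longrightarrow> (\<forall>x\<in>S. \<forall>y\<in>S. V x \<le> (1 + \<theta>1) * V y) \<longrightarrow>
      (\<forall>y\<in>ball x0 (\<delta> * L1). v y \<le> v x0 + 4) \<longrightarrow>
      green_on S v (\<lambda>x. (\<epsilon>\<^sup>2 + (norm x)\<^sup>2) powr \<alpha> * V x * exp (v x)) \<longrightarrow>
      8 * pi * (1 - t) \<le>
        (\<integral>y. indicator (ball x0 (\<delta> * L1)) y * ((\<epsilon>\<^sup>2 + (norm y)\<^sup>2) powr \<alpha> * V y * exp (v y)) \<partial>lborel)"
    using concentration_regular[OF ab t(1,2)] by (elim exE conjE) (rule that)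
  note reg = reg0[THEN spec, THEN spec, THEN spec, THEN spec, THEN spec, THEN spec, THEN spec, THEN mp, THEN mp, THEN mp, THEN mp, THEN mp, THEN mp, THEN mp, THEN mp, THEN mp, THEN mp, THEN mp]
  define \<alpha>m where "\<alpha>m = 1 + \<alpha>0 - t"
  have \<alpha>m: "0 < \<alpha>m" using t by (simp add: \<alpha>m_def)
  \<comment> \<open>Failure of the regular case means m^(1 + \<alpha>) < N1 \<delta>2^(1 +
    \<alpha>). Taking roots bounds m by a multiple of \<delta>2, uniformly because 1 + \<alpha> is
    at least \<open>\<alpha>m\<close>.\<close>
  define N2 where "N2 = N1 powr (1 / \<alpha>m)"
  have N2: "1 \<le> N2" unfolding N2_def using N1 \<alpha>m by (intro ge_one_powr_ge_zero) auto
  obtain L2 \<theta>2 where L2: "N2 + 1 < L2" and \<theta>2: "0 < \<theta>2" and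
    sing0: "\<forall>\<epsilon> \<alpha> V v x0 S \<delta>. 0 < \<epsilon> \<longrightarrow> - \<beta> \<le> \<alpha> \<longrightarrow> \<alpha> \<le> 1 \<longrightarrow>
      \<delta> = exp (- v x0 / (2 + 2 * \<alpha>)) \<longrightarrow> pole_dist \<epsilon> x0 \<le> N2 * \<delta> \<longrightarrow>
      cball 0 (\<delta> * L2) \<subseteq> S \<longrightarrow> continuous_on S v \<longrightarrow> continuous_on S V \<longrightarrow>
      (\<forall>x\<in>S. a \<le> V x \<and> V x \<le> b) \<longrightarrow> (\<forall>x\<in>S. \<forall>y\<in>S. V x \<le> (1 + \<theta>2) * V y) \<longrightarrow>
      (\<forall>y\<in>ball 0 (\<delta> * L2). v y \<le> v x0 + 4) \<longrightarrow>
      green_on S v (\<lambda>x. (\<epsilon>\<^sup>2 + (norm x)\<^sup>2) powr \<alpha> * V x * exp (v x)) \<longrightarrow>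
      8 * pi * ((1 - \<beta>) * (1 - t)) \<le>
        (\<integral>y. indicator (ball 0 (\<delta> * L2)) y * ((\<epsilon>\<^sup>2 + (norm y)\<^sup>2) powr \<alpha> * V y * exp (v y)) \<partial>lborel)"
    using concentration_singular[OF ab \<beta> t(1,2) N2] by (elim exE conjE) (rule that)
  note sing = sing0[THEN spec, THEN spec, THEN spec, THEN spec, THEN spec, THEN spec, THEN spec, THEN mp, THEN mp, THEN mp, THEN mp, THEN mp, THEN mp, THEN mp, THEN mp, THEN mp, THEN mp, THEN mp, THEN mp]
  \<comment> \<open>Since V \<ge> a, an absolute oscillation of at most a \<theta> is a relative one
    of at most \<theta>.\<close>
  define \<eta> where "\<eta> = min t (a * min \<theta>1 \<theta>2)"
  have \<eta>: "0 < \<eta>" "\<eta> \<le> t" "\<eta> \<le> a * \<theta>1" "\<eta> \<le> a * \<theta>2"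
    using t ab \<theta>1 \<theta>2 by (auto simp: \<eta>_def min_le_iff_disj min_mult_distrib_left)
  show ?thesis
  proof (rule exI[of _ \<eta>], intro conjI allI impI)
    show "0 < \<eta>" by (rule \<eta>)
    fix D \<kappa> :: real assume D: "0 < D" and \<kappa>: "0 < \<kappa>"
    \<comment> \<open>The multiple of the scale that contains every blow-up disc as seen from x0:
      \<open>L1\<close> if it is centred at x0, N2 + L2 if it is centred at the origin.\<close>
    define K0 where "K0 = L1 + N2 + L2"
    have K0: "0 < K0" "L1 \<le> K0" "L2 \<le> K0" "N2 + L2 \<le> K0" using L1 L2 N2 by (auto simp: K0_def)
    \<comment> \<open>Compensates the weight for \<alpha> < 0, when the regular scale carries the
      factor m^(-\<alpha>) \<le> \<kappa>^(-1/2).\<close>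
    define k where "k = 1 + \<kappa> powr (-(1/2))"
    have k: "1 \<le> k" by (simp add: k_def)
    \<comment> \<open>The threshold for v xs above which the selected disc has radius at least 2 K0
      k e; the divisor 4 covers 2 \<gamma> \<le> 4.\<close>
    define \<Lambda> where "\<Lambda> = 4 * max 0 (ln (2 * K0 * k / D))"
    have \<Lambda>0: "0 \<le> \<Lambda>" by (simp add: \<Lambda>_def)
    have \<Lambda>1: "2 * K0 * k \<le> exp (\<Lambda> / 4) * D"
    proof -
      have "2 * K0 * k / D = exp (ln (2 * K0 * k / D))" using K0 k D by simp
      also have "\<dots> \<le> exp (\<Lambda> / 4)" by (simp add: \<Lambda>_def)
      finally show ?thesis using D by (simp add: divide_le_eq)
    qed
    \<comment> \<open>Collects the constants of ln (D / (r K0)) - 1/2 at r = k e, which is then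
      exactly v x0 / (2 \<gamma>) - B.\<close>
    define B where "B = ln K0 + ln k - ln D + 1 / 2"
    define C2 where "C2 = 1 + (1 + C1) * \<Lambda> + 4 * C1 * \<bar>B\<bar>"
    show "\<exists>C2>0. estimate_constant a b \<alpha>0 C1 \<eta> D \<kappa> C2"
      unfolding estimate_constant_def
    proof (rule exI[of _ C2], intro conjI allI impI)
      show "0 < C2" using \<Lambda>0 C1' by (auto simp: C2_def intro!: add_pos_nonneg)
      fix \<epsilon> \<alpha> :: real and V v :: "real^2 \<Rightarrow> real" and xs :: "real^2" and l :: real
      define S where "S = ball xs (3 * D)"
      define f where "f x = (\<epsilon>\<^sup>2 + (norm x)\<^sup>2) powr \<alpha> * V x * exp (v x)" for x
      assume \<epsilon>: "0 < \<epsilon>" and \<alpha>\<eta>: "\<bar>\<alpha> - \<alpha>0\<bar> < \<eta>" and "continuous_on (ball xs (3 * D)) v"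
        and "continuous_on (ball xs (3 * D)) V" and "\<forall>x\<in>ball xs (3 * D). a \<le> V x \<and> V x \<le> b"
        and "\<forall>x\<in>ball xs (3 * D). \<forall>y\<in>ball xs (3 * D). \<bar>V x - V y\<bar> \<le> \<eta>"
        and "\<alpha> < 0 \<longrightarrow> (\<forall>x\<in>ball xs (3 * D). \<kappa> \<le> (\<epsilon>\<^sup>2 + (norm x)\<^sup>2) powr \<alpha>)"
        and "green_on (ball xs (3 * D)) v (\<lambda>x. (\<epsilon>\<^sup>2 + (norm x)\<^sup>2) powr \<alpha> * V x * exp (v x))"
        and "\<forall>x\<in>ball xs (3 * D). l \<le> v x"
      then have cv: "continuous_on S v" and cV: "continuous_on S V"
        and Vab: "\<forall>x\<in>S. a \<le> V x \<and> V x \<le> b" and Vo: "\<forall>x\<in>S. \<forall>y\<in>S. \<bar>V x - V y\<bar> \<le> \<eta>"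
        and lo: "\<And>x. \<alpha> < 0 \<Longrightarrow> x \<in> S \<Longrightarrow> \<kappa> \<le> (\<epsilon>\<^sup>2 + (norm x)\<^sup>2) powr \<alpha>"
        and gr: "green_on S v (\<lambda>x. (\<epsilon>\<^sup>2 + (norm x)\<^sup>2) powr \<alpha> * V x * exp (v x))"
        and l: "\<And>x. x \<in> S \<Longrightarrow> l \<le> v x"
        unfolding S_def by blast+
      have \<alpha>: "\<bar>\<alpha>\<bar> \<le> 1" "- \<beta> \<le> \<alpha>" "\<alpha> \<le> \<alpha>0 + t" "\<alpha>m \<le> 1 + \<alpha>"
        using \<alpha>\<eta> \<eta>(2) t unfolding \<beta>_def \<alpha>m_def abs_le_iff abs_less_iff by auto
      have osc: "\<forall>x\<in>S. \<forall>y\<in>S. V x \<le> (1 + \<theta>) * V y" if "\<eta> \<le> a * \<theta>" "0 < \<theta>" for \<theta>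
      proof (intro ballI)
        fix x y assume x: "x \<in> S" and y: "y \<in> S"
        have "V x \<le> V y + \<eta>" using Vo x y by force
        also have "\<eta> \<le> V y * \<theta>" using that Vab y by (meson mult_right_mono order_trans less_imp_le)
        finally show "V x \<le> (1 + \<theta>) * V y" by (simp add: algebra_simps)
      qed
      have V0: "0 \<le> V y" if "y \<in> S" for y using Vab that ab by force
      have pne: "\<epsilon>\<^sup>2 + (norm x)\<^sup>2 \<noteq> 0" for x :: "real^2" using \<epsilon> by (simp add: add_nonneg_eq_0_iff)
      have cf: "continuous_on S f" unfolding f_def[abs_def]
        by (intro continuous_intros cv cV) (use pne in auto)
      have fnn: "0 \<le> f y" if "y \<in> S" for y using V0[OF that] by (simp add: f_def)
      have gr': "green_on S v f" using gr by (simp add: f_def[abs_def])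
      have xsS: "xs \<in> S" using D by (simp add: S_def)
      show "v xs + C1 * l \<le> C2"
      proof (cases "v xs \<le> \<Lambda>")
        case True
        have "C1 * l \<le> C1 * \<Lambda>" using l[OF xsS] True C1' by (intro mult_left_mono) auto
        moreover have "0 \<le> 4 * C1 * \<bar>B\<bar>" using C1' by simp
        ultimately show ?thesis using True unfolding C2_def by (simp add: distrib_right)
      next
        case False
        \<comment> \<open>Fits the largest scale that can occur: exp (- v x0 / (2 + 2 \<alpha>)) for
          \<alpha> \<ge> 0, and a multiple of exp (- v x0 / 2) for \<alpha> < 0.\<close>
        define \<gamma> where "\<gamma> = 1 + max \<alpha> 0"
        have \<gamma>: "1 \<le> \<gamma>" "\<gamma> \<le> 2" using \<alpha>(1) unfolding \<gamma>_def by linarith+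
        have subD: "cball xs D \<subseteq> S" using D by (auto simp: S_def)
        obtain x0 \<rho>0 where \<rho>0: "0 < \<rho>0" "\<rho>0 \<le> D" "dist x0 xs = D - \<rho>0" and vx0: "v xs \<le> v x0"
          and \<rho>lo: "exp ((v xs - v x0) / (2 * \<gamma>)) * D \<le> \<rho>0"
          and vle: "\<And>y. y \<in> cball x0 (\<rho>0 / 2) \<Longrightarrow> v y \<le> v x0 + 4"
          by (rule peak_selection[OF D continuous_on_subset[OF cv subD] \<gamma>]) (rule that)
        have v0: "0 \<le> v x0" using vx0 False \<Lambda>0 by linarith
        have subx: "cball x0 D \<subseteq> S"
        proof
          fix y assume "y \<in> cball x0 D"
          then show "y \<in> S" using dist_triangle[of xs y x0] \<rho>0 D by (simp add: S_def dist_commute)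
        qed
        have x0S: "x0 \<in> S" using subx D by auto
        define e where "e = exp (- v x0 / (2 * \<gamma>))"
        have e0: "0 < e" by (simp add: e_def)
        have room: "2 * K0 * (k * e) \<le> \<rho>0"
        proof -
          have "\<Lambda> / 4 \<le> v xs / (2 * \<gamma>)"
          proof -
            have "\<Lambda> / 4 \<le> v xs / 4" using False by simp
            also have "\<dots> \<le> v xs / (2 * \<gamma>)" using \<gamma> False \<Lambda>0 by (intro divide_left_mono) auto
            finally show ?thesis .
          qed
          then have "2 * K0 * k \<le> exp (v xs / (2 * \<gamma>)) * D"
            using \<Lambda>1 D by (meson exp_le_cancel_iff less_imp_le mult_right_mono order_trans)
          then have "2 * K0 * k * e \<le> exp (v xs / (2 * \<gamma>)) * D * e" using e0 by (intro mult_right_mono) auto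
          also have "\<dots> = exp ((v xs - v x0) / (2 * \<gamma>)) * D"
          proof -
            have "(v xs - v x0) / (2 * \<gamma>) = v xs / (2 * \<gamma>) + - v x0 / (2 * \<gamma>)"
              by (simp only: add_divide_distrib[symmetric]) simp
            then have "exp ((v xs - v x0) / (2 * \<gamma>)) = exp (v xs / (2 * \<gamma>)) * e"
              by (simp only: e_def exp_add)
            then show ?thesis by (simp only: mult_ac)
          qed
          finally show ?thesis using \<rho>lo by (simp add: mult_ac)
        qed
        define m where "m = pole_dist \<epsilon> x0"
        have m: "0 < m" using \<epsilon> by (simp add: m_def pole_dist_pos)
        define \<delta>1 where "\<delta>1 = exp (- v x0 / 2) * m powr (-\<alpha>)"
        define \<delta>2 where "\<delta>2 = exp (- v x0 / (2 + 2 * \<alpha>))"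
        have \<delta>: "0 < \<delta>1" "0 < \<delta>2" using m by (auto simp: \<delta>1_def \<delta>2_def)
        have a1: "0 < 1 + \<alpha>" using \<alpha> \<alpha>m by linarith
        have d2pow: "\<delta>2 powr (1 + \<alpha>) = exp (- v x0 / 2)"
        proof -
          have "- v x0 / (2 + 2 * \<alpha>) * (1 + \<alpha>) = - v x0 / 2"
          proof -
            have "x / (2 * c) * c = x / 2" if "0 < c" for x c :: real using that by simp
            from this[OF a1, of "- v x0"] show ?thesis by (simp only: distrib_left mult_1_right)
          qed
          then show ?thesis unfolding \<delta>2_def by (simp add: exp_powr_real)
        qed
        have scale: "r * K0 \<le> \<rho>0 / 2" "ln (D / (r * K0)) - 1 / 2 \<ge> - ln r + ln k - B" if "0 < r" "r \<le> k * e" for r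
        proof -
          have "r * K0 \<le> k * e * K0" using that K0 by (intro mult_right_mono) auto
          then show "r * K0 \<le> \<rho>0 / 2" using room by (simp add: mult_ac)
          show "ln (D / (r * K0)) - 1 / 2 \<ge> - ln r + ln k - B"
            using that D K0 by (simp add: B_def ln_div ln_mult)
        qed
        show ?thesis
        proof (cases "N1 * \<delta>1 \<le> m")
          case True
          have "\<delta>1 \<le> N1 * \<delta>1" using N1 \<delta> mult_right_mono[of 1 N1 \<delta>1] by simp
          then have dm: "\<delta>1 \<le> m" using True by linarith
          have d1: "\<delta>1 \<le> k * e"
          proof (cases "0 \<le> \<alpha>")
            case True
            \<comment> \<open>For \<alpha> \<ge> 0 the regular scale grows as the pole approaches.
              In this case, however, m is at least \<delta>1, which forces m \<ge> \<delta>2, and at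
              m = \<delta>2 both scales agree.\<close>
            have "exp (- v x0 / 2) \<le> m powr (1 + \<alpha>)"
            proof -
              have "exp (- v x0 / 2) = \<delta>1 * m powr \<alpha>" using m by (simp add: \<delta>1_def mult.assoc flip: powr_add)
              also have "\<dots> \<le> m * m powr \<alpha>" using dm by (intro mult_right_mono) auto
              finally show ?thesis using m by (simp add: powr_add)
            qed
            then have "\<delta>2 powr (1 + \<alpha>) \<le> m powr (1 + \<alpha>)" by (simp only: d2pow)
            then have "\<delta>2 \<le> m" using powr_less_mono2[OF a1, of m \<delta>2] m by linarith
            then have "m powr (-\<alpha>) \<le> \<delta>2 powr (-\<alpha>)" using True \<delta> by (intro powr_mono2') auto
            then have "\<delta>1 \<le> \<delta>2 powr (1 + \<alpha>) * \<delta>2 powr (-\<alpha>)"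
              unfolding \<delta>1_def d2pow by (intro mult_left_mono) auto
            also have "\<dots> = \<delta>2" using \<delta> by (simp flip: powr_add)
            also have "\<delta>2 = e" unfolding \<delta>2_def e_def \<gamma>_def using True by simp
            also have "1 * e \<le> k * e" using k e0 by (intro mult_right_mono) auto
            finally show ?thesis by simp
          next
            case False
            have "\<kappa> \<le> (m\<^sup>2) powr \<alpha>" using lo[OF _ x0S] False by (simp add: m_def pole_dist_sq)
            also have "\<dots> = m powr (2 * \<alpha>)" using power2_powr_half[of m "2 * \<alpha>"] m by simp
            finally have "(m powr (2 * \<alpha>)) powr (-(1/2)) \<le> \<kappa> powr (-(1/2))" using \<kappa> by (intro powr_mono2') auto
            then have "m powr (-\<alpha>) \<le> \<kappa> powr (-(1/2))" by (simp add: powr_powr)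
            then have "m powr (-\<alpha>) \<le> k" by (simp add: k_def)
            moreover have "e = exp (- v x0 / 2)" using False by (simp add: e_def \<gamma>_def)
            ultimately show ?thesis using e0 by (simp add: \<delta>1_def mult.commute)
          qed
          have half: "\<delta>1 * K0 \<le> \<rho>0 / 2" by (rule scale(1)[OF \<delta>(1) d1])
          have dL: "\<delta>1 * L1 \<le> \<delta>1 * K0" using K0 \<delta> by (intro mult_left_mono) auto
          have mass: "8 * pi * (1 - t) \<le> (\<integral>y. indicator (ball x0 (\<delta>1 * L1)) y * f y \<partial>lborel)"
            unfolding f_def
          proof (rule reg[OF \<epsilon> \<alpha>(1) _ _ _ cv cV Vab osc[OF \<eta>(3) \<theta>1] _ gr])
            show "\<delta>1 = exp (- v x0 / 2) * pole_dist \<epsilon> x0 powr - \<alpha>" by (simp add: \<delta>1_def m_def)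
            show "N1 * \<delta>1 \<le> pole_dist \<epsilon> x0" using True by (simp add: m_def)
            show "cball x0 (\<delta>1 * L1) \<subseteq> S" using subx dL half \<rho>0 by (auto simp: subset_eq)
            show "\<forall>y\<in>ball x0 (\<delta>1 * L1). v y \<le> v x0 + 4" using vle dL half by auto
          qed
          have "l \<le> v x0 - 8 * pi * (1 - t) / (2 * pi) * (ln (D / (\<delta>1 * K0)) - 1 / 2)"
          proof (rule infimum_bound[OF gr' cv cf fnn D subx l _ _ _ _ mass])
            show "0 < \<delta>1 * K0" "\<delta>1 * K0 < D" using \<delta> K0 half \<rho>0 by auto
            show "ball x0 (\<delta>1 * L1) \<subseteq> cball x0 (\<delta>1 * K0)" using dL by auto
          qed (use t in auto)
          also have "\<dots> \<le> v x0 - 4 * (1 - t) * (1 / (2 * \<gamma>) * v x0 - B)"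
          proof -
            have "ln \<delta>1 \<le> ln (k * e)" using d1 \<delta> by (intro ln_mono) auto
            also have "\<dots> = ln k - v x0 / (2 * \<gamma>)" using k e0 by (simp add: ln_mult e_def)
            finally have "1 / (2 * \<gamma>) * v x0 - B \<le> ln (D / (\<delta>1 * K0)) - 1 / 2"
              using scale(2)[OF \<delta>(1) d1] by simp
            then have "4 * (1 - t) * (1 / (2 * \<gamma>) * v x0 - B) \<le> 4 * (1 - t) * (ln (D / (\<delta>1 * K0)) - 1 / 2)"
              using t by (intro mult_left_mono) auto
            then show ?thesis by (simp only: pi8 diff_left_mono)
          qed
          finally have lb: "l \<le> v x0 - 4 * (1 - t) * (1 / (2 * \<gamma>) * v x0 - B)" .
          have "1 + 1 / C1 \<le> 4 * (1 - t) * (1 / (2 * \<gamma>))"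
          proof -
            \<comment> \<open>The mass is close to 8 pi here, but for \<alpha> > 0 the scale may be
              as large as exp (- v x0 / (2 + 2 \<alpha>)). So this case, too, relies on the bound C1
              > (1 + \<alpha>0)/(1 - \<alpha>0) when \<alpha>0 is positive.\<close>
            have "\<gamma> * (1 + 1 / C1) \<le> 2 * (1 - t)"
            proof (cases "0 \<le> \<alpha>")
              case True
              have "\<gamma> * (1 + 1 / C1) \<le> (1 + \<alpha>0 + t) * (1 + 1 / C1)"
                using True \<alpha>(3) C1' by (intro mult_right_mono) (auto simp: \<gamma>_def)
              also have "\<dots> \<le> 2 * ((1 - \<beta>) * (1 - t))" using t(6) by (simp add: \<beta>_def)
              also have "\<dots> \<le> 2 * (1 * (1 - t))" using \<beta> t by (intro mult_left_mono mult_right_mono) auto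
              finally show ?thesis by simp
            next
              case False
              then show ?thesis using t(7) by (simp add: \<gamma>_def)
            qed
            then have "1 + 1 / C1 \<le> 2 * (1 - t) / \<gamma>" using \<gamma> by (simp add: pos_le_divide_eq mult.commute)
            also have "\<dots> = 4 * (1 - t) * (1 / (2 * \<gamma>))"
            proof -
              have "2 * x / c = 4 * x * (1 / (2 * c))" for x c :: real by simp
              then show ?thesis .
            qed
            finally show ?thesis .
          qed
          from final_arithmetic[OF vx0 v0 _ lb this] have "v xs + C1 * l \<le> 4 * C1 * \<bar>B\<bar>" using C1' t by auto
          moreover have "0 \<le> (1 + C1) * \<Lambda>" using C1' \<Lambda>0 by simp
          ultimately show ?thesis by (simp add: C2_def)
        next
          case False
          have mN: "m \<le> N2 * \<delta>2"
          proof -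
            have "m powr (1 + \<alpha>) \<le> N1 * \<delta>2 powr (1 + \<alpha>)"
            proof -
              have "m powr (1 + \<alpha>) = m * m powr \<alpha>" using m by (simp add: powr_add)
              also have "\<dots> \<le> (N1 * \<delta>1) * m powr \<alpha>" using False by (intro mult_right_mono) auto
              also have "\<dots> = N1 * exp (- v x0 / 2)" using m by (simp add: \<delta>1_def mult.assoc flip: powr_add)
              finally show ?thesis by (simp only: d2pow)
            qed
            then have "(m powr (1 + \<alpha>)) powr (1 / (1 + \<alpha>)) \<le> (N1 * \<delta>2 powr (1 + \<alpha>)) powr (1 / (1 + \<alpha>))"
              using a1 by (intro powr_mono2) auto
            then have "m \<le> N1 powr (1 / (1 + \<alpha>)) * \<delta>2"
              using a1 m \<delta> by (simp add: powr_powr powr_mult)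
            also have "\<dots> \<le> N2 * \<delta>2"
              unfolding N2_def using N1 \<alpha>(4) \<alpha>m \<delta> a1
              by (intro mult_right_mono powr_mono frac_le) auto
            finally show ?thesis .
          qed
          have d2: "\<delta>2 \<le> k * e"
          proof -
            have "\<delta>2 \<le> e"
            proof -
              have "v x0 / (2 * \<gamma>) \<le> v x0 / (2 + 2 * \<alpha>)"
                using v0 a1 \<gamma> by (intro divide_left_mono) (auto simp: \<gamma>_def)
              then show ?thesis by (simp add: \<delta>2_def e_def)
            qed
            also have "1 * e \<le> k * e" using k e0 by (intro mult_right_mono) auto
            finally show ?thesis by simp
          qed
          have half: "\<delta>2 * K0 \<le> \<rho>0 / 2" by (rule scale(1)[OF \<delta>(2) d2])
          have nx0: "norm x0 \<le> N2 * \<delta>2" using mN norm_le_pole_dist(1)[of x0 \<epsilon>] by (simp add: m_def)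
          have sub0: "cball 0 (\<delta>2 * L2) \<subseteq> cball x0 (\<delta>2 * K0)"
          proof
            fix y :: "real^2" assume "y \<in> cball 0 (\<delta>2 * L2)"
            then have "dist x0 y \<le> N2 * \<delta>2 + \<delta>2 * L2"
              using nx0 dist_triangle[of x0 y 0] by simp
            also have "\<dots> = \<delta>2 * (N2 + L2)" by (simp add: algebra_simps)
            also have "\<dots> \<le> \<delta>2 * K0" using K0 \<delta> by (intro mult_left_mono) auto
            finally show "y \<in> cball x0 (\<delta>2 * K0)" by simp
          qed
          have subh: "cball x0 (\<delta>2 * K0) \<subseteq> cball x0 (\<rho>0 / 2)" using half by auto
          have mass: "8 * pi * ((1 - \<beta>) * (1 - t)) \<le> (\<integral>y. indicator (ball 0 (\<delta>2 * L2)) y * f y \<partial>lborel)"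
            unfolding f_def
          proof (rule sing[OF \<epsilon> \<alpha>(2) _ \<delta>2_def _ _ cv cV Vab osc[OF \<eta>(4) \<theta>2] _ gr])
            show "\<alpha> \<le> 1" using \<alpha>(1) by (simp add: abs_le_iff)
            show "pole_dist \<epsilon> x0 \<le> N2 * \<delta>2" using mN by (simp add: m_def)
            have "cball x0 (\<rho>0 / 2) \<subseteq> cball x0 D" using \<rho>0 by auto
            then show "cball 0 (\<delta>2 * L2) \<subseteq> S" using sub0 subh subx by blast
            show "\<forall>y\<in>ball 0 (\<delta>2 * L2). v y \<le> v x0 + 4" using vle sub0 subh ball_subset_cball by blast
          qed
          have "l \<le> v x0 - 8 * pi * ((1 - \<beta>) * (1 - t)) / (2 * pi) * (ln (D / (\<delta>2 * K0)) - 1 / 2)"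
          proof (rule infimum_bound[OF gr' cv cf fnn D subx l _ _ _ _ mass])
            show "0 < \<delta>2 * K0" "\<delta>2 * K0 < D" using \<delta> K0 half \<rho>0 by auto
            show "ball 0 (\<delta>2 * L2) \<subseteq> cball x0 (\<delta>2 * K0)" using sub0 ball_subset_cball by blast
          qed (use t \<beta> in auto)
          also have "\<dots> \<le> v x0 - 4 * ((1 - \<beta>) * (1 - t)) * (1 / (2 + 2 * \<alpha>) * v x0 - B)"
          proof -
            have "1 / (2 + 2 * \<alpha>) * v x0 - B \<le> ln (D / (\<delta>2 * K0)) - 1 / 2"
              using scale(2)[OF \<delta>(2) d2] k by (simp add: \<delta>2_def ln_ge_zero) (smt (verit) k ln_ge_zero)
            then have "4 * ((1 - \<beta>) * (1 - t)) * (1 / (2 + 2 * \<alpha>) * v x0 - B) \<le> 4 * ((1 - \<beta>) * (1 - t)) * (ln (D / (\<delta>2 * K0)) - 1 / 2)"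
              using t \<beta> by (intro mult_left_mono) auto
            then show ?thesis by (simp only: pi8 diff_left_mono)
          qed
          finally have lb: "l \<le> v x0 - 4 * ((1 - \<beta>) * (1 - t)) * (1 / (2 + 2 * \<alpha>) * v x0 - B)" .
          have "1 + 1 / C1 \<le> 4 * ((1 - \<beta>) * (1 - t)) * (1 / (2 + 2 * \<alpha>))"
          proof -
            have "(1 + \<alpha>) * (1 + 1 / C1) \<le> (1 + \<alpha>0 + t) * (1 + 1 / C1)"
              using \<alpha>(3) C1' by (intro mult_right_mono) auto
            also have "\<dots> \<le> 2 * ((1 - \<beta>) * (1 - t))" using t(6) by (simp add: \<beta>_def)
            finally have "1 + 1 / C1 \<le> 2 * ((1 - \<beta>) * (1 - t)) / (1 + \<alpha>)" using a1 by (simp add: pos_le_divide_eq mult.commute)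
            also have "\<dots> = 4 * ((1 - \<beta>) * (1 - t)) * (1 / (2 + 2 * \<alpha>))"
            proof -
              have "2 * X / c = 4 * X * (1 / (2 * c))" for X c :: real by simp
              from this[of "(1 - \<beta>) * (1 - t)" "1 + \<alpha>"] show ?thesis by (simp only: distrib_left mult_1_right)
            qed
            finally show ?thesis .
          qed
          moreover have "0 \<le> (1 - \<beta>) * (1 - t)" "(1 - \<beta>) * (1 - t) \<le> 1" using \<beta> t by (auto intro!: mult_le_one)
          ultimately have "v xs + C1 * l \<le> 4 * C1 * \<bar>B\<bar>"
            using final_arithmetic[OF vx0 v0 _ lb] C1' by auto
          moreover have "0 \<le> (1 + C1) * \<Lambda>" using C1' \<Lambda>0 by simp
          ultimately show ?thesis by (simp add: C2_def)
        qed
      qed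
    qed
  qed
qed

section \<open>Passing from small discs to a compact set\<close>

definition thicken :: "real \<Rightarrow> 'a::real_normed_vector set \<Rightarrow> 'a set" where
  "thicken r K = {x + y |x y. x \<in> K \<and> y \<in> cball 0 r}"

lemma compact_thicken: "compact (K :: 'a::euclidean_space set) \<Longrightarrow> compact (thicken r K)"
  unfolding thicken_def by (rule compact_sums) auto

lemma cball_subset_thicken: "x \<in> K \<Longrightarrow> cball x r \<subseteq> thicken r K"
proof
  fix y assume "x \<in> K" "y \<in> cball x r"
  then have "y = x + (y - x)" "y - x \<in> cball 0 r" by (auto simp: dist_norm norm_minus_commute)
  then show "y \<in> thicken r K" using \<open>x \<in> K\<close> unfolding thicken_def by blast
qed

text \<open>A closed ball that meets both \<Omega> and its complement meets the frontier, because it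
  is connected; that would put a frontier point within r of K.\<close>

lemma cball_subset_domain:
  fixes \<Omega> :: "'a::euclidean_space set"
  assumes K: "K \<subseteq> \<Omega>" and r: "r < setdist K (frontier \<Omega>)" and x: "x \<in> K"
  shows "cball x r \<subseteq> \<Omega>"
proof (cases "0 \<le> r")
  case True
  show ?thesis
  proof (rule ccontr)
    assume "\<not> cball x r \<subseteq> \<Omega>"
    then have "cball x r - \<Omega> \<noteq> {}" by blast
    moreover have "x \<in> cball x r \<inter> \<Omega>" using K x True by auto
    then have "cball x r \<inter> \<Omega> \<noteq> {}" by blast
    ultimately have "cball x r \<inter> frontier \<Omega> \<noteq> {}"
      by (intro connected_Int_frontier convex_connected convex_cball)
    then obtain z where z: "z \<in> cball x r" "z \<in> frontier \<Omega>" by blast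
    have "setdist K (frontier \<Omega>) \<le> dist x z" by (rule setdist_le_dist[OF x z(2)])
    then show False using z r by simp
  qed
qed simp

lemma thicken_subset_domain:
  fixes \<Omega> :: "'a::euclidean_space set"
  assumes "K \<subseteq> \<Omega>" "r < setdist K (frontier \<Omega>)"
  shows "thicken r K \<subseteq> \<Omega>"
proof
  fix z assume "z \<in> thicken r K"
  then obtain x y where "x \<in> K" "y \<in> cball 0 r" "z = x + y" by (auto simp: thicken_def)
  then have "z \<in> cball x r" by (simp add: dist_norm)
  then show "z \<in> \<Omega>" using cball_subset_domain[OF assms \<open>x \<in> K\<close>] by blast
qed

lemma setdist_frontier_pos:
  fixes \<Omega> :: "'a::euclidean_space set"
  assumes "open \<Omega>" "bounded \<Omega>" "compact K" "K \<subseteq> \<Omega>" "K \<noteq> {}"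
  shows "0 < setdist K (frontier \<Omega>)"
proof -
  have "frontier \<Omega> \<noteq> {}" using assms by (auto simp: frontier_eq_empty)
  moreover have "K \<inter> frontier \<Omega> = {}" using assms by (auto simp: frontier_def interior_open)
  ultimately show ?thesis using assms by (simp add: setdist_gt_0_compact_closed)
qed

text \<open>Uniform continuity on the closed neighbourhood of K whose radius is half the distance to
  the frontier, which is compact and still contained in \<Omega>. The 6 in the choice of D turns two
  radii 3 D into at most \<delta>.\<close>

lemma small_oscillation:
  fixes h :: "real^2 \<Rightarrow> real"
  assumes K: "compact K" "K \<subseteq> \<Omega>" and d: "0 < setdist K (frontier \<Omega>)"
    and h: "\<And>T. compact T \<Longrightarrow> T \<subseteq> \<Omega> \<Longrightarrow> continuous_on T h" and e: "0 < e"
  obtains D where "0 < D" "3 * D < setdist K (frontier \<Omega>)"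
    "\<And>xs x y. xs \<in> K \<Longrightarrow> x \<in> ball xs (3 * D) \<Longrightarrow> y \<in> ball xs (3 * D) \<Longrightarrow> \<bar>h x - h y\<bar> \<le> e"
proof -
  define d where "d = setdist K (frontier \<Omega>)"
  define T where "T = thicken (d / 2) K"
  have T: "compact T" "T \<subseteq> \<Omega>"
    using compact_thicken[OF K(1)] thicken_subset_domain[OF K(2), of "d / 2"] d by (auto simp: T_def d_def)
  have "uniformly_continuous_on T h" by (rule compact_uniformly_continuous[OF h[OF T] T(1)])
  then obtain \<delta> where \<delta>: "0 < \<delta>" "\<And>x y. x \<in> T \<Longrightarrow> y \<in> T \<Longrightarrow> dist y x < \<delta> \<Longrightarrow> dist (h y) (h x) < e"
    using e unfolding uniformly_continuous_on_def by metis
  define D where "D = min d \<delta> / 6"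
  have D: "0 < D" "6 * D \<le> d" "6 * D \<le> \<delta>" using d \<delta> by (auto simp: D_def d_def)
  show thesis
  proof (rule that[of D])
    show "0 < D" "3 * D < setdist K (frontier \<Omega>)" using D by (auto simp: d_def)
    fix xs x y assume xs: "xs \<in> K" and x: "x \<in> ball xs (3 * D)" and y: "y \<in> ball xs (3 * D)"
    have "ball xs (3 * D) \<subseteq> T" using cball_subset_thicken[OF xs, of "d / 2"] D unfolding T_def by force
    moreover have "dist x y < \<delta>" using x y D dist_triangle[of x y xs] by (simp add: dist_commute)
    ultimately have "dist (h x) (h y) < e" using \<delta>(2)[of y x] x y by blast
    then show "\<bar>h x - h y\<bar> \<le> e" by (simp add: dist_real_def)
  qed
qed

lemma green_on_subset: "green_on S v f \<Longrightarrow> T \<subseteq> S \<Longrightarrow> green_on T v f"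
  unfolding green_on_def by blast

lemma liouville_green_on:
  assumes sol: "liouville_solution \<Omega> \<epsilon> \<alpha> V v" and V: "continuous_on \<Omega> V" and \<epsilon>: "0 < \<epsilon>"
  shows "continuous_on \<Omega> v" "green_on \<Omega> v (\<lambda>x. (\<epsilon>\<^sup>2 + (norm x)\<^sup>2) powr \<alpha> * V x * exp (v x))"
proof -
  have sp: "solves_poisson \<Omega> v (\<lambda>x. (\<epsilon>\<^sup>2 + (norm x)\<^sup>2) powr \<alpha> * V x * exp (v x))"
    using sol by (simp add: liouville_solution_def)
  then show cv: "continuous_on \<Omega> v" by (simp add: solves_poisson_def)
  have "\<epsilon>\<^sup>2 + (norm x)\<^sup>2 \<noteq> 0" for x :: "real^2" using \<epsilon> by (simp add: add_nonneg_eq_0_iff)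
  then show "green_on \<Omega> v (\<lambda>x. (\<epsilon>\<^sup>2 + (norm x)\<^sup>2) powr \<alpha> * V x * exp (v x))"
    by (intro solves_poisson_green_on[OF sp] continuous_intros cv V) auto
qed

text \<open>If the infimum is minus infinity, so is the sum: v is bounded above on the compact set
  K, and no sum of opposite infinities arises. Otherwise the infimum itself is an admissible
  l.\<close>

lemma sup_plus_inf_le:
  assumes C: "0 < C" and K: "compact K" "K \<subseteq> \<Omega>" and \<Omega>: "\<Omega> \<noteq> {}" and v: "continuous_on \<Omega> v"
    and le: "\<And>x l. x \<in> K \<Longrightarrow> (\<And>y. y \<in> \<Omega> \<Longrightarrow> l \<le> v y) \<Longrightarrow> v x + C * l \<le> C2"
  shows "sup_plus_inf C K \<Omega> v \<le> ereal C2"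
proof -
  define I where "I = (INF x\<in>\<Omega>. ereal (v x))"
  obtain z where "z \<in> \<Omega>" using \<Omega> by blast
  then have Iz: "I \<le> ereal (v z)" unfolding I_def by (rule INF_lower)
  have "bounded (v ` K)"
    using compact_continuous_image[OF continuous_on_subset[OF v K(2)] K(1)] by (rule compact_imp_bounded)
  then obtain B where B: "\<forall>x\<in>K. \<bar>v x\<bar> \<le> B" by (auto simp: bounded_iff)
  have S: "(SUP x\<in>K. ereal (v x)) \<le> ereal B" using B by (intro SUP_least) (auto simp: abs_le_iff)
  show ?thesis
  proof (cases I)
    case (real l)
    have "l \<le> v y" if "y \<in> \<Omega>" for y
    proof -
      have "I \<le> ereal (v y)" unfolding I_def using that by (rule INF_lower)
      then show ?thesis using real by simp
    qed
    then have "v x \<le> C2 - C * l" if "x \<in> K" for x using le[OF that, of l] by fastforce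
    then have "(SUP x\<in>K. ereal (v x)) \<le> ereal (C2 - C * l)" by (intro SUP_least) auto
    then have "(SUP x\<in>K. ereal (v x)) + ereal (C * l) \<le> ereal (C2 - C * l) + ereal (C * l)" by (rule add_right_mono)
    then show ?thesis using real by (simp add: sup_plus_inf_def flip: I_def)
  next
    case PInf
    then show ?thesis using Iz by simp
  next
    case MInf
    then have "ereal C * I = - \<infinity>" using C by simp
    then have "sup_plus_inf C K \<Omega> v = (SUP x\<in>K. ereal (v x)) + - \<infinity>"
      by (simp only: sup_plus_inf_def I_def[symmetric])
    also have "\<dots> = - \<infinity>" using S by (cases "SUP x\<in>K. ereal (v x)") auto
    finally show ?thesis by simp
  qed
qed

lemma liouville_estimate:
  assumes ec: "estimate_constant a b \<alpha>0 C1 \<eta> D \<kappa> C2" and C1: "0 < C1"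
    and \<Omega>: "\<Omega> \<noteq> {}" and K: "compact K" "K \<subseteq> \<Omega>"
    and balls: "\<And>xs. xs \<in> K \<Longrightarrow> ball xs (3 * D) \<subseteq> \<Omega>"
    and \<epsilon>: "0 < \<epsilon>" and \<alpha>: "\<bar>\<alpha> - \<alpha>0\<bar> < \<eta>" and V: "continuous_on \<Omega> V" "\<And>x. x \<in> \<Omega> \<Longrightarrow> a \<le> V x \<and> V x \<le> b"
    and osc: "\<And>xs x y. xs \<in> K \<Longrightarrow> x \<in> ball xs (3 * D) \<Longrightarrow> y \<in> ball xs (3 * D) \<Longrightarrow> \<bar>V x - V y\<bar> \<le> \<eta>"
    and lo: "\<And>x. \<alpha> < 0 \<Longrightarrow> x \<in> \<Omega> \<Longrightarrow> \<kappa> \<le> (\<epsilon>\<^sup>2 + (norm x)\<^sup>2) powr \<alpha>"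
    and sol: "liouville_solution \<Omega> \<epsilon> \<alpha> V v"
  shows "sup_plus_inf C1 K \<Omega> v \<le> ereal C2"
proof (rule sup_plus_inf_le[OF C1 K \<Omega> liouville_green_on(1)[OF sol V(1) \<epsilon>]])
  fix x l assume x: "x \<in> K" and l: "\<And>y. y \<in> \<Omega> \<Longrightarrow> l \<le> v y"
  note sub = balls[OF x]
  show "v x + C1 * l \<le> C2"
  proof (rule ec[unfolded estimate_constant_def, rule_format, OF \<epsilon> \<alpha>])
    show "continuous_on (ball x (3 * D)) v" "continuous_on (ball x (3 * D)) V"
      using liouville_green_on(1)[OF sol V(1) \<epsilon>] V(1) sub continuous_on_subset by blast+
    show "green_on (ball x (3 * D)) v (\<lambda>x. (\<epsilon>\<^sup>2 + (norm x)\<^sup>2) powr \<alpha> * V x * exp (v x))"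
      by (rule green_on_subset[OF liouville_green_on(2)[OF sol V(1) \<epsilon>] sub])
    show "\<bar>V y - V z\<bar> \<le> \<eta>" if "y \<in> ball x (3 * D)" "z \<in> ball x (3 * D)" for y z
      by (rule osc[OF x that])
  qed (use V(2) lo l sub in auto)
qed

text \<open>Locally uniform convergence on a compact neighbourhood of K carries the oscillation
  bound over to \<open>Vn n\<close>, with \<eta>/2 + 2 * \<eta>/4 = \<eta>. Once \<epsilon> n < 1, a
  negative exponent leaves the weight at least (1 + r^2)^(\<alpha> n), and the limit of this exceeds
  \<kappa>.\<close>

lemma eventual_estimate:
  assumes adm: "admissible_domain \<Omega>" "admissible_coefficients \<Omega> a b \<alpha>0 \<epsilon> \<alpha> Vn V"
    and K: "compact K" "K \<subseteq> \<Omega>" and ec: "estimate_constant a b' \<alpha>0 C1 \<eta> D \<kappa> C2"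
    and bb: "b \<le> b'" and C1: "0 < C1" and \<eta>: "0 < \<eta>" and D: "3 * D < setdist K (frontier \<Omega>)"
    and osc: "\<And>xs x y. xs \<in> K \<Longrightarrow> x \<in> ball xs (3 * D) \<Longrightarrow> y \<in> ball xs (3 * D) \<Longrightarrow> \<bar>V x - V y\<bar> \<le> \<eta> / 2"
    and r: "\<Omega> \<subseteq> cball 0 r" and \<kappa>: "\<kappa> < (1 + r\<^sup>2) powr \<alpha>0"
  shows "\<forall>\<^sub>F n in sequentially. \<forall>v. liouville_solution \<Omega> (\<epsilon> n) (\<alpha> n) (Vn n) v \<longrightarrow> sup_plus_inf C1 K \<Omega> v \<le> ereal C2"
proof -
  have co: "\<And>n. \<epsilon> n > 0" "\<epsilon> \<longlonglongrightarrow> 0" "\<alpha> \<longlonglongrightarrow> \<alpha>0" "\<And>n x. x \<in> \<Omega> \<Longrightarrow> a \<le> Vn n x \<and> Vn n x \<le> b"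
    "\<And>n. continuous_on \<Omega> (Vn n)" "\<And>S. compact S \<Longrightarrow> S \<subseteq> \<Omega> \<Longrightarrow> uniform_limit S Vn V sequentially"
    using adm(2) by (auto simp: admissible_coefficients_def)
  define T where "T = thicken (3 * D) K"
  have T: "compact T" "T \<subseteq> \<Omega>"
    using compact_thicken[OF K(1)] thicken_subset_domain[OF K(2) D] by (auto simp: T_def)
  have e1: "\<forall>\<^sub>F n in sequentially. \<forall>x\<in>T. dist (Vn n x) (V x) < \<eta> / 4"
    using uniform_limitD[OF co(6)[OF T], of "\<eta> / 4"] \<eta> by simp
  have e2: "\<forall>\<^sub>F n in sequentially. \<bar>\<alpha> n - \<alpha>0\<bar> < \<eta>"
    using tendstoD[OF co(3) \<eta>] by (simp add: dist_real_def)
  have e3: "\<forall>\<^sub>F n in sequentially. \<epsilon> n < 1" by (rule order_tendstoD(2)[OF co(2)]) simp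
  have "(\<lambda>n. (1 + r\<^sup>2) powr \<alpha> n) \<longlonglongrightarrow> (1 + r\<^sup>2) powr \<alpha>0"
    by (intro tendsto_powr tendsto_const co(3)) (smt (verit) zero_le_power2)
  then have e4: "\<forall>\<^sub>F n in sequentially. \<kappa> < (1 + r\<^sup>2) powr \<alpha> n" by (rule order_tendstoD(1)[OF _ \<kappa>])
  show ?thesis
    using e1 e2 e3 e4
  proof (eventually_elim, intro allI impI)
    fix n v assume c: "\<forall>x\<in>T. dist (Vn n x) (V x) < \<eta> / 4" and \<alpha>: "\<bar>\<alpha> n - \<alpha>0\<bar> < \<eta>" and \<epsilon>1: "\<epsilon> n < 1"
      and \<kappa>n: "\<kappa> < (1 + r\<^sup>2) powr \<alpha> n" and sol: "liouville_solution \<Omega> (\<epsilon> n) (\<alpha> n) (Vn n) v"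
    have sub: "ball xs (3 * D) \<subseteq> T" if "xs \<in> K" for xs
      using cball_subset_thicken[OF that, of "3 * D"] ball_subset_cball unfolding T_def by blast
    show "sup_plus_inf C1 K \<Omega> v \<le> ereal C2"
    proof (rule liouville_estimate[OF ec C1 _ K _ co(1) \<alpha> co(5) _ _ _ sol])
      show "\<Omega> \<noteq> {}" using adm(1) by (auto simp: admissible_domain_def)
      show "ball xs (3 * D) \<subseteq> \<Omega>" if "xs \<in> K" for xs using sub[OF that] T by blast
      show "a \<le> Vn n x \<and> Vn n x \<le> b'" if "x \<in> \<Omega>" for x using co(4)[OF that, of n] bb by auto
      show "\<bar>Vn n x - Vn n y\<bar> \<le> \<eta>" if "xs \<in> K" "x \<in> ball xs (3 * D)" "y \<in> ball xs (3 * D)" for xs x y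
      proof -
        have "dist (Vn n x) (V x) < \<eta> / 4" "dist (Vn n y) (V y) < \<eta> / 4" using c sub[OF that(1)] that by blast+
        then show ?thesis using osc[OF that] unfolding dist_real_def by linarith
      qed
      show "\<kappa> \<le> ((\<epsilon> n)\<^sup>2 + (norm x)\<^sup>2) powr \<alpha> n" if "\<alpha> n < 0" "x \<in> \<Omega>" for x
      proof -
        have "(norm x)\<^sup>2 \<le> r\<^sup>2" using that r by (intro power_mono) (auto simp: subset_eq)
        moreover have "(\<epsilon> n)\<^sup>2 \<le> 1" using \<epsilon>1 co(1)[of n] by (simp add: power_le_one)
        moreover have "0 < (\<epsilon> n)\<^sup>2 + (norm x)\<^sup>2" using co(1)[of n] by (simp add: add_pos_nonneg)
        ultimately have "(1 + r\<^sup>2) powr \<alpha> n \<le> ((\<epsilon> n)\<^sup>2 + (norm x)\<^sup>2) powr \<alpha> n"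
          using that by (intro powr_mono2') auto
        then show ?thesis using \<kappa>n by simp
      qed
    qed
  qed
qed

text \<open>For one fixed \<epsilon> > 0 the weight is continuous and lies between positive
  constants on the bounded domain. It is absorbed into the coefficient W, which leaves an equation
  with exponent 0, for which the threshold on C1 is 1. This covers the finitely many n that the
  asymptotic estimate does not reach, where \<alpha> n may be any real number.\<close>

lemma regular_estimate:
  fixes \<Omega> :: "(real^2) set"
  assumes adm: "admissible_domain \<Omega>" and K: "compact K" "K \<subseteq> \<Omega>" "K \<noteq> {}" and \<epsilon>: "0 < \<epsilon>" and a: "0 < a"
    and V: "continuous_on \<Omega> V" "\<And>x. x \<in> \<Omega> \<Longrightarrow> a \<le> V x \<and> V x \<le> b" and C1: "1 < C1"
  shows "\<exists>C2>0. \<forall>v. liouville_solution \<Omega> \<epsilon> \<alpha> V v \<longrightarrow> sup_plus_inf C1 K \<Omega> v \<le> ereal C2"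
proof -
  have \<Omega>: "open \<Omega>" "bounded \<Omega>" "\<Omega> \<noteq> {}" using adm by (auto simp: admissible_domain_def)
  define q where "q x = \<epsilon>\<^sup>2 + (norm x)\<^sup>2" for x :: "real^2"
  define W where "W x = q x powr \<alpha> * V x" for x
  have q0: "0 < q x" for x using \<epsilon> by (simp add: q_def add_pos_nonneg)
  obtain r where r: "\<Omega> \<subseteq> cball 0 r" using \<Omega>(2) by (meson ball_subset_cball bounded_subset_ballD order_trans)
  define B where "B = max (max (1 / \<epsilon>\<^sup>2) (\<epsilon>\<^sup>2 + r\<^sup>2)) 1 powr \<bar>\<alpha>\<bar>"
  have B: "0 < B" by (simp add: B_def)
  have qB: "1 / B \<le> q x powr \<alpha>" "q x powr \<alpha> \<le> B" if x: "x \<in> \<Omega>" for x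
  proof -
    define X where "X = max (max (1 / \<epsilon>\<^sup>2) (\<epsilon>\<^sup>2 + r\<^sup>2)) 1"
    have X: "1 \<le> X" by (simp add: X_def)
    have "(norm x)\<^sup>2 \<le> r\<^sup>2" using x r by (intro power_mono) (auto simp: subset_eq)
    then have qX: "q x \<le> X" by (simp add: q_def X_def)
    have "1 / \<epsilon>\<^sup>2 \<le> X" by (simp add: X_def)
    then have "1 / X \<le> \<epsilon>\<^sup>2" using \<epsilon> X by (simp add: field_simps)
    then have "1 / X \<le> q x" by (simp add: q_def add_increasing2)
    then have "ln (1 / X) \<le> ln (q x)" using X by (intro ln_mono) auto
    moreover have "ln (q x) \<le> ln X" using qX q0[of x] by (intro ln_mono) auto
    ultimately have "\<bar>ln (q x)\<bar> \<le> ln X" using X by (simp add: ln_div abs_le_iff)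
    then have "\<bar>\<alpha> * ln (q x)\<bar> \<le> \<bar>\<alpha>\<bar> * ln X" unfolding abs_mult by (intro mult_left_mono) auto
    then have "- (\<bar>\<alpha>\<bar> * ln X) \<le> \<alpha> * ln (q x)" "\<alpha> * ln (q x) \<le> \<bar>\<alpha>\<bar> * ln X" by (auto simp: abs_le_iff)
    moreover have "q x powr \<alpha> = exp (\<alpha> * ln (q x))" using q0[of x] by (simp add: powr_def)
    moreover have "B = exp (\<bar>\<alpha>\<bar> * ln X)" using X by (simp add: B_def X_def powr_def)
    moreover have "1 / B = exp (- (\<bar>\<alpha>\<bar> * ln X))" using calculation by (simp add: exp_minus divide_inverse)
    ultimately show "1 / B \<le> q x powr \<alpha>" "q x powr \<alpha> \<le> B" by simp_all
  qed
  obtain z where "z \<in> \<Omega>" using \<Omega> by blast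
  then have ab: "a \<le> b" using V(2) by force
  define a' where "a' = a * (1 / B)"
  define b' where "b' = max a' (b * B)"
  have a': "0 < a'" "a' \<le> b'" using a B by (auto simp: a'_def b'_def)
  have Wab: "a' \<le> W x \<and> W x \<le> b'" if "x \<in> \<Omega>" for x
  proof
    have "a * (1 / B) \<le> V x * q x powr \<alpha>" using V(2)[OF that] qB[OF that] a B by (intro mult_mono) auto
    then show "a' \<le> W x" by (simp add: a'_def W_def mult.commute)
    have "V x * q x powr \<alpha> \<le> b * B" using V(2)[OF that] qB[OF that] a ab by (intro mult_mono) auto
    then show "W x \<le> b'" by (simp add: b'_def W_def mult.commute)
  qed
  have "q x \<noteq> 0" for x using q0[of x] by simp
  then have cW: "continuous_on \<Omega> W"
    unfolding W_def[abs_def] q_def[abs_def] by (intro continuous_intros V) auto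
  have "C1 > max 1 ((1 + 0) / (1 - 0))" using C1 by simp
  from local_estimate[OF a' _ _ this] obtain \<eta> where \<eta>: "0 < \<eta>"
    and est: "\<forall>D>0. \<forall>\<kappa>>0. \<exists>C2>0. estimate_constant a' b' 0 C1 \<eta> D \<kappa> C2"
    by auto
  have d: "0 < setdist K (frontier \<Omega>)" by (rule setdist_frontier_pos[OF \<Omega>(1,2) K])
  obtain D where D: "0 < D" "3 * D < setdist K (frontier \<Omega>)"
    "\<And>xs x y. xs \<in> K \<Longrightarrow> x \<in> ball xs (3 * D) \<Longrightarrow> y \<in> ball xs (3 * D) \<Longrightarrow> \<bar>W x - W y\<bar> \<le> \<eta>"
    using small_oscillation[OF K(1,2) d _ \<eta>, of W] continuous_on_subset[OF cW] by blast
  obtain C2 where C2: "0 < C2" "estimate_constant a' b' 0 C1 \<eta> D 1 C2" using est D(1) zero_less_one by blast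
  have "sup_plus_inf C1 K \<Omega> v \<le> ereal C2" if sol: "liouville_solution \<Omega> \<epsilon> \<alpha> V v" for v
  proof (rule liouville_estimate[OF C2(2) _ \<Omega>(3) K(1,2) _ \<epsilon> _ cW Wab D(3), where \<alpha> = 0])
    show "ball xs (3 * D) \<subseteq> \<Omega>" if "xs \<in> K" for xs
      using cball_subset_domain[OF K(2) D(2) that] ball_subset_cball by blast
    have "(\<epsilon>\<^sup>2 + (norm x)\<^sup>2) powr 0 = 1" for x :: "real^2" using \<epsilon> by simp
    then have "(\<lambda>x. (\<epsilon>\<^sup>2 + (norm x)\<^sup>2) powr 0 * W x * exp (v x)) = (\<lambda>x. (\<epsilon>\<^sup>2 + (norm x)\<^sup>2) powr \<alpha> * V x * exp (v x))"
      by (simp add: W_def q_def)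
    then show "liouville_solution \<Omega> \<epsilon> 0 W v" using sol by (simp only: liouville_solution_def)
  qed (use C1 \<eta> in auto)
  then show ?thesis using C2(1) by blast
qed

lemma sup_plus_inf_empty:
  assumes "\<Omega> \<noteq> {}" "0 < C"
  shows "sup_plus_inf C {} \<Omega> v \<le> ereal C2"
proof -
  obtain z where "z \<in> \<Omega>" using assms by blast
  then have "(INF x\<in>\<Omega>. ereal (v x)) \<le> ereal (v z)" by (rule INF_lower)
  then have "(INF x\<in>\<Omega>. ereal (v x)) \<noteq> \<infinity>" by auto
  then have "ereal C * (INF x\<in>\<Omega>. ereal (v x)) \<noteq> \<infinity>"
    using assms(2) by (cases "INF x\<in>\<Omega>. ereal (v x)") auto
  then show ?thesis by (cases "ereal C * (INF x\<in>\<Omega>. ereal (v x))") (auto simp: sup_plus_inf_def bot_ereal_def)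
qed

theorem theorem1p1:
  fixes a b \<alpha>lim C1 :: real
  assumes "0 < a" and "-1 < \<alpha>lim" and "\<alpha>lim < 1"
    and "C1 > max 1 ((1 + \<alpha>lim) / (1 - \<alpha>lim))"
  shows
    \<comment> \<open>the estimate, for every n, with a constant that does not depend on the solutions\<close>
    "(\<forall>\<Omega> \<epsilon> \<alpha> Vn V K.
        admissible_domain \<Omega> \<and> admissible_coefficients \<Omega> a b \<alpha>lim \<epsilon> \<alpha> Vn V \<and>
        compact K \<and> K \<subseteq> \<Omega> \<longrightarrow>
        (\<exists>C2>0. \<forall>v. (\<forall>n. liouville_solution \<Omega> (\<epsilon> n) (\<alpha> n) (Vn n) (v n)) \<longrightarrow>
           (\<forall>n. sup_plus_inf C1 K \<Omega> (v n) \<le> ereal C2)))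
     \<and>
     (\<forall>(d::real) (\<omega>::real \<Rightarrow> real) (R::real). \<exists>C2>0.
        \<forall>\<Omega> \<epsilon> \<alpha> Vn V K v.
          admissible_domain \<Omega> \<and> admissible_coefficients \<Omega> a b \<alpha>lim \<epsilon> \<alpha> Vn V \<and>
          (\<alpha>lim < 0 \<longrightarrow> \<Omega> \<subseteq> cball 0 R) \<and>
          compact K \<and> K \<subseteq> \<Omega> \<and> setdist K (frontier \<Omega>) = d \<and>
          modulus_of_continuity_on \<omega> K \<Omega> V \<and>
          (\<forall>n. liouville_solution \<Omega> (\<epsilon> n) (\<alpha> n) (Vn n) (v n)) \<longrightarrow>
          (\<forall>\<^sub>F n in sequentially. sup_plus_inf C1 K \<Omega> (v n) \<le> ereal C2))"
    \<comment> \<open>the dependence of the constant, which concerns all large n\<close>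
proof -
  have C1: "1 < C1" "0 < C1" using assms(4) by auto
  \<comment> \<open>The tolerance \<eta> has to be fixed before any coefficients are given; that a
    \<le> b is only seen from a coefficient evaluated at a point of the domain.\<close>
  define b' where "b' = max a b"
  have ab: "a \<le> b'" "b \<le> b'" by (auto simp: b'_def)
  obtain \<eta> where \<eta>: "0 < \<eta>"
    and est: "\<forall>D>0. \<forall>\<kappa>>0. \<exists>C2>0. estimate_constant a b' \<alpha>lim C1 \<eta> D \<kappa> C2"
    using local_estimate[OF assms(1) ab(1) assms(2-4)] by auto
  show ?thesis
  proof (intro conjI allI impI)
    fix \<Omega> :: "(real^2) set" and \<epsilon> \<alpha> :: "nat \<Rightarrow> real" and Vn :: "nat \<Rightarrow> real^2 \<Rightarrow> real" and V K
    assume "admissible_domain \<Omega> \<and> admissible_coefficients \<Omega> a b \<alpha>lim \<epsilon> \<alpha> Vn V \<and> compact K \<and> K \<subseteq> \<Omega>"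
    then have adm: "admissible_domain \<Omega>" and coe: "admissible_coefficients \<Omega> a b \<alpha>lim \<epsilon> \<alpha> Vn V"
      and K: "compact K" "K \<subseteq> \<Omega>" by auto
    have \<Omega>: "open \<Omega>" "bounded \<Omega>" "\<Omega> \<noteq> {}" using adm by (auto simp: admissible_domain_def)
    have co: "\<And>n. \<epsilon> n > 0" "\<And>n x. x \<in> \<Omega> \<Longrightarrow> a \<le> Vn n x \<and> Vn n x \<le> b"
      "\<And>n. continuous_on \<Omega> (Vn n)" "\<And>S. compact S \<Longrightarrow> S \<subseteq> \<Omega> \<Longrightarrow> uniform_limit S Vn V sequentially"
      using coe by (auto simp: admissible_coefficients_def)
    show "\<exists>C2>0. \<forall>v. (\<forall>n. liouville_solution \<Omega> (\<epsilon> n) (\<alpha> n) (Vn n) (v n)) \<longrightarrow>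
           (\<forall>n. sup_plus_inf C1 K \<Omega> (v n) \<le> ereal C2)"
    proof (cases "K = {}")
      case True
      then show ?thesis using sup_plus_inf_empty[OF \<Omega>(3) C1(2)] zero_less_one by blast
    next
      case K0: False
      have d: "0 < setdist K (frontier \<Omega>)" by (rule setdist_frontier_pos[OF \<Omega>(1,2) K K0])
      have cV: "continuous_on T V" if T: "compact T" "T \<subseteq> \<Omega>" for T
        by (rule uniform_limit_theorem[OF _ co(4)[OF T]]) (use continuous_on_subset[OF co(3) T(2)] in auto)
      have "0 < \<eta> / 2" using \<eta> by simp
      from small_oscillation[OF K d cV this]
      obtain D where D: "0 < D" "3 * D < setdist K (frontier \<Omega>)"
        "\<And>xs x y. xs \<in> K \<Longrightarrow> x \<in> ball xs (3 * D) \<Longrightarrow> y \<in> ball xs (3 * D) \<Longrightarrow> \<bar>V x - V y\<bar> \<le> \<eta> / 2"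
        by blast
      obtain r where r: "\<Omega> \<subseteq> cball 0 r" using \<Omega>(2) by (meson ball_subset_cball bounded_subset_ballD order_trans)
      \<comment> \<open>Half of the limiting lower bound of the weight, so that the inequality is
        strict and survives for \<alpha> n with n large.\<close>
      define \<kappa> where "\<kappa> = (1 + r\<^sup>2) powr \<alpha>lim / 2"
      have "1 + r\<^sup>2 \<noteq> 0" by (smt (verit) zero_le_power2)
      then have \<kappa>: "0 < \<kappa>" "\<kappa> < (1 + r\<^sup>2) powr \<alpha>lim" by (auto simp: \<kappa>_def)
      obtain C where C: "0 < C" "estimate_constant a b' \<alpha>lim C1 \<eta> D \<kappa> C" using est D(1) \<kappa>(1) by blast
      have "\<forall>\<^sub>F n in sequentially. \<forall>v. liouville_solution \<Omega> (\<epsilon> n) (\<alpha> n) (Vn n) v \<longrightarrow> sup_plus_inf C1 K \<Omega> v \<le> ereal C"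
        by (rule eventual_estimate[OF adm coe K C(2) ab(2) C1(2) \<eta> D(2) D(3) r \<kappa>(2)])
      then obtain n0 where n0: "\<And>n v. n0 \<le> n \<Longrightarrow> liouville_solution \<Omega> (\<epsilon> n) (\<alpha> n) (Vn n) v \<Longrightarrow> sup_plus_inf C1 K \<Omega> v \<le> ereal C"
        unfolding eventually_sequentially by blast
      have "\<exists>c>0. \<forall>v. liouville_solution \<Omega> (\<epsilon> n) (\<alpha> n) (Vn n) v \<longrightarrow> sup_plus_inf C1 K \<Omega> v \<le> ereal c" for n
        by (rule regular_estimate[OF adm K K0 co(1) assms(1) co(3) co(2) C1(1)])
      then obtain c where c: "\<And>n. 0 < c n"
        "\<And>n v. liouville_solution \<Omega> (\<epsilon> n) (\<alpha> n) (Vn n) v \<Longrightarrow> sup_plus_inf C1 K \<Omega> v \<le> ereal (c n)" by metis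
      \<comment> \<open>A sum over the finitely many early n serves as a common bound for their
        constants and stays positive also for n0 = 0.\<close>
      define C2 where "C2 = C + (\<Sum>n<n0. c n)"
      have s0: "0 \<le> (\<Sum>n<n0. c n)" using c(1) by (intro sum_nonneg) (auto intro: less_imp_le)
      have "sup_plus_inf C1 K \<Omega> v \<le> ereal C2" if sol: "liouville_solution \<Omega> (\<epsilon> n) (\<alpha> n) (Vn n) v" for n v
      proof (cases "n0 \<le> n")
        case True
        have "sup_plus_inf C1 K \<Omega> v \<le> ereal C" by (rule n0[OF True sol])
        also have "\<dots> \<le> ereal C2" using s0 by (simp add: C2_def)
        finally show ?thesis .
      next
        case False
        have "c n \<le> (\<Sum>n<n0. c n)" using False c(1) by (intro member_le_sum) (auto intro: less_imp_le)
        then have "ereal (c n) \<le> ereal C2" using C(1) by (simp add: C2_def)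
        then show ?thesis using c(2)[OF sol] by (rule order_trans[rotated])
      qed
      moreover have "0 < C2" using C(1) s0 by (simp add: C2_def)
      ultimately show ?thesis by blast
    qed
  next
    fix d R :: real and \<omega> :: "real \<Rightarrow> real"
    \<comment> \<open>Must be fixed before the domain. For a negative limit exponent the radius R
      bounds the weight from below; otherwise (1 + r^2) to that power is at least 1 for every r, and
      1/2 lies strictly below.\<close>
    define \<kappa> where "\<kappa> = (if \<alpha>lim < 0 then (1 + R\<^sup>2) powr \<alpha>lim else 1) / 2"
    have "1 + R\<^sup>2 \<noteq> 0" by (smt (verit) zero_le_power2)
    then have \<kappa>: "0 < \<kappa>" by (auto simp: \<kappa>_def)
    show "\<exists>C2>0. \<forall>\<Omega> \<epsilon> \<alpha> Vn V K v.
          admissible_domain \<Omega> \<and> admissible_coefficients \<Omega> a b \<alpha>lim \<epsilon> \<alpha> Vn V \<and>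
          (\<alpha>lim < 0 \<longrightarrow> \<Omega> \<subseteq> cball 0 R) \<and>
          compact K \<and> K \<subseteq> \<Omega> \<and> setdist K (frontier \<Omega>) = d \<and>
          modulus_of_continuity_on \<omega> K \<Omega> V \<and>
          (\<forall>n. liouville_solution \<Omega> (\<epsilon> n) (\<alpha> n) (Vn n) (v n)) \<longrightarrow>
          (\<forall>\<^sub>F n in sequentially. sup_plus_inf C1 K \<Omega> (v n) \<le> ereal C2)"
    \<comment> \<open>If d is not positive or \<omega> does not tend to 0, the premises can only
      hold for empty K, and the supremum over the empty set is minus infinity.\<close>
    proof (cases "0 < d \<and> (\<omega> \<longlongrightarrow> 0) (at_right 0)")
      case True
      have "\<forall>\<^sub>F r in at_right 0. \<omega> r < \<eta> / 4" using True \<eta> by (intro order_tendstoD(2)[of \<omega> 0]) auto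
      then obtain \<rho> where \<rho>: "0 < \<rho>" "\<And>r. 0 < r \<Longrightarrow> r < \<rho> \<Longrightarrow> \<omega> r < \<eta> / 4"
        unfolding eventually_at_right_field by auto
      define D where "D = min d \<rho> / 6"
      have D: "0 < D" "3 * D < d" "3 * D < \<rho>" using True \<rho>(1) by (auto simp: D_def min_def)
      obtain C where C: "0 < C" "estimate_constant a b' \<alpha>lim C1 \<eta> D \<kappa> C" using est D(1) \<kappa> by blast
      show ?thesis
      proof (rule exI[of _ C], intro conjI allI impI C(1))
        fix \<Omega> :: "(real^2) set" and \<epsilon> \<alpha> :: "nat \<Rightarrow> real" and Vn v :: "nat \<Rightarrow> real^2 \<Rightarrow> real" and V K
        assume "admissible_domain \<Omega> \<and> admissible_coefficients \<Omega> a b \<alpha>lim \<epsilon> \<alpha> Vn V \<and>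
          (\<alpha>lim < 0 \<longrightarrow> \<Omega> \<subseteq> cball 0 R) \<and>
          compact K \<and> K \<subseteq> \<Omega> \<and> setdist K (frontier \<Omega>) = d \<and>
          modulus_of_continuity_on \<omega> K \<Omega> V \<and>
          (\<forall>n. liouville_solution \<Omega> (\<epsilon> n) (\<alpha> n) (Vn n) (v n))"
        then have adm: "admissible_domain \<Omega>" and coe: "admissible_coefficients \<Omega> a b \<alpha>lim \<epsilon> \<alpha> Vn V"
          and R: "\<alpha>lim < 0 \<Longrightarrow> \<Omega> \<subseteq> cball 0 R" and K: "compact K" "K \<subseteq> \<Omega>" and d: "setdist K (frontier \<Omega>) = d"
          and mod: "\<And>x y. x \<in> K \<Longrightarrow> y \<in> \<Omega> \<Longrightarrow> \<bar>V x - V y\<bar> \<le> \<omega> (dist x y)"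
          and sol: "\<And>n. liouville_solution \<Omega> (\<epsilon> n) (\<alpha> n) (Vn n) (v n)"
          by (auto simp: modulus_of_continuity_on_def)
        have osc1: "\<bar>V xs - V x\<bar> \<le> \<eta> / 4" if "xs \<in> K" "x \<in> ball xs (3 * D)" for xs x
        \<comment> \<open>The limit of \<omega> from the right says nothing about \<omega> 0, so the
          centre itself is treated apart.\<close>
        proof (cases "x = xs")
          case False
          have "x \<in> \<Omega>" using cball_subset_domain[OF K(2) _ that(1), of "3 * D"] D(2) d that(2) by auto
          from mod[OF that(1) this] have "\<bar>V xs - V x\<bar> \<le> \<omega> (dist xs x)" .
          also have "\<dots> \<le> \<eta> / 4" using \<rho>(2)[of "dist xs x"] that(2) False D(3) by auto
          finally show ?thesis .
        qed (use \<eta> in simp)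
        have osc: "\<bar>V x - V y\<bar> \<le> \<eta> / 2" if "xs \<in> K" "x \<in> ball xs (3 * D)" "y \<in> ball xs (3 * D)" for xs x y
          using osc1[OF that(1,2)] osc1[OF that(1,3)] by linarith
        obtain r where r: "\<Omega> \<subseteq> cball 0 r" "\<kappa> < (1 + r\<^sup>2) powr \<alpha>lim"
        proof (cases "\<alpha>lim < 0")
          case True
          have "\<kappa> < (1 + R\<^sup>2) powr \<alpha>lim" using True \<open>1 + R\<^sup>2 \<noteq> 0\<close> by (simp add: \<kappa>_def)
          then show thesis using that[OF R[OF True]] by blast
        next
          case False
          obtain r where r: "\<Omega> \<subseteq> cball 0 r"
            using adm unfolding admissible_domain_def
            by (meson ball_subset_cball bounded_subset_ballD order_trans)
          have "1 \<le> (1 + r\<^sup>2) powr \<alpha>lim" using False by (intro ge_one_powr_ge_zero) auto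
          then show thesis using that[OF r] False by (simp add: \<kappa>_def)
        qed
        have Dd: "3 * D < setdist K (frontier \<Omega>)" using D(2) d by simp
        have "\<forall>\<^sub>F n in sequentially. \<forall>v. liouville_solution \<Omega> (\<epsilon> n) (\<alpha> n) (Vn n) v \<longrightarrow> sup_plus_inf C1 K \<Omega> v \<le> ereal C"
          by (rule eventual_estimate[OF adm coe K C(2) ab(2) C1(2) \<eta> Dd osc r])
        then show "\<forall>\<^sub>F n in sequentially. sup_plus_inf C1 K \<Omega> (v n) \<le> ereal C"
          by (rule eventually_mono) (use sol in auto)
      qed
    next
      case False
      show ?thesis
      proof (rule exI[of _ 1], intro conjI allI impI zero_less_one)
        fix \<Omega> :: "(real^2) set" and \<epsilon> \<alpha> :: "nat \<Rightarrow> real" and Vn v :: "nat \<Rightarrow> real^2 \<Rightarrow> real" and V K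
        assume H: "admissible_domain \<Omega> \<and> admissible_coefficients \<Omega> a b \<alpha>lim \<epsilon> \<alpha> Vn V \<and>
          (\<alpha>lim < 0 \<longrightarrow> \<Omega> \<subseteq> cball 0 R) \<and>
          compact K \<and> K \<subseteq> \<Omega> \<and> setdist K (frontier \<Omega>) = d \<and>
          modulus_of_continuity_on \<omega> K \<Omega> V \<and>
          (\<forall>n. liouville_solution \<Omega> (\<epsilon> n) (\<alpha> n) (Vn n) (v n))"
        then have \<Omega>: "open \<Omega>" "bounded \<Omega>" "\<Omega> \<noteq> {}" by (auto simp: admissible_domain_def)
        have "K = {}"
        proof (rule ccontr)
          assume "K \<noteq> {}"
          then have "0 < d" using setdist_frontier_pos[OF \<Omega>(1,2), of K] H by auto
          then show False using False H by (auto simp: modulus_of_continuity_on_def)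
        qed
        then show "\<forall>\<^sub>F n in sequentially. sup_plus_inf C1 K \<Omega> (v n) \<le> ereal 1"
          using sup_plus_inf_empty[OF \<Omega>(3) C1(2)] by auto
      qed
    qed
  qed
qed

end
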